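(* Let $\chi^*=(z^*,\lambda^* )$, $z^*=(L^*,\xi^* )$, be a global solution of problem (P) together with its Lagrange multiplier $\lambda^*=0$, and assume it satisfies the first order necessary conditions and the second order sufficient conditions with constant $\underline{\mathcal B}>0$. Moreover, let there be $c>0$ and $u\in\mathbb R^2$ with $\|u\|=1$ such that $u^T\xi^*_\tau(\tau)\ge c$ for almost all $\tau\in\,]0,1[$. Let $\omega:=\omega_1\omega_2$, with $\omega_1=\omega_1(R)$ and $\omega_2=\omega_2(R)=(8+\hat{\mathcal B})R$ as defined in the context. Then there is $R_C>0$ such that the ordinary Newton iterates $\chi^k$ converge to $\chi^*$ at the estimated rate $$\|\chi^{k+1}-\chi^*\|_{Y^2}\le \frac{\omega}{2}\,\|\chi^k-\chi^*\|_{Y^2},$$ provided they are initialized with $\chi^0\in\mathcal N_{R_C}(\chi^* )$ and the iterates $\chi^k$ remain in $\mathcal N_{R_C}(\chi^* )$. Moreover, $\chi^*$ is the unique solution of $F(\chi)=0$ in $\mathcal N_{R_C}(\chi^* )$.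
   Context: Setting (free flight problem). Fix an airspeed $\bar v>0$, points $x_O,x_D\in\mathbb R^2$ (origin, destination), $\tilde L:=\|x_D-x_O\|$, and a wind field $w\in C^3(\mathbb R^2,\mathbb R^2)$ with $\|w(x)\|<\bar v$ for all $x$. $\|\cdot\|$ is the Euclidean norm; for a (vector-valued) function $g$, $\|g\|_{L^\infty(D)}:=\inf\{C\ge0:\|g(x)\|\le C \text{ for a.a. } x\in D\}$ (default $D=]0,1[$), and $\|g\|_{L^2}$ is the $L^2(]0,1[)$ norm with the Euclidean norm pointwise. Let $\Omega\subset\mathbb R^2$ be an ellipse with foci $x_O,x_D$ containing every globally optimal trajectory. Constants: $\|w\|_{L^\infty(\Omega)}\le\bar c_0\le\bar v/\sqrt5$, $\|w_x\|_{L^\infty(\Omega)}\le\bar c_1$, $\|w_{xx}\|_{L^\infty(\Omega)}\le\bar c_2$, $\|w_{xxx}\|_{L^\infty(\Omega)}\le\bar c_3$, and $\underline v^2:=\bar v^2-\bar c_0^2$. For $x,p\in\mathbb R^2$ let $f(x,p)=\frac{-p^Tw(x)+\sqrt{(p^Tw(x))^2+(\bar v^2-w(x)^Tw(x))\,p^Tp}}{\bar v^2-w(x)^Tw(x)}$. Let $X=\{\xi\in W^{1,\infty}(]0,1[,\mathbb R^2):\xi(0)=x_O,\xi(1)=x_D\}$, $\delta X=W^{1,\infty}_0(]0,1[,\mathbb R^2)$, $\xi_\tau$ the derivative, and $T(\xi)=\int_0^1 f(\xi(\tau),\xi_\tau(\tau))\,d\tau$, with Fréchet derivatives $T',T'',\dots$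 in directions from $\delta X$. Problem (P): minimize $T(\xi)$ over $\xi\in X$, $L\in\mathbb R$, subject to $\|\xi_\tau(\tau)\|^2=L^2$ for a.a. $\tau$. Write $z=(L,\xi)\in Z=\mathbb R\times X$, $\delta z=(\delta L,\delta\xi)\in\delta Z=\mathbb R\times\delta X$, $h(z)=\xi_\tau^T\xi_\tau-L^2\in\Lambda:=L^\infty(]0,1[)$. Norms: $\|z\|_{Z^\infty}=|L|+\|\xi\|_{L^\infty}+\|\xi_\tau\|_{L^\infty}$, $\|z\|_{Z^2}=|L|+\|\xi\|_{L^2}+\|\xi_\tau\|_{L^2}$; for $\chi=(z,\lambda)$ (multiplier $\lambda$ a function on $]0,1[$), $\|\chi\|_{Y^\infty}=\|z\|_{Z^\infty}+\|\lambda\|_{L^\infty}$, $\|\chi\|_{Y^2}=\|z\|_{Z^2}+\|\lambda\|_{L^2}$, and $\mathcal N_R(\chi^* )=\{\chi:\|\chi-\chi^*\|_{Y^\infty}\le R\}$. Lagrangian $\mathcal L(z,\lambda)=T(\xi)+\int_0^1\lambda\,h(z)\,d\tau$; $F(\chi):=\mathcal L'(z,\lambda)$ (total derivative, i.e. $F(\chi)[\delta z,\delta\lambda]=T'(\xi)[\delta\xi]+2\int_0^1\lambda(\xi_\tau^T\delta\xi_\tau-L\delta L)d\tau+\int_0^1\delta\lambda\,h(z)d\tau$), and $F'(\chi)$ its derivative (KKT operator). Newton iteration: given $\chi^0$, solve $F'(\chi^k)[\Delta\chi^k]=-F(\chi^k)$ and set $\chi^{k+1}=\chi^k+\Delta\chi^k$.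 First order conditions: $F(\chi^* )=0$. Second order sufficient conditions with $\underline{\mathcal B}>0$: there is $\kappa>0$ with $\inf_{0\ne\delta\lambda\in L^2}\sup_{\delta z\in\delta Z}\frac{\int_0^1\delta\lambda(2\xi^{*T}_\tau\delta\xi_\tau-2L^*\delta L)d\tau}{\|\delta\lambda\|_{L^2}\|\delta z\|_{Z^2}}\ge\kappa$, and $T''(\xi^* )[\delta\xi]^2\ge\underline{\mathcal B}\|\delta z\|_{Z^2}^2$ for all $\delta z\in\delta Z$ with $\delta\xi_\tau^T\xi^*_\tau=\delta L\,L^*$ a.e. Constants: $\kappa(R)=(c-R)\big[\tfrac38+2\big(\tfrac{\bar v+\bar c_0}{\bar v-\bar c_0}+\tfrac{R}{\tilde L}\big)^2\big]^{-1/2}$; $\bar\beta_0=14\bar c_1^2/\underline v^3+4\bar c_2/\underline v^2$, $\bar\beta_1=7\bar c_1/\underline v^2$, $\bar\beta_2=4/\underline v$; $\bar{\mathcal B}(R)=\bar\beta_1+\max\{(\tfrac{\bar v+\bar c_0}{\bar v-\bar c_0}\tilde L+R)\bar\beta_0,\ \bar\beta_2/(\tilde L+R)\}$; $\omega_1=\sqrt2\max\{\tfrac{4}{\underline{\mathcal B}},\ \tfrac1\kappa(1+\tfrac{4(\bar{\mathcal B}+R)}{\underline{\mathcal B}}),\ \tfrac{\bar{\mathcal B}+R}{\kappa^2}\}$; $\omega_2=(8+\hat{\mathcal B})R$, where $\hat{\mathcal B}<\infty$ is a constant such that $\|(F'(\chi_2)-F'(\chi_1))[\chi_2-\chi_1]\|_{Y^2}\le\omega_2\|\chi_2-\chi_1\|_{Y^2}$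 for $\chi_1,\chi_2\in\mathcal N_R(\chi^* )$ (norm of the functional $\delta\chi\mapsto (F'(\chi_2)-F'(\chi_1))[\chi_2-\chi_1,\delta\chi]$ over $\|\delta\chi\|_{Y^2}\le1$). *)

theory Defs
  imports "HOL-Analysis.Analysis"
begin

type_synonym vec2 = "real^2"

definition D1 :: "(vec2 \<Rightarrow> vec2) \<Rightarrow> vec2 \<Rightarrow> vec2 \<Rightarrow> vec2" where
  "D1 w x a = frechet_derivative w (at x) a"

definition D2 :: "(vec2 \<Rightarrow> vec2) \<Rightarrow> vec2 \<Rightarrow> vec2 \<Rightarrow> vec2 \<Rightarrow> vec2" where
  "D2 w x a b = frechet_derivative (\<lambda>y. D1 w y a) (at x) b"

definition D3 :: "(vec2 \<Rightarrow> vec2) \<Rightarrow> vec2 \<Rightarrow> vec2 \<Rightarrow> vec2 \<Rightarrow> vec2 \<Rightarrow> vec2" where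
  "D3 w x a b c = frechet_derivative (\<lambda>y. D2 w y a b) (at x) c"

definition C3 :: "(vec2 \<Rightarrow> vec2) \<Rightarrow> bool" where
  "C3 w \<longleftrightarrow> (\<forall>x. w differentiable (at x))
     \<and> (\<forall>a x. (\<lambda>y. D1 w y a) differentiable (at x))
     \<and> (\<forall>a b x. (\<lambda>y. D2 w y a b) differentiable (at x))
     \<and> (\<forall>a b c. continuous_on UNIV (\<lambda>y. D3 w y a b c))"

definition nD1 :: "(vec2 \<Rightarrow> vec2) \<Rightarrow> vec2 \<Rightarrow> real" where
  "nD1 w x = sqrt (\<Sum>a\<in>Basis. (norm (D1 w x a))\<^sup>2)"
definition nD2 :: "(vec2 \<Rightarrow> vec2) \<Rightarrow> vec2 \<Rightarrow> real" where
  "nD2 w x = sqrt (\<Sum>a\<in>Basis. \<Sum>b\<in>Basis. (norm (D2 w x a b))\<^sup>2)"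
definition nD3 :: "(vec2 \<Rightarrow> vec2) \<Rightarrow> vec2 \<Rightarrow> real" where
  "nD3 w x = sqrt (\<Sum>a\<in>Basis. \<Sum>b\<in>Basis. \<Sum>c\<in>Basis. (norm (D3 w x a b c))\<^sup>2)"

definition Linf_bound_on :: "vec2 set \<Rightarrow> (vec2 \<Rightarrow> real) \<Rightarrow> real \<Rightarrow> bool" where
  "Linf_bound_on D g C \<longleftrightarrow> (AE x in lebesgue. x \<in> D \<longrightarrow> g x \<le> C)"

definition ff :: "real \<Rightarrow> (vec2 \<Rightarrow> vec2) \<Rightarrow> vec2 \<Rightarrow> vec2 \<Rightarrow> real" where
  "ff v w x p = (- (p \<bullet> w x) + sqrt ((p \<bullet> w x)\<^sup>2 + (v\<^sup>2 - w x \<bullet> w x) * (p \<bullet> p)))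
                 / (v\<^sup>2 - w x \<bullet> w x)"

definition I01 :: "real set" where "I01 = {0<..<1}"

definition Linf :: "(real \<Rightarrow> 'a::real_normed_vector) \<Rightarrow> real" where
  "Linf g = Inf {C. C \<ge> 0 \<and> (AE t in lborel. t \<in> I01 \<longrightarrow> norm (g t) \<le> C)}"

definition L2n :: "(real \<Rightarrow> 'a::real_normed_vector) \<Rightarrow> real" where
  "L2n g = sqrt (set_lebesgue_integral lborel I01 (\<lambda>t. (norm (g t))\<^sup>2))"

definition is_Linf :: "(real \<Rightarrow> 'a::real_normed_vector) \<Rightarrow> bool" where
  "is_Linf g \<longleftrightarrow> set_borel_measurable lborel I01 g
      \<and> (\<exists>C. AE t in lborel. t \<in> I01 \<longrightarrow> norm (g t) \<le> C)"

definition is_L2 :: "(real \<Rightarrow> 'a::real_normed_vector) \<Rightarrow> bool" where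
  "is_L2 g \<longleftrightarrow> set_borel_measurable lborel I01 g
      \<and> set_integrable lborel I01 (\<lambda>t. (norm (g t))\<^sup>2)"

text \<open>\<open>\<xi> \<in> W^{1,\<infinity>}(]0,1[,\<real>^2)\<close> with weak derivative \<open>\<xi>'\<close>: \<open>\<xi>'\<close> is essentially bounded
  and \<open>\<xi>\<close> (its continuous representative on [0,1]) is the integral of \<open>\<xi>'\<close>.\<close>
definition W1inf :: "(real \<Rightarrow> vec2) \<Rightarrow> (real \<Rightarrow> vec2) \<Rightarrow> bool" where
  "W1inf \<xi> \<xi>' \<longleftrightarrow> is_Linf \<xi>'
      \<and> (\<forall>t\<in>{0..1}. \<xi> t = \<xi> 0 + set_lebesgue_integral lborel {0..t} \<xi>')"

record state =
  sL :: real
  sxi :: "real \<Rightarrow> vec2"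
  sdxi :: "real \<Rightarrow> vec2"
  slam :: "real \<Rightarrow> real"

definition sadd :: "state \<Rightarrow> state \<Rightarrow> state" where
  "sadd a b = \<lparr>sL = sL a + sL b, sxi = (\<lambda>t. sxi a t + sxi b t),
               sdxi = (\<lambda>t. sdxi a t + sdxi b t), slam = (\<lambda>t. slam a t + slam b t)\<rparr>"

definition sscale :: "real \<Rightarrow> state \<Rightarrow> state" where
  "sscale s a = \<lparr>sL = s * sL a, sxi = (\<lambda>t. s *\<^sub>R sxi a t),
                 sdxi = (\<lambda>t. s *\<^sub>R sdxi a t), slam = (\<lambda>t. s * slam a t)\<rparr>"

definition sdiff :: "state \<Rightarrow> state \<Rightarrow> state" where
  "sdiff a b = sadd a (sscale (-1) b)"

definition Z2n :: "state \<Rightarrow> real" where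
  "Z2n a = \<bar>sL a\<bar> + L2n (sxi a) + L2n (sdxi a)"

definition Y2n :: "state \<Rightarrow> real" where
  "Y2n a = Z2n a + L2n (slam a)"

definition Yinfn :: "state \<Rightarrow> real" where
  "Yinfn a = \<bar>sL a\<bar> + Linf (sxi a) + Linf (sdxi a) + Linf (slam a)"

definition inZ :: "vec2 \<Rightarrow> vec2 \<Rightarrow> state \<Rightarrow> bool" where
  "inZ xO xD a \<longleftrightarrow> W1inf (sxi a) (sdxi a) \<and> sxi a 0 = xO \<and> sxi a 1 = xD"

definition indZ :: "state \<Rightarrow> bool" where
  "indZ a \<longleftrightarrow> W1inf (sxi a) (sdxi a) \<and> sxi a 0 = 0 \<and> sxi a 1 = 0"

definition inY :: "vec2 \<Rightarrow> vec2 \<Rightarrow> state \<Rightarrow> bool" where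
  "inY xO xD a \<longleftrightarrow> inZ xO xD a \<and> is_Linf (slam a)"

definition indY :: "state \<Rightarrow> bool" where
  "indY a \<longleftrightarrow> indZ a \<and> is_Linf (slam a)"

definition Nbhd :: "vec2 \<Rightarrow> vec2 \<Rightarrow> real \<Rightarrow> state \<Rightarrow> state set" where
  "Nbhd xO xD R cs = {a. inY xO xD a \<and> Yinfn (sdiff a cs) \<le> R}"

definition TT :: "real \<Rightarrow> (vec2 \<Rightarrow> vec2) \<Rightarrow> (real \<Rightarrow> vec2) \<Rightarrow> (real \<Rightarrow> vec2) \<Rightarrow> real" where
  "TT v w \<xi> \<xi>' = set_lebesgue_integral lborel I01 (\<lambda>t. ff v w (\<xi> t) (\<xi>' t))"

definition TD1 :: "real \<Rightarrow> (vec2 \<Rightarrow> vec2) \<Rightarrow> state \<Rightarrow> state \<Rightarrow> real" where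
  "TD1 v w a d = deriv (\<lambda>s. TT v w (\<lambda>t. sxi a t + s *\<^sub>R sxi d t)
                                   (\<lambda>t. sdxi a t + s *\<^sub>R sdxi d t)) 0"

definition TD2 :: "real \<Rightarrow> (vec2 \<Rightarrow> vec2) \<Rightarrow> state \<Rightarrow> state \<Rightarrow> real" where
  "TD2 v w a d = (deriv ^^ 2) (\<lambda>s. TT v w (\<lambda>t. sxi a t + s *\<^sub>R sxi d t)
                                   (\<lambda>t. sdxi a t + s *\<^sub>R sdxi d t)) 0"

definition FF :: "real \<Rightarrow> (vec2 \<Rightarrow> vec2) \<Rightarrow> state \<Rightarrow> state \<Rightarrow> real" where
  "FF v w a d = TD1 v w a d
     + 2 * set_lebesgue_integral lborel I01
             (\<lambda>t. slam a t * (sdxi a t \<bullet> sdxi d t - sL a * sL d))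
     + set_lebesgue_integral lborel I01
             (\<lambda>t. slam d t * (sdxi a t \<bullet> sdxi a t - (sL a)\<^sup>2))"

definition FD :: "real \<Rightarrow> (vec2 \<Rightarrow> vec2) \<Rightarrow> state \<Rightarrow> state \<Rightarrow> state \<Rightarrow> real" where
  "FD v w a e d = deriv (\<lambda>s. FF v w (sadd a (sscale s e)) d) 0"

definition feasible :: "vec2 \<Rightarrow> vec2 \<Rightarrow> state \<Rightarrow> bool" where
  "feasible xO xD a \<longleftrightarrow> inZ xO xD a
      \<and> (AE t in lborel. t \<in> I01 \<longrightarrow> sdxi a t \<bullet> sdxi a t = (sL a)\<^sup>2)"

definition global_sol :: "real \<Rightarrow> (vec2 \<Rightarrow> vec2) \<Rightarrow> vec2 \<Rightarrow> vec2 \<Rightarrow> state \<Rightarrow> bool" where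
  "global_sol v w xO xD a \<longleftrightarrow> feasible xO xD a
      \<and> (\<forall>b. feasible xO xD b \<longrightarrow> TT v w (sxi a) (sdxi a) \<le> TT v w (sxi b) (sdxi b))"

definition kappaR :: "real \<Rightarrow> real \<Rightarrow> real \<Rightarrow> real \<Rightarrow> real \<Rightarrow> real" where
  "kappaR c v c0 Lt R = (c - R) / sqrt (3/8 + 2 * ((v + c0) / (v - c0) + R / Lt)\<^sup>2)"

definition Bbar :: "real \<Rightarrow> real \<Rightarrow> real \<Rightarrow> real \<Rightarrow> real \<Rightarrow> real \<Rightarrow> real" where
  "Bbar v c0 c1 c2 Lt R =
     (let uv = sqrt (v\<^sup>2 - c0\<^sup>2);
          b0 = 14 * c1\<^sup>2 / uv ^ 3 + 4 * c2 / uv\<^sup>2;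
          b1 = 7 * c1 / uv\<^sup>2;
          b2 = 4 / uv
      in b1 + max (((v + c0) / (v - c0) * Lt + R) * b0) (b2 / (Lt + R)))"

definition omega1 :: "real \<Rightarrow> real \<Rightarrow> real \<Rightarrow> real \<Rightarrow> real" where
  "omega1 Bl k Bb R = sqrt 2 * Max {4 / Bl, (1 / k) * (1 + 4 * (Bb + R) / Bl), (Bb + R) / k\<^sup>2}"

end

theory Submission
  imports Defs
begin

text \<open>
  Write \<open>e\<close> for the error of an iterate and \<open>G s = F'(\<chi>* + s e)[e, \<cdot>]\<close>. The Newton step satisfies
  \<open>F'(\<chi>* + e)[e\<^sup>+, \<cdot>] = G 1 - \<integral>\<^sub>0\<^sup>1 G\<close>, and since the third derivative of the integrand is uniformly
  continuous near the trajectory, the right-hand side agrees with \<open>(G 1 - G (-1)) / 4\<close> up to a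
  term \<open>o(R) \<parallel>e\<parallel>\<close>. The Lipschitz hypothesis, applied to the points \<open>\<chi>* + e\<close> and \<open>\<chi>* - e\<close>, bounds this by
  \<open>\<omega>\<^sub>2/4 \<parallel>e\<parallel>\<close>; this is where half of the expected constant is gained. Testing the hypothesis with
  a pure change of \<open>L\<close> shows \<open>\<omega>\<^sub>2 \<ge> 4 R\<close>, so that the remainder is absorbed.

  It remains to bound the inverse of \<open>F'(\<chi>*)\<close> by slightly less than \<open>2 \<omega>\<^sub>1\<close>. Every curve near
  \<open>\<xi>*\<close> can be reparametrised to constant speed without changing its travel time, so \<open>T''(\<xi>*)\<close> is
  positive semidefinite in all directions. With the Cauchy-Schwarz inequality for \<open>T''(\<xi>*)\<close> the saddle point
  problem is stable with the constant \<open>1/\<B> + (2 + 2 (B/\<B>)\<^bsup>1/2\<^esup>)/\<kappa> + B/\<kappa>\<^sup>2\<close>, where \<open>B\<close> bounds \<open>T''(\<xi>*)\<close> and \<open>\<kappa>\<close>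
  is an inf-sup constant. Moving along \<open>u\<close> gives \<open>\<kappa> = 4c/5\<close>, and differentiating \<open>\<parallel>p - f w\<parallel> = v f\<close> twice gives \<open>B\<close>.
\<close>

section \<open>Functions of class C3\<close>

text \<open>Applied directly, the Lipschitz hypothesis is too weak. Both of its sides scale with the
  difference of the two points: for \<open>\<chi>* + e\<close> and \<open>\<chi>* + s e\<close> the
  factor 1 - s cancels, so G 1 - G s is only bounded by \<omega>2 \<parallel>e\<parallel>, and
  integrating over s yields no factor 1/2. The reflected point helps because G is nearly affine: for
  affine G, both G 1 minus its mean and (G 1 - G (-1)) / 4 equal half the slope.

  The order of quantifiers shapes the rest. The radius is fixed before the Lipschitz constant is
  given, and without knowing that one exists. Hence all stability constants are computed at the
  solution itself, where they do not depend on the radius; convergence and uniqueness come from the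
  smallness of the radius alone; and the hypothesis enters only the estimated rate. Because the
  numerical margin in the final comparison is narrow, the bounds for the second variation and for
  the inf-sup constant are explicit rather than up to a generic factor.\<close>

lemma has_derivative_directional:
  fixes g :: "'a::real_normed_vector \<Rightarrow> real"
  assumes "(g has_derivative g') (at (y + s *\<^sub>R h))"
  shows "((\<lambda>r. g (y + r *\<^sub>R h)) has_real_derivative g' h) (at s)"
proof -
  have 1: "((\<lambda>r. y + r *\<^sub>R h) has_derivative (\<lambda>r. r *\<^sub>R h)) (at s)"
    by (auto intro!: derivative_eq_intros)
  have "((\<lambda>r. g (y + r *\<^sub>R h)) has_derivative (\<lambda>r. g' (r *\<^sub>R h))) (at s)"
    using has_derivative_compose[OF 1 assms] .
  moreover have "g' (r *\<^sub>R h) = g' h * r" for r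
    using linear_scale[OF has_derivative_linear[OF assms], of r h] by (simp add: mult.commute)
  ultimately show ?thesis by (simp add: has_field_derivative_def)
qed

text \<open>Only derivatives in a fixed direction \<open>h\<close> have to be smooth again. Every
  derivative is then a real function on the same space, so the recursion needs no spaces of
  multilinear maps; linearity in the directions is recovered later from the uniqueness of
  derivatives.\<close>

fun Ck :: "nat \<Rightarrow> 'a::euclidean_space set \<Rightarrow> ('a \<Rightarrow> real) \<Rightarrow> bool" where
  "Ck 0 U g = continuous_on U g"
| "Ck (Suc k) U g = (\<exists>g'. (\<forall>y\<in>U. (g has_derivative g' y) (at y)) \<and> (\<forall>h. Ck k U (\<lambda>y. g' y h)))"

lemma Ck_cong:
  assumes "open U" "\<And>y. y \<in> U \<Longrightarrow> f y = g y" "Ck k U f"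
  shows "Ck k U g"
proof (cases k)
  case 0
  then show ?thesis using assms continuous_on_cong[of U U f g] by simp
next
  case (Suc m)
  with assms(3) obtain g' where g': "\<And>y. y \<in> U \<Longrightarrow> (f has_derivative g' y) (at y)"
    "\<And>h. Ck m U (\<lambda>y. g' y h)" by auto
  have "(g has_derivative g' y) (at y)" if "y \<in> U" for y
    using has_derivative_transform_within_open[OF g'(1)[OF that] assms(1) that] assms(2) by blast
  then show ?thesis using Suc g'(2) by auto
qed

lemma Ck_SucD: "Ck (Suc k) U g \<Longrightarrow> Ck k U g"
proof (induction k arbitrary: g)
  case 0
  then obtain g' where "\<forall>y\<in>U. (g has_derivative g' y) (at y)" by auto
  then have "\<forall>y\<in>U. continuous (at y within U) g"
    by (meson continuous_at_imp_continuous_within has_derivative_continuous)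
  then show ?case by (simp add: continuous_on_eq_continuous_within)
next
  case (Suc k)
  then show ?case by (metis Ck.simps(2))
qed

lemma Ck_const: "Ck k U (\<lambda>y. c)"
proof (induction k arbitrary: c)
  case (Suc k)
  show ?case by (auto intro!: exI[of _ "\<lambda>y h. 0"] Suc)
qed simp

lemma Ck_linear: assumes "bounded_linear l" shows "Ck k U l"
proof (cases k)
  case 0
  then show ?thesis using assms linear_continuous_on by auto
next
  case (Suc m)
  then show ?thesis using assms
    by (auto intro!: exI[of _ "\<lambda>y. l"] Ck_const bounded_linear_imp_has_derivative)
qed

lemma Ck_add: "Ck k U f \<Longrightarrow> Ck k U g \<Longrightarrow> Ck k U (\<lambda>y. f y + g y)"
proof (induction k arbitrary: f g)
  case (Suc k)
  then obtain f' g' where "\<forall>y\<in>U. (f has_derivative f' y) (at y)" "\<forall>h. Ck k U (\<lambda>y. f' y h)"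
    "\<forall>y\<in>U. (g has_derivative g' y) (at y)" "\<forall>h. Ck k U (\<lambda>y. g' y h)" by auto
  then show ?case
    by (auto intro!: exI[of _ "\<lambda>y h. f' y h + g' y h"] Suc.IH has_derivative_add)
qed (auto intro: continuous_intros)

lemma Ck_mult: "Ck k U f \<Longrightarrow> Ck k U g \<Longrightarrow> Ck k U (\<lambda>y. f y * g y)"
proof (induction k arbitrary: f g)
  case (Suc k)
  then obtain f' g' where 1: "\<forall>y\<in>U. (f has_derivative f' y) (at y)" "\<forall>h. Ck k U (\<lambda>y. f' y h)"
    "\<forall>y\<in>U. (g has_derivative g' y) (at y)" "\<forall>h. Ck k U (\<lambda>y. g' y h)" by auto
  have 2: "Ck k U f" "Ck k U g" using Suc.prems Ck_SucD by blast+
  show ?case unfolding Ck.simps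
    by (rule exI[of _ "\<lambda>y h. f y * g' y h + f' y h * g y"])
      (use 1 2 in \<open>auto intro!: Suc.IH Ck_add has_derivative_mult\<close>)
qed (auto intro: continuous_intros)

lemma Ck_uminus: "Ck k U f \<Longrightarrow> Ck k U (\<lambda>y. - f y)"
  using Ck_mult[OF Ck_const[of k U "-1"], of f] by simp

lemma Ck_sum: "finite I \<Longrightarrow> (\<And>i. i \<in> I \<Longrightarrow> Ck k U (f i)) \<Longrightarrow> Ck k U (\<lambda>y. \<Sum>i\<in>I. f i y)"
  by (induction I rule: finite_induct) (auto intro: Ck_const Ck_add)

text \<open>The derivative of the reciprocal is a product containing the reciprocal itself, which
  the induction hypothesis covers one order lower. \<open>Ck_sqrt\<close> follows the same
  pattern.\<close>

lemma Ck_inverse: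
  "(\<And>y. y \<in> U \<Longrightarrow> f y \<noteq> 0) \<Longrightarrow> Ck k U f \<Longrightarrow> Ck k U (\<lambda>y. inverse (f y))"
proof (induction k)
  case (Suc k)
  then obtain f' where 1: "\<forall>y\<in>U. (f has_derivative f' y) (at y)" "\<forall>h. Ck k U (\<lambda>y. f' y h)"
    by auto
  have 2: "Ck k U (\<lambda>y. inverse (f y))" using Suc Ck_SucD by blast
  show ?case unfolding Ck.simps
    by (rule exI[of _ "\<lambda>y h. - (inverse (f y) * f' y h * inverse (f y))"])
      (use 1 2 Suc.prems in \<open>auto intro!: Ck_mult Ck_uminus has_derivative_inverse\<close>)
qed (auto intro: continuous_intros)

lemma Ck_sqrt:
  "(\<And>y. y \<in> U \<Longrightarrow> f y > 0) \<Longrightarrow> Ck k U f \<Longrightarrow> Ck k U (\<lambda>y. sqrt (f y))"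
proof (induction k)
  case (Suc k)
  then obtain f' where 1: "\<forall>y\<in>U. (f has_derivative f' y) (at y)" "\<forall>h. Ck k U (\<lambda>y. f' y h)"
    by auto
  have 2: "Ck k U (\<lambda>y. sqrt (f y))" using Suc Ck_SucD by blast
  have 3: "Ck k U (\<lambda>y. inverse (sqrt (f y)))"
    by (rule Ck_inverse) (use 2 Suc.prems(1) in force)+
  show ?case unfolding Ck.simps
  proof (rule exI[of _ "\<lambda>y h. (inverse (sqrt (f y)) * (1/2)) * f' y h"], intro conjI ballI allI)
    fix y assume y: "y \<in> U"
    have "(sqrt has_real_derivative inverse (sqrt (f y)) / 2) (at (f y))"
      by (rule DERIV_real_sqrt) (use Suc.prems y in auto)
    then have "(sqrt has_derivative (\<lambda>t. (inverse (sqrt (f y)) * (1/2)) * t)) (at (f y))"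
      by (simp only: has_field_derivative_def times_divide_eq_right mult_1_right)
    from has_derivative_compose[of f "f' y" y UNIV, OF _ this] 1 y
    show "((\<lambda>y. sqrt (f y)) has_derivative (\<lambda>h. (inverse (sqrt (f y)) * (1/2)) * f' y h)) (at y)"
      by blast
  qed (intro Ck_mult Ck_const 3 1(2)[rule_format])
qed (auto intro: continuous_intros)

lemma Ck_compose_linear:
  assumes "bounded_linear l" "Ck k UNIV g"
  shows "Ck k U (\<lambda>y. g (l y))"
  using assms(2)
proof (induction k arbitrary: g)
  case 0
  then show ?case using assms(1)
    using continuous_on_compose2[of UNIV g U l] linear_continuous_on[of l U] by auto
next
  case (Suc k)
  then obtain g' where 1: "\<And>y. (g has_derivative g' y) (at y)" "\<And>h. Ck k UNIV (\<lambda>y. g' y h)" by auto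
  show ?case unfolding Ck.simps
  proof (rule exI[of _ "\<lambda>y h. g' (l y) (l h)"], intro conjI ballI allI)
    fix y
    show "((\<lambda>y. g (l y)) has_derivative (\<lambda>h. g' (l y) (l h))) (at y)"
      by (rule has_derivative_compose[OF bounded_linear_imp_has_derivative[OF assms(1)] 1(1)])
  qed (use Suc.IH 1 in auto)
qed

lemma C3_has_derivative_D1: "C3 w \<Longrightarrow> (w has_derivative D1 w x) (at x)"
  unfolding C3_def D1_def by (metis frechet_derivative_works eta_contract_eq)

lemma C3_has_derivative_D2: "C3 w \<Longrightarrow> ((\<lambda>y. D1 w y a) has_derivative D2 w x a) (at x)"
  unfolding C3_def D2_def by (metis frechet_derivative_works eta_contract_eq)

lemma C3_has_derivative_D3: "C3 w \<Longrightarrow> ((\<lambda>y. D2 w y a b) has_derivative D3 w x a b) (at x)"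
  unfolding C3_def D3_def by (metis frechet_derivative_works eta_contract_eq)

text \<open>The wind enters through its components, because \<open>Ck\<close> speaks of real
  functions.\<close>

lemma C3_imp_Ck_inner:
  assumes "C3 w" shows "Ck 3 UNIV (\<lambda>x. w x \<bullet> b)"
proof -
  have 0: "Ck 0 UNIV (\<lambda>x. D3 w x h k l \<bullet> b)" for h k l
    using assms by (auto simp: C3_def intro!: continuous_intros)
  have 1: "Ck (Suc 0) UNIV (\<lambda>x. D2 w x h k \<bullet> b)" for h k
    unfolding Ck.simps(2) by (rule exI[of _ "\<lambda>x l. D3 w x h k l \<bullet> b"])
      (use 0 C3_has_derivative_D3[OF assms] in \<open>auto intro: has_derivative_inner_left\<close>)
  have 2: "Ck (Suc (Suc 0)) UNIV (\<lambda>x. D1 w x h \<bullet> b)" for h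
    unfolding Ck.simps(2)[of "Suc 0"] by (rule exI[of _ "\<lambda>x k. D2 w x h k \<bullet> b"])
      (use 1 C3_has_derivative_D2[OF assms] in \<open>auto intro: has_derivative_inner_left\<close>)
  show ?thesis
    unfolding numeral_3_eq_3 Ck.simps(2)[of "Suc (Suc 0)"] by (rule exI[of _ "\<lambda>x k. D1 w x k \<bullet> b"])
      (use 2 C3_has_derivative_D1[OF assms] in \<open>auto intro: has_derivative_inner_left\<close>)
qed

section \<open>The travel time integrand in the joint variable of position and velocity\<close>

abbreviation "ffp v w \<equiv> (\<lambda>y. ff v w (fst y) (snd y))"
abbreviation "nonzero_velocity \<equiv> {y::vec2 \<times> vec2. snd y \<noteq> 0}"

lemma open_nonzero_velocity: "open nonzero_velocity"
  by (intro open_Collect_neq continuous_intros)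

lemma norm_lt_imp_inner_pos: "norm (a::'a::real_inner) < v \<Longrightarrow> v\<^sup>2 - a \<bullet> a > 0"
  by (simp add: power2_norm_eq_inner[symmetric] power_strict_mono)

text \<open>For nonzero velocity the radicand is positive because the wind is slower than
  \<open>v\<close>, so neither the root nor the denominator spoils smoothness. At zero velocity the
  integrand is merely homogeneous of degree one, hence the restricted domain.\<close>

lemma Ck_ffp:
  assumes "C3 w" and w: "\<forall>x. norm (w x) < v"
  shows "Ck 3 nonzero_velocity (ffp v w)"
proof -
  have pw: "Ck 3 nonzero_velocity (\<lambda>y. snd y \<bullet> w (fst y))"
    by (subst euclidean_inner, intro Ck_sum Ck_mult)
      (auto intro!: Ck_linear bounded_linear_intros Ck_compose_linear[OF bounded_linear_fst] C3_imp_Ck_inner assms)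
  have ww: "Ck 3 nonzero_velocity (\<lambda>y. w (fst y) \<bullet> w (fst y))"
    by (subst euclidean_inner, intro Ck_sum Ck_mult)
      (auto intro!: Ck_compose_linear[OF bounded_linear_fst] C3_imp_Ck_inner assms)
  have pp: "Ck 3 nonzero_velocity (\<lambda>y. snd y \<bullet> snd y)"
    by (subst euclidean_inner, intro Ck_sum Ck_mult)
      (auto intro!: Ck_linear bounded_linear_intros)
  have den: "Ck 3 nonzero_velocity (\<lambda>y. v\<^sup>2 + - (w (fst y) \<bullet> w (fst y)))"
    by (intro Ck_add Ck_const Ck_uminus ww)
  have pos: "v\<^sup>2 + - (w x \<bullet> w x) > 0" for x using norm_lt_imp_inner_pos w by auto
  have "Ck 3 nonzero_velocity (\<lambda>y. (- (snd y \<bullet> w (fst y)) + sqrt ((snd y \<bullet> w (fst y)) * (snd y \<bullet> w (fst y))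
      + (v\<^sup>2 + - (w (fst y) \<bullet> w (fst y))) * (snd y \<bullet> snd y))) * inverse (v\<^sup>2 + - (w (fst y) \<bullet> w (fst y))))"
    using pos by (intro Ck_add Ck_mult Ck_sqrt Ck_inverse den pw pp Ck_uminus)
      (auto intro!: add_nonneg_pos mult_pos_pos simp: less_imp_neq[THEN not_sym])
  then show ?thesis
    by (rule Ck_cong[OF open_nonzero_velocity, rotated]) (simp add: ff_def divide_inverse power2_eq_square)
qed

text \<open>The derivatives vanish outside \<open>U\<close> so that they are Borel functions on the whole space.\<close>

locale C3_function =
  fixes U :: "'a::euclidean_space set" and f :: "'a \<Rightarrow> real"
    and f1 :: "'a \<Rightarrow> 'a \<Rightarrow> real" and f2 :: "'a \<Rightarrow> 'a \<Rightarrow> 'a \<Rightarrow> real"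
    and f3 :: "'a \<Rightarrow> 'a \<Rightarrow> 'a \<Rightarrow> 'a \<Rightarrow> real"
  assumes openU: "open U"
    and d1: "\<And>y. y \<in> U \<Longrightarrow> (f has_derivative f1 y) (at y)"
    and d2: "\<And>y h. y \<in> U \<Longrightarrow> ((\<lambda>z. f1 z h) has_derivative f2 y h) (at y)"
    and d3: "\<And>y h k. y \<in> U \<Longrightarrow> ((\<lambda>z. f2 z h k) has_derivative f3 y h k) (at y)"
    and c3: "\<And>h k l. continuous_on U (\<lambda>y. f3 y h k l)"
    and out: "\<And>y h k l. y \<notin> U \<Longrightarrow> f1 y h = 0 \<and> f2 y h k = 0 \<and> f3 y h k l = 0"

lemma Ck_3_imp_C3_function:
  fixes f :: "'a::euclidean_space \<Rightarrow> real"
  assumes "open U" "Ck 3 U f"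
  shows "\<exists>f1 f2 f3. C3_function U f f1 f2 f3"
proof -
  obtain g1 where g1: "\<And>y. y \<in> U \<Longrightarrow> (f has_derivative g1 y) (at y)" "\<And>h. Ck 2 U (\<lambda>y. g1 y h)"
    using assms(2) by (auto simp: numeral_3_eq_3 numeral_2_eq_2)
  have "\<forall>h. \<exists>g'. (\<forall>y\<in>U. ((\<lambda>z. g1 z h) has_derivative g' y) (at y)) \<and> (\<forall>k. Ck 1 U (\<lambda>y. g' y k))"
    using g1(2) unfolding numeral_2_eq_2 One_nat_def Ck.simps(2)[of "Suc 0"] by blast
  then obtain g2' where g2': "\<And>h y. y \<in> U \<Longrightarrow> ((\<lambda>z. g1 z h) has_derivative g2' h y) (at y)"
    "\<And>h k. Ck 1 U (\<lambda>y. g2' h y k)" by metis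
  have "\<forall>h k. \<exists>g'. (\<forall>y\<in>U. ((\<lambda>z. g2' h z k) has_derivative g' y) (at y)) \<and> (\<forall>l. continuous_on U (\<lambda>y. g' y l))"
    using g2'(2) by auto
  then obtain g3' where g3': "\<And>h k y. y \<in> U \<Longrightarrow> ((\<lambda>z. g2' h z k) has_derivative g3' h k y) (at y)"
    "\<And>h k l. continuous_on U (\<lambda>y. g3' h k y l)" by metis
  define f1 where "f1 = (\<lambda>y h. if y \<in> U then g1 y h else 0)"
  define f2 where "f2 = (\<lambda>y h k. if y \<in> U then g2' h y k else 0)"
  define f3 where "f3 = (\<lambda>y h k l. if y \<in> U then g3' h k y l else 0)"
  have tr: "((\<lambda>z. if z \<in> U then p z else 0) has_derivative p') (at y)"
    if "y \<in> U" "(p has_derivative p') (at y)" for p :: "'a \<Rightarrow> real" and p' y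
    by (rule has_derivative_transform_within_open[OF that(2) assms(1) that(1)]) auto
  have "C3_function U f f1 f2 f3"
  proof
    show "(f has_derivative f1 y) (at y)" if "y \<in> U" for y using g1(1)[OF that] that by (simp add: f1_def)
    show "((\<lambda>z. f1 z h) has_derivative f2 y h) (at y)" if "y \<in> U" for y h
      using tr[OF that g2'(1)[OF that]] that by (simp add: f1_def f2_def)
    show "((\<lambda>z. f2 z h k) has_derivative f3 y h k) (at y)" if "y \<in> U" for y h k
      using tr[OF that g3'(1)[OF that]] that by (simp add: f3_def f2_def)
    show "continuous_on U (\<lambda>y. f3 y h k l)" for h k l
      using g3'(2)[of h k l] by (simp add: f3_def cong: continuous_on_cong)
  qed (auto simp: f1_def f2_def f3_def assms)
  then show ?thesis by blast
qed

lemma linear_basis_expansion: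
  fixes l :: "'a::euclidean_space \<Rightarrow> real"
  assumes "linear l" shows "l h = (\<Sum>b\<in>Basis. (h \<bullet> b) * l b)"
proof -
  have "l h = l (\<Sum>b\<in>Basis. (h \<bullet> b) *\<^sub>R b)" by (simp add: euclidean_representation)
  also have "\<dots> = (\<Sum>b\<in>Basis. (h \<bullet> b) * l b)"
    by (simp add: linear_sum[OF assms] linear_scale[OF assms])
  finally show ?thesis .
qed

lemma linear_abs_le_basis:
  fixes l :: "'a::euclidean_space \<Rightarrow> real" and C :: real
  assumes "linear l" "\<And>b. b \<in> Basis \<Longrightarrow> \<bar>l b\<bar> \<le> C"
  shows "\<bar>l h\<bar> \<le> DIM('a) * C * norm h"
proof -
  have "\<bar>l h\<bar> \<le> (\<Sum>b\<in>Basis. \<bar>(h \<bullet> b) * l b\<bar>)"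
    unfolding linear_basis_expansion[OF assms(1), of h] by (rule sum_abs)
  also have "\<dots> \<le> (\<Sum>b\<in>(Basis::'a set). norm h * C)"
    by (intro sum_mono) (auto simp: abs_mult intro!: mult_mono assms Basis_le_norm)
  finally show ?thesis by (simp add: mult_ac)
qed

context C3_function
begin

lemma linear_f1: "linear (f1 y)"
  by (cases "y \<in> U") (auto intro: has_derivative_linear d1 linearI simp: out)

lemma linear_f2: "linear (f2 y h)"
  by (cases "y \<in> U") (auto intro: has_derivative_linear d2 linearI simp: out)

lemma linear_f3: "linear (f3 y h k)"
  by (cases "y \<in> U") (auto intro: has_derivative_linear d3 linearI simp: out)

text \<open>Linearity in the older slot is inherited: \<open>f1\<close> is linear in
  \<open>h\<close>, so the derivative of a combination of directions is computed in two ways, and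
  derivatives are unique.\<close>

lemma linear_f2_fst: "linear (\<lambda>h. f2 y h k)"
proof (cases "y \<in> U")
  case True
  show ?thesis
  proof (rule linearI)
    fix a b r
    have "((\<lambda>z. f1 z (a + b)) has_derivative (\<lambda>k. f2 y a k + f2 y b k)) (at y)"
      unfolding linear_add[OF linear_f1] by (intro has_derivative_add d2 True)
    from has_derivative_unique[OF this d2[OF True]] show "f2 y (a + b) k = f2 y a k + f2 y b k" by metis
    have "((\<lambda>z. f1 z (r *\<^sub>R a)) has_derivative (\<lambda>k. r * f2 y a k)) (at y)"
      unfolding linear_scale[OF linear_f1] real_scaleR_def by (intro has_derivative_mult_right d2 True)
    from has_derivative_unique[OF this d2[OF True]] show "f2 y (r *\<^sub>R a) k = r *\<^sub>R f2 y a k"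
      by (metis real_scaleR_def)
  qed
qed (auto intro: linearI simp: out)

lemma linear_f3_snd: "linear (\<lambda>k. f3 y h k l)"
proof (cases "y \<in> U")
  case True
  show ?thesis
  proof (rule linearI)
    fix a b r
    have "((\<lambda>z. f2 z h (a + b)) has_derivative (\<lambda>k. f3 y h a k + f3 y h b k)) (at y)"
      unfolding linear_add[OF linear_f2] by (intro has_derivative_add d3 True)
    from has_derivative_unique[OF this d3[OF True]] show "f3 y h (a + b) l = f3 y h a l + f3 y h b l" by metis
    have "((\<lambda>z. f2 z h (r *\<^sub>R a)) has_derivative (\<lambda>k. r * f3 y h a k)) (at y)"
      unfolding linear_scale[OF linear_f2] real_scaleR_def by (intro has_derivative_mult_right d3 True)
    from has_derivative_unique[OF this d3[OF True]] show "f3 y h (r *\<^sub>R a) l = r *\<^sub>R f3 y h a l"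
      by (metis real_scaleR_def)
  qed
qed (auto intro: linearI simp: out)

lemma linear_f3_fst: "linear (\<lambda>h. f3 y h k l)"
proof (cases "y \<in> U")
  case True
  show ?thesis
  proof (rule linearI)
    fix a b r
    have "((\<lambda>z. f2 z (a + b) k) has_derivative (\<lambda>l. f3 y a k l + f3 y b k l)) (at y)"
      unfolding linear_add[OF linear_f2_fst] by (intro has_derivative_add d3 True)
    from has_derivative_unique[OF this d3[OF True]] show "f3 y (a + b) k l = f3 y a k l + f3 y b k l" by metis
    have "((\<lambda>z. f2 z (r *\<^sub>R a) k) has_derivative (\<lambda>l. r * f3 y a k l)) (at y)"
      unfolding linear_scale[OF linear_f2_fst] real_scaleR_def by (intro has_derivative_mult_right d3 True)
    from has_derivative_unique[OF this d3[OF True]] show "f3 y (r *\<^sub>R a) k l = r *\<^sub>R f3 y a k l"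
      by (metis real_scaleR_def)
  qed
qed (auto intro: linearI simp: out)

lemma continuous_f1: "continuous_on U (\<lambda>y. f1 y h)"
  by (intro continuous_at_imp_continuous_on ballI has_derivative_continuous[OF d2])

lemma continuous_f2: "continuous_on U (\<lambda>y. f2 y h k)"
  by (intro continuous_at_imp_continuous_on ballI has_derivative_continuous[OF d3])

lemma borel_if_cont:
  fixes g :: "'a \<Rightarrow> real"
  assumes "continuous_on U g" "\<And>y. y \<notin> U \<Longrightarrow> g y = 0"
  shows "g \<in> borel_measurable borel"
proof -
  have "(\<lambda>y. indicator U y *\<^sub>R g y) \<in> borel_measurable borel"
    using borel_measurable_continuous_on_indicator[of U g] assms openU by simp
  also have "(\<lambda>y. indicator U y *\<^sub>R g y) = g"
    using assms(2) by (auto simp: indicator_def fun_eq_iff)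
  finally show ?thesis .
qed

lemma measurable_f1: "(\<lambda>y. f1 y h) \<in> borel_measurable borel"
  by (rule borel_if_cont[OF continuous_f1]) (simp add: out)

lemma measurable_f2: "(\<lambda>y. f2 y h k) \<in> borel_measurable borel"
  by (rule borel_if_cont[OF continuous_f2]) (simp add: out)

text \<open>Measurability is known for fixed directions only. Expanding the varying direction in the
  basis reduces the claim to finitely many fixed ones.\<close>

lemma measurable_f1_comp:
  assumes "y \<in> borel_measurable M" "h \<in> borel_measurable M"
  shows "(\<lambda>t. f1 (y t) (h t)) \<in> borel_measurable M"
proof -
  have "(\<lambda>t. f1 (y t) (h t)) = (\<lambda>t. \<Sum>b\<in>Basis. (h t \<bullet> b) * f1 (y t) b)"
    by (rule ext) (rule linear_basis_expansion[OF linear_f1])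
  moreover have "(\<lambda>t. f1 (y t) b) \<in> borel_measurable M" for b
    by (rule measurable_compose[OF assms(1) measurable_f1])
  ultimately show ?thesis using assms(2) by simp
qed

lemma measurable_f2_comp:
  assumes "y \<in> borel_measurable M" "h \<in> borel_measurable M" "k \<in> borel_measurable M"
  shows "(\<lambda>t. f2 (y t) (h t) (k t)) \<in> borel_measurable M"
proof -
  have "(\<lambda>t. f2 (y t) (h t) (k t)) = (\<lambda>t. \<Sum>b\<in>Basis. (h t \<bullet> b) * (\<Sum>c\<in>Basis. (k t \<bullet> c) * f2 (y t) b c))"
  proof
    fix t
    have "f2 (y t) (h t) (k t) = (\<Sum>b\<in>Basis. (h t \<bullet> b) * f2 (y t) b (k t))"
      by (rule linear_basis_expansion[OF linear_f2_fst])
    also have "\<dots> = (\<Sum>b\<in>Basis. (h t \<bullet> b) * (\<Sum>c\<in>Basis. (k t \<bullet> c) * f2 (y t) b c))"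
      by (intro sum.cong refl arg_cong2[where f="(*)"]) (rule linear_basis_expansion[OF linear_f2])
    finally show "f2 (y t) (h t) (k t) = (\<Sum>b\<in>Basis. (h t \<bullet> b) * (\<Sum>c\<in>Basis. (k t \<bullet> c) * f2 (y t) b c))" .
  qed
  moreover have "(\<lambda>t. f2 (y t) b c) \<in> borel_measurable M" for b c
    by (rule measurable_compose[OF assms(1) measurable_f2])
  ultimately show ?thesis using assms(2,3) by simp
qed

text \<open>Uniform continuity holds for each pair of basis directions; by bilinearity it becomes a
  bound in the norms of arbitrary directions, at the price of the squared dimension.\<close>

lemma f2_bound_basis:
  fixes C :: real
  assumes "\<And>b c. b \<in> Basis \<Longrightarrow> c \<in> Basis \<Longrightarrow> \<bar>f2 y b c - f2 z b c\<bar> \<le> C"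
  shows "\<bar>f2 y h k - f2 z h k\<bar> \<le> DIM('a)^2 * C * norm h * norm k"
proof -
  have 1: "\<bar>f2 y b k - f2 z b k\<bar> \<le> DIM('a) * C * norm k" if "b \<in> Basis" for b
    by (rule linear_abs_le_basis[where l="\<lambda>k. f2 y b k - f2 z b k"])
      (use that assms in \<open>auto intro: linear_compose_sub linear_f2\<close>)
  have "\<bar>f2 y h k - f2 z h k\<bar> \<le> DIM('a) * (DIM('a) * C * norm k) * norm h"
    by (rule linear_abs_le_basis[where l="\<lambda>h. f2 y h k - f2 z h k"])
      (use 1 in \<open>auto intro: linear_compose_sub linear_f2_fst\<close>)
  then show ?thesis by (simp add: power2_eq_square mult_ac)
qed

lemma f3_bound_basis:
  fixes C :: real
  assumes "\<And>b c d. b \<in> Basis \<Longrightarrow> c \<in> Basis \<Longrightarrow> d \<in> Basis \<Longrightarrow> \<bar>f3 y b c d - f3 z b c d\<bar> \<le> C"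
  shows "\<bar>f3 y h k l - f3 z h k l\<bar> \<le> DIM('a)^3 * C * norm h * norm k * norm l"
proof -
  have 1: "\<bar>f3 y b c l - f3 z b c l\<bar> \<le> DIM('a) * C * norm l" if "b \<in> Basis" "c \<in> Basis" for b c
    by (rule linear_abs_le_basis[where l="\<lambda>l. f3 y b c l - f3 z b c l"])
      (use that assms in \<open>auto intro: linear_compose_sub linear_f3\<close>)
  have 2: "\<bar>f3 y b k l - f3 z b k l\<bar> \<le> DIM('a) * (DIM('a) * C * norm l) * norm k" if "b \<in> Basis" for b
    by (rule linear_abs_le_basis[where l="\<lambda>k. f3 y b k l - f3 z b k l"])
      (use that 1 in \<open>auto intro: linear_compose_sub linear_f3_snd\<close>)
  have "\<bar>f3 y h k l - f3 z h k l\<bar> \<le> DIM('a) * (DIM('a) * (DIM('a) * C * norm l) * norm k) * norm h"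
    by (rule linear_abs_le_basis[where l="\<lambda>h. f3 y h k l - f3 z h k l"])
      (use 2 in \<open>auto intro: linear_compose_sub linear_f3_fst\<close>)
  then show ?thesis by (simp add: power3_eq_cube mult_ac)
qed

end

lemma uniformly_continuous_family:
  fixes g :: "'i \<Rightarrow> 'a::metric_space \<Rightarrow> real"
  assumes "finite I" "compact K" "\<And>i. i \<in> I \<Longrightarrow> continuous_on K (g i)" "e > 0"
  shows "\<exists>\<delta>>0. \<forall>i\<in>I. \<forall>y\<in>K. \<forall>z\<in>K. dist y z < \<delta> \<longrightarrow> \<bar>g i y - g i z\<bar> \<le> e"
proof -
  have "\<exists>\<delta>>0. \<forall>y\<in>K. \<forall>z\<in>K. dist y z < \<delta> \<longrightarrow> \<bar>g i y - g i z\<bar> \<le> e" if i: "i \<in> I" for i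
  proof -
    have "uniformly_continuous_on K (g i)"
      using compact_uniformly_continuous assms i by blast
    then obtain \<delta> where "\<delta> > 0" "\<forall>y\<in>K. \<forall>z\<in>K. dist z y < \<delta> \<longrightarrow> dist (g i z) (g i y) < e"
      unfolding uniformly_continuous_on_def using \<open>e > 0\<close> by metis
    then show ?thesis by (intro exI[of _ \<delta>]) (auto simp: dist_real_def dist_commute less_imp_le)
  qed
  then obtain D where D: "\<And>i. i \<in> I \<Longrightarrow> D i > 0 \<and> (\<forall>y\<in>K. \<forall>z\<in>K. dist y z < D i \<longrightarrow> \<bar>g i y - g i z\<bar> \<le> e)"
    by metis
  show ?thesis
  proof (intro exI[of _ "Min (insert 1 (D ` I))"] conjI ballI impI)
    show "Min (insert 1 (D ` I)) > 0" using D assms(1) by auto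
    fix i y z assume "i \<in> I" "y \<in> K" "z \<in> K" "dist y z < Min (insert 1 (D ` I))"
    then show "\<bar>g i y - g i z\<bar> \<le> e" using D assms(1) by auto
  qed
qed

context C3_function
begin

lemma uniformly_continuous_f2:
  assumes "compact K" "K \<subseteq> U" "e > 0"
  shows "\<exists>\<delta>>0. \<forall>y\<in>K. \<forall>z\<in>K. dist y z < \<delta> \<longrightarrow> (\<forall>h k. \<bar>f2 y h k - f2 z h k\<bar> \<le> e * norm h * norm k)"
proof -
  have "\<exists>\<delta>>0. \<forall>i\<in>(Basis::'a set)\<times>(Basis::'a set). \<forall>y\<in>K. \<forall>z\<in>K. dist y z < \<delta> \<longrightarrow>
     \<bar>f2 y (fst i) (snd i) - f2 z (fst i) (snd i)\<bar> \<le> e / DIM('a)^2"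
    by (rule uniformly_continuous_family) (use assms continuous_on_subset[OF continuous_f2] in auto)
  then obtain \<delta> where d: "\<delta> > 0" "\<And>b c y z. b \<in> (Basis::'a set) \<Longrightarrow> c \<in> (Basis::'a set) \<Longrightarrow> y \<in> K \<Longrightarrow> z \<in> K
     \<Longrightarrow> dist y z < \<delta> \<Longrightarrow> \<bar>f2 y b c - f2 z b c\<bar> \<le> e / DIM('a)^2" by force
  show ?thesis
  proof (intro exI[of _ \<delta>] conjI ballI impI allI d)
    fix y z h k assume "y \<in> K" "z \<in> K" "dist y z < \<delta>"
    then show "\<bar>f2 y h k - f2 z h k\<bar> \<le> e * norm h * norm k"
      using f2_bound_basis[of y z "e / DIM('a)^2" h k] d by simp
  qed
qed

lemma uniformly_continuous_f3:
  assumes "compact K" "K \<subseteq> U" "e > 0"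
  shows "\<exists>\<delta>>0. \<forall>y\<in>K. \<forall>z\<in>K. dist y z < \<delta> \<longrightarrow> (\<forall>h k l. \<bar>f3 y h k l - f3 z h k l\<bar> \<le> e * norm h * norm k * norm l)"
proof -
  have "\<exists>\<delta>>0. \<forall>i\<in>(Basis::'a set)\<times>(Basis::'a set)\<times>(Basis::'a set). \<forall>y\<in>K. \<forall>z\<in>K. dist y z < \<delta> \<longrightarrow>
     \<bar>f3 y (fst i) (fst (snd i)) (snd (snd i)) - f3 z (fst i) (fst (snd i)) (snd (snd i))\<bar> \<le> e / DIM('a)^3"
    by (rule uniformly_continuous_family) (use assms continuous_on_subset[OF c3] in auto)
  then obtain \<delta> where d: "\<delta> > 0" "\<And>b c d y z. b \<in> (Basis::'a set) \<Longrightarrow> c \<in> (Basis::'a set) \<Longrightarrow> d \<in> (Basis::'a set)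
    \<Longrightarrow> y \<in> K \<Longrightarrow> z \<in> K \<Longrightarrow> dist y z < \<delta> \<Longrightarrow> \<bar>f3 y b c d - f3 z b c d\<bar> \<le> e / DIM('a)^3" by force
  show ?thesis
  proof (intro exI[of _ \<delta>] conjI ballI impI allI d)
    fix y z h k l assume "y \<in> K" "z \<in> K" "dist y z < \<delta>"
    then show "\<bar>f3 y h k l - f3 z h k l\<bar> \<le> e * norm h * norm k * norm l"
      using f3_bound_basis[of y z "e / DIM('a)^3" h k l] d by simp
  qed
qed

lemma compact_bound:
  assumes "compact K" "K \<subseteq> U"
  shows "\<exists>C\<ge>0. \<forall>y\<in>K. \<forall>h k l. \<bar>f y\<bar> \<le> C \<and> \<bar>f1 y h\<bar> \<le> C * norm h \<and> \<bar>f2 y h k\<bar> \<le> C * norm h * norm k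
     \<and> \<bar>f3 y h k l\<bar> \<le> C * norm h * norm k * norm l"
proof -
  have bd: "\<exists>C. \<forall>y\<in>K. \<bar>g y\<bar> \<le> C" if "continuous_on U g" for g :: "'a \<Rightarrow> real"
  proof -
    have "bounded (g ` K)"
      using compact_continuous_image[OF continuous_on_subset[OF that assms(2)] assms(1)] compact_imp_bounded by blast
    then show ?thesis by (auto simp: bounded_iff)
  qed
  have fam: "\<exists>C\<ge>0. \<forall>i\<in>I. \<forall>y\<in>K. \<bar>g i y\<bar> \<le> C" if fin: "finite I" and gi: "\<And>i. i \<in> I \<Longrightarrow> continuous_on U (g i)"
    for I :: "'i set" and g :: "'i \<Rightarrow> 'a \<Rightarrow> real"
  proof -
    have "\<forall>i\<in>I. \<exists>C. \<forall>y\<in>K. \<bar>g i y\<bar> \<le> C" using bd gi by blast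
    then obtain c where c: "\<And>i y. i \<in> I \<Longrightarrow> y \<in> K \<Longrightarrow> \<bar>g i y\<bar> \<le> c i" by metis
    have "\<bar>g i y\<bar> \<le> (\<Sum>i\<in>I. \<bar>c i\<bar>)" if "i \<in> I" "y \<in> K" for i y
      using c[OF that] member_le_sum[of i I "\<lambda>i. \<bar>c i\<bar>"] that fin by force
    then show ?thesis by (intro exI[of _ "\<Sum>i\<in>I. \<bar>c i\<bar>"]) (auto intro: sum_nonneg)
  qed
  have cf: "continuous_on U f" by (intro continuous_at_imp_continuous_on ballI has_derivative_continuous[OF d1])
  obtain C0 where C0: "\<And>y. y \<in> K \<Longrightarrow> \<bar>f y\<bar> \<le> C0" using bd[OF cf] by blast
  obtain C1 where C1: "C1 \<ge> 0" "\<And>b y. b \<in> (Basis::'a set) \<Longrightarrow> y \<in> K \<Longrightarrow> \<bar>f1 y b\<bar> \<le> C1"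
    using fam[of Basis "\<lambda>b y. f1 y b"] continuous_f1 by auto
  obtain C2 where C2: "C2 \<ge> 0" "\<And>b c y. b \<in> (Basis::'a set) \<Longrightarrow> c \<in> (Basis::'a set) \<Longrightarrow> y \<in> K \<Longrightarrow> \<bar>f2 y b c\<bar> \<le> C2"
    using fam[of "Basis \<times> Basis" "\<lambda>(b,c) y. f2 y b c"] continuous_f2 by auto
  obtain C3 where C3: "C3 \<ge> 0" "\<And>b c d y. b \<in> (Basis::'a set) \<Longrightarrow> c \<in> (Basis::'a set) \<Longrightarrow> d \<in> (Basis::'a set)
      \<Longrightarrow> y \<in> K \<Longrightarrow> \<bar>f3 y b c d\<bar> \<le> C3"
    using fam[of "Basis \<times> Basis \<times> Basis" "\<lambda>(b,c,d) y. f3 y b c d"] c3 by auto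
  define N where "N = real DIM('a)"
  define C where "C = \<bar>C0\<bar> + N * C1 + N^2 * C2 + N^3 * C3"
  have N: "N \<ge> 0" by (simp add: N_def)
  note nn = C1(1) C2(1) C3(1) N
  have CC: "C \<ge> 0" "C0 \<le> C" "N * C1 \<le> C" "N^2 * C2 \<le> C" "N^3 * C3 \<le> C"
    using nn mult_nonneg_nonneg[of N C1] mult_nonneg_nonneg[of "N^2" C2] mult_nonneg_nonneg[of "N^3" C3]
    unfolding C_def by (auto simp del: mult_nonneg_nonneg zero_le_mult_iff)
  show ?thesis
  proof (intro exI[of _ C] conjI ballI allI)
    fix y h k l assume y: "y \<in> K"
    show "\<bar>f y\<bar> \<le> C" using C0[OF y] CC by linarith
    have "\<bar>f1 y h\<bar> \<le> N * C1 * norm h" unfolding N_def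
      by (rule linear_abs_le_basis[OF linear_f1]) (use C1 y in auto)
    also have "\<dots> \<le> C * norm h" using CC by (intro mult_right_mono) auto
    finally show "\<bar>f1 y h\<bar> \<le> C * norm h" .
    have 1: "\<bar>f2 y b k\<bar> \<le> N * C2 * norm k" if "b \<in> Basis" for b unfolding N_def
      by (rule linear_abs_le_basis[OF linear_f2]) (use that C2 y in auto)
    have "\<bar>f2 y h k\<bar> \<le> N * (N * C2 * norm k) * norm h" unfolding N_def
      by (rule linear_abs_le_basis[OF linear_f2_fst]) (use 1[unfolded N_def] in auto)
    also have "\<dots> = N^2 * C2 * (norm h * norm k)" by (simp add: power2_eq_square mult_ac)
    also have "\<dots> \<le> C * (norm h * norm k)" using CC by (intro mult_right_mono) auto
    finally show "\<bar>f2 y h k\<bar> \<le> C * norm h * norm k" by (simp add: mult_ac)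
    have 1: "\<bar>f3 y b c l\<bar> \<le> N * C3 * norm l" if "b \<in> Basis" "c \<in> Basis" for b c unfolding N_def
      by (rule linear_abs_le_basis[OF linear_f3]) (use that C3 y in auto)
    have 2: "\<bar>f3 y b k l\<bar> \<le> N * (N * C3 * norm l) * norm k" if "b \<in> Basis" for b unfolding N_def
      by (rule linear_abs_le_basis[OF linear_f3_snd]) (use 1[unfolded N_def] that in auto)
    have "\<bar>f3 y h k l\<bar> \<le> N * (N * (N * C3 * norm l) * norm k) * norm h" unfolding N_def
      by (rule linear_abs_le_basis[OF linear_f3_fst]) (use 2[unfolded N_def] in auto)
    also have "\<dots> = N^3 * C3 * (norm h * norm k * norm l)" by (simp add: power3_eq_cube mult_ac)
    also have "\<dots> \<le> C * (norm h * norm k * norm l)" using CC by (intro mult_right_mono) auto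
    finally show "\<bar>f3 y h k l\<bar> \<le> C * norm h * norm k * norm l" by (simp add: mult_ac)
  qed (use CC in auto)
qed

lemma directional_derivative_f: "y + s *\<^sub>R h \<in> U \<Longrightarrow> ((\<lambda>r. f (y + r *\<^sub>R h)) has_real_derivative f1 (y + s *\<^sub>R h) h) (at s)"
  by (rule has_derivative_directional) (rule d1)

lemma directional_derivative_f1: "y + s *\<^sub>R h \<in> U \<Longrightarrow> ((\<lambda>r. f1 (y + r *\<^sub>R h) k) has_real_derivative f2 (y + s *\<^sub>R h) k h) (at s)"
  by (rule has_derivative_directional) (rule d2)

lemma directional_derivative_f2: "y + s *\<^sub>R h \<in> U \<Longrightarrow> ((\<lambda>r. f2 (y + r *\<^sub>R h) k l) has_real_derivative f3 (y + s *\<^sub>R h) k l h) (at s)"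
  by (rule has_derivative_directional) (rule d3)

text \<open>The mean value theorem is applied once in each direction. The left side does not change
  when \<open>h\<close> and \<open>k\<close> are exchanged, which is what symmetry of the second
  derivative rests on.\<close>

lemma second_difference:
  assumes "\<And>a b. a \<in> {0..s} \<Longrightarrow> b \<in> {0..s} \<Longrightarrow> y + a *\<^sub>R h + b *\<^sub>R k \<in> U" "s > 0"
  shows "\<exists>a\<in>{0..s}. \<exists>b\<in>{0..s}. f (y + s *\<^sub>R h + s *\<^sub>R k) - f (y + s *\<^sub>R h) - f (y + s *\<^sub>R k) + f y
     = s * s * f2 (y + a *\<^sub>R h + b *\<^sub>R k) h k"
proof -
  have U1: "(y + s *\<^sub>R k) + a *\<^sub>R h \<in> U" "y + a *\<^sub>R h \<in> U" if "a \<in> {0..s}" for a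
    using assms(1)[OF that, of s] assms(1)[OF that, of 0] assms(2) by (auto simp: algebra_simps)
  have "\<exists>a>0. a < s \<and> (f ((y + s *\<^sub>R k) + s *\<^sub>R h) - f (y + s *\<^sub>R h)) - (f ((y + s *\<^sub>R k) + 0 *\<^sub>R h) - f (y + 0 *\<^sub>R h))
      = (s - 0) * (f1 ((y + s *\<^sub>R k) + a *\<^sub>R h) h - f1 (y + a *\<^sub>R h) h)"
    by (rule MVT2[where f = "\<lambda>a. f ((y + s *\<^sub>R k) + a *\<^sub>R h) - f (y + a *\<^sub>R h)"])
      (use assms(2) U1 in \<open>auto intro!: DERIV_diff directional_derivative_f\<close>)
  then obtain a where a: "0 < a" "a < s"
    "f (y + s *\<^sub>R h + s *\<^sub>R k) - f (y + s *\<^sub>R h) - f (y + s *\<^sub>R k) + f y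
      = s * (f1 (y + a *\<^sub>R h + s *\<^sub>R k) h - f1 (y + a *\<^sub>R h) h)" by (auto simp: algebra_simps)
  have "\<exists>b>0. b < s \<and> f1 ((y + a *\<^sub>R h) + s *\<^sub>R k) h - f1 ((y + a *\<^sub>R h) + 0 *\<^sub>R k) h
      = (s - 0) * f2 ((y + a *\<^sub>R h) + b *\<^sub>R k) h k"
    by (rule MVT2[where f = "\<lambda>b. f1 ((y + a *\<^sub>R h) + b *\<^sub>R k) h"])
      (use assms(2) a assms(1) in \<open>auto intro!: directional_derivative_f1\<close>)
  then obtain b where b: "0 < b" "b < s" "f1 (y + a *\<^sub>R h + s *\<^sub>R k) h - f1 (y + a *\<^sub>R h) h = s * f2 (y + a *\<^sub>R h + b *\<^sub>R k) h k"
    by auto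
  show ?thesis using a b by (intro bexI[of _ a] bexI[of _ b]) auto
qed

text \<open>Both orders of differentiation are limits of the same second difference, and continuity
  of \<open>f2\<close> lets the intermediate points collapse to \<open>y\<close>.\<close>

lemma f2_sym: "f2 y h k = f2 y k h"
proof (cases "y \<in> U")
  case y: True
  show ?thesis
  proof (rule ccontr)
    assume ne: "f2 y h k \<noteq> f2 y k h"
    define e where "e = \<bar>f2 y h k - f2 y k h\<bar> / 2"
    have e: "e > 0" using ne by (simp add: e_def)
    have c: "isCont (\<lambda>y. f2 y h k) y" "isCont (\<lambda>y. f2 y k h) y"
      using continuous_f2 openU y by (auto simp: continuous_on_eq_continuous_at)
    obtain d1 where d1: "d1 > 0" "\<And>z. dist z y < d1 \<Longrightarrow> \<bar>f2 z h k - f2 y h k\<bar> < e"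
      using c(1) e unfolding continuous_at_eps_delta dist_real_def by metis
    obtain d2 where d2: "d2 > 0" "\<And>z. dist z y < d2 \<Longrightarrow> \<bar>f2 z k h - f2 y k h\<bar> < e"
      using c(2) e unfolding continuous_at_eps_delta dist_real_def by metis
    obtain d0 where d0: "d0 > 0" "\<And>z. dist z y < d0 \<Longrightarrow> z \<in> U"
      using openU y unfolding open_dist by metis
    define d where "d = min d0 (min d1 d2)"
    have d: "d > 0" using d0 d1 d2 by (simp add: d_def)
    \<comment> \<open>Half the radius, so that the parallelogram spanned by \<open>s h\<close> and
      \<open>s k\<close> stays strictly inside the ball; the summand 1 avoids a zero
      denominator.\<close>
    define s where "s = d / (2 * (norm h + norm k + 1))"
    have s: "s > 0" using d by (simp add: s_def add_nonneg_pos)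
    have sd: "s * (norm h + norm k + 1) < d" using d
      by (simp add: s_def field_simps add_nonneg_pos add_pos_nonneg)
    have near: "dist (y + a *\<^sub>R h + b *\<^sub>R k) y < d" if "a \<in> {0..s}" "b \<in> {0..s}" for a b
    proof -
      have "dist (y + a *\<^sub>R h + b *\<^sub>R k) y \<le> a * norm h + b * norm k"
        using norm_triangle_ineq[of "a *\<^sub>R h" "b *\<^sub>R k"] that by (simp add: dist_norm add.assoc)
      also have "\<dots> \<le> s * norm h + s * norm k" using that by (intro add_mono mult_right_mono) auto
      also have "\<dots> \<le> s * (norm h + norm k + 1)" using s by (simp add: algebra_simps)
      finally show ?thesis using sd by simp
    qed
    have nU: "y + a *\<^sub>R h + b *\<^sub>R k \<in> U" if "a \<in> {0..s}" "b \<in> {0..s}" for a b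
      using d0(2) near[OF that] by (simp add: d_def)
    obtain a b where ab: "a \<in> {0..s}" "b \<in> {0..s}" "f (y + s *\<^sub>R h + s *\<^sub>R k) - f (y + s *\<^sub>R h) - f (y + s *\<^sub>R k) + f y
     = s * s * f2 (y + a *\<^sub>R h + b *\<^sub>R k) h k"
      using second_difference[of s y h k] nU s by metis
    have nU': "y + a *\<^sub>R k + b *\<^sub>R h \<in> U" if "a \<in> {0..s}" "b \<in> {0..s}" for a b
      using nU[OF that(2,1)] by (simp add: algebra_simps)
    obtain a' b' where ab': "a' \<in> {0..s}" "b' \<in> {0..s}" "f (y + s *\<^sub>R k + s *\<^sub>R h) - f (y + s *\<^sub>R k) - f (y + s *\<^sub>R h) + f y
     = s * s * f2 (y + a' *\<^sub>R k + b' *\<^sub>R h) k h"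
      using second_difference[of s y k h] nU' s by metis
    have eq: "f2 (y + a *\<^sub>R h + b *\<^sub>R k) h k = f2 (y + b' *\<^sub>R h + a' *\<^sub>R k) k h"
    proof -
      have "s * s * f2 (y + a *\<^sub>R h + b *\<^sub>R k) h k = s * s * f2 (y + a' *\<^sub>R k + b' *\<^sub>R h) k h"
        using ab(3) ab'(3) by (simp add: algebra_simps)
      then show ?thesis using s by (simp add: algebra_simps)
    qed
    have "\<bar>f2 (y + a *\<^sub>R h + b *\<^sub>R k) h k - f2 y h k\<bar> < e"
      using d1(2) near[OF ab(1,2)] by (simp add: d_def)
    moreover have "\<bar>f2 (y + b' *\<^sub>R h + a' *\<^sub>R k) k h - f2 y k h\<bar> < e"
      using d2(2) near[OF ab'(2,1)] by (simp add: d_def)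
    ultimately show False using eq unfolding e_def by (smt (verit) field_sum_of_halves)
  qed
qed (simp add: out)

end

section \<open>Essentially bounded functions on the unit interval\<close>

text \<open>Lebesgue measure on the open unit interval as a measure of total mass 1. The set
  integrals and the guarded almost-everywhere statements of the theorem become ordinary ones over
  \<open>mu\<close>, and essentially bounded functions are integrable.\<close>

definition mu :: "real measure" where "mu = restrict_space lborel I01"

lemma I01_sets: "I01 \<inter> space lborel \<in> sets lborel" by (simp add: I01_def)

lemma space_mu [simp]: "space mu = I01" by (simp add: mu_def space_restrict_space)

lemma borel_measurable_muI: "g \<in> borel_measurable borel \<Longrightarrow> g \<in> borel_measurable mu"
  unfolding mu_def by (rule measurable_restrict_space1) simp

lemma measure_mu_space [simp]: "measure mu I01 = 1"
  unfolding mu_def by (subst measure_restrict_space) (auto simp: I01_def)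

lemma emeasure_mu_space: "emeasure mu (space mu) = 1"
  unfolding mu_def by (subst emeasure_restrict_space) (auto simp: I01_def)

lemma AE_mu_const: "(AE t in mu. P) \<longleftrightarrow> P"
proof (cases P)
  case False
  have "ae_filter mu \<noteq> bot" by (simp add: ae_filter_eq_bot_iff emeasure_mu_space del: space_mu)
  then have "\<not> (AE t in mu. False)" by (simp add: trivial_limit_def)
  with False show ?thesis by simp
qed simp

interpretation mu: finite_measure mu
  by standard (simp add: emeasure_mu_space del: space_mu)

lemma set_integral_mu:
  fixes g :: "real \<Rightarrow> 'a::{banach, second_countable_topology}"
  shows "set_lebesgue_integral lborel I01 g = integral\<^sup>L mu g"
  unfolding set_lebesgue_integral_def mu_def by (rule integral_restrict_space[OF I01_sets, symmetric])

lemma AE_mu: "(AE t in lborel. t \<in> I01 \<longrightarrow> P t) \<longleftrightarrow> (AE t in mu. P t)"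
  unfolding mu_def by (rule AE_restrict_space_iff[OF I01_sets, symmetric])

lemma is_Linf_iff:
  "is_Linf g \<longleftrightarrow> g \<in> borel_measurable mu \<and> (\<exists>C. AE t in mu. norm (g t) \<le> C)"
  unfolding is_Linf_def AE_mu set_borel_measurable_def
  unfolding mu_def borel_measurable_restrict_space_iff[OF I01_sets] ..

lemma is_LinfI: "g \<in> borel_measurable mu \<Longrightarrow> (AE t in mu. norm (g t) \<le> C) \<Longrightarrow> is_Linf g"
  by (auto simp: is_Linf_iff)

lemma is_Linf_measurable: "is_Linf g \<Longrightarrow> g \<in> borel_measurable mu"
  by (simp add: is_Linf_iff)

lemma is_Linf_bound:
  assumes "is_Linf g" obtains C where "C \<ge> 0" "AE t in mu. norm (g t) \<le> C"
proof -
  obtain C where "AE t in mu. norm (g t) \<le> C" using assms by (auto simp: is_Linf_iff)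
  then have "AE t in mu. norm (g t) \<le> \<bar>C\<bar>" by eventually_elim auto
  then show ?thesis using that[of "\<bar>C\<bar>"] by simp
qed

lemma Linf_nonneg: "is_Linf g \<Longrightarrow> Linf g \<ge> 0"
  unfolding Linf_def AE_mu by (intro cInf_greatest) (auto elim: is_Linf_bound)

lemma Linf_leI:
  assumes "C \<ge> 0" "AE t in mu. norm (g t) \<le> C" shows "Linf g \<le> C"
  unfolding Linf_def AE_mu using assms by (intro cInf_lower) (auto intro!: bdd_belowI[of _ 0])

text \<open>The infimum is attained: the exceptional sets for the bounds exceeding it by 1 / (n + 1)
  are countably many null sets.\<close>

lemma AE_Linf:
  assumes "is_Linf g" shows "AE t in mu. norm (g t) \<le> Linf g"
proof -
  define S where "S = {C. C \<ge> 0 \<and> (AE t in mu. norm (g t) \<le> C)}"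
  have S: "S \<noteq> {}" using is_Linf_bound[OF assms] by (auto simp: S_def)
  have "AE t in mu. norm (g t) \<le> Linf g + 1 / Suc n" for n :: nat
  proof -
    have "Inf S < Inf S + 1 / Suc n" by simp
    then obtain C where "C \<in> S" "C < Inf S + 1 / Suc n" using S cInf_lessD by blast
    then show ?thesis unfolding Linf_def AE_mu S_def[symmetric] by (auto simp: S_def elim!: eventually_mono)
  qed
  then have "AE t in mu. \<forall>n::nat. norm (g t) \<le> Linf g + 1 / Suc n" by (simp add: AE_all_countable)
  then show ?thesis
  proof eventually_elim
    case (elim t)
    show ?case
    proof (rule field_le_epsilon)
      fix e :: real assume "e > 0"
      then obtain n :: nat where "1 / Suc n < e" using nat_approx_posE by auto
      then show "norm (g t) \<le> Linf g + e" using elim[rule_format, of n] by linarith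
    qed
  qed
qed

lemma is_Linf_add:
  fixes f g :: "real \<Rightarrow> 'a::euclidean_space"
  assumes "is_Linf f" "is_Linf g" shows "is_Linf (\<lambda>t. f t + g t)"
proof -
  obtain C where C: "AE t in mu. norm (f t) \<le> C" by (rule is_Linf_bound[OF assms(1)])
  obtain D where D: "AE t in mu. norm (g t) \<le> D" by (rule is_Linf_bound[OF assms(2)])
  show ?thesis
  proof (rule is_LinfI)
    show "AE t in mu. norm (f t + g t) \<le> C + D" using C D by eventually_elim norm
  qed (use assms[THEN is_Linf_measurable] in \<open>auto intro: borel_measurable_Pair\<close>)
qed

lemma is_Linf_const: fixes c :: "'a::euclidean_space" shows "is_Linf (\<lambda>t. c)"
  by (rule is_LinfI[of _ "norm c"]) auto

lemma is_Linf_norm: 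
  fixes f :: "real \<Rightarrow> 'a::euclidean_space"
  assumes "is_Linf f" shows "is_Linf (\<lambda>t. norm (f t))"
  using assms by (auto simp: is_Linf_iff)

lemma is_Linf_mult:
  fixes f g :: "real \<Rightarrow> real"
  assumes "is_Linf f" "is_Linf g" shows "is_Linf (\<lambda>t. f t * g t)"
proof -
  obtain C where C: "C \<ge> 0" "AE t in mu. norm (f t) \<le> C" by (rule is_Linf_bound[OF assms(1)])
  obtain D where D: "D \<ge> 0" "AE t in mu. norm (g t) \<le> D" by (rule is_Linf_bound[OF assms(2)])
  show ?thesis
  proof (rule is_LinfI)
    show "AE t in mu. norm (f t * g t) \<le> C * D" using C(2) D(2)
      by eventually_elim (auto simp: norm_mult abs_mult intro!: mult_mono C D)
  qed (use assms[THEN is_Linf_measurable] in \<open>auto intro: borel_measurable_Pair\<close>)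
qed

lemma is_Linf_scaleR:
  fixes g :: "real \<Rightarrow> 'a::euclidean_space"
  assumes "is_Linf f" "is_Linf g" shows "is_Linf (\<lambda>t. f t *\<^sub>R g t)"
proof -
  obtain C where C: "C \<ge> 0" "AE t in mu. norm (f t) \<le> C" by (rule is_Linf_bound[OF assms(1)])
  obtain D where D: "D \<ge> 0" "AE t in mu. norm (g t) \<le> D" by (rule is_Linf_bound[OF assms(2)])
  show ?thesis
  proof (rule is_LinfI)
    show "AE t in mu. norm (f t *\<^sub>R g t) \<le> C * D" using C(2) D(2)
      by eventually_elim (auto intro!: mult_mono C D)
  qed (use assms[THEN is_Linf_measurable] in \<open>auto intro: borel_measurable_Pair\<close>)
qed

lemma is_Linf_inner:
  fixes f g :: "real \<Rightarrow> 'a::euclidean_space"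
  assumes "is_Linf f" "is_Linf g" shows "is_Linf (\<lambda>t. f t \<bullet> g t)"
proof -
  obtain C where C: "C \<ge> 0" "AE t in mu. norm (f t) \<le> C" by (rule is_Linf_bound[OF assms(1)])
  obtain D where D: "D \<ge> 0" "AE t in mu. norm (g t) \<le> D" by (rule is_Linf_bound[OF assms(2)])
  show ?thesis
  proof (rule is_LinfI)
    show "AE t in mu. norm (f t \<bullet> g t) \<le> C * D" using C(2) D(2)
    proof eventually_elim
      case (elim t)
      have "norm (f t \<bullet> g t) \<le> norm (f t) * norm (g t)" by (simp add: Cauchy_Schwarz_ineq2)
      also have "\<dots> \<le> C * D" using elim by (intro mult_mono C D) auto
      finally show ?case .
    qed
  qed (use assms[THEN is_Linf_measurable] in \<open>auto intro: borel_measurable_Pair\<close>)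
qed

lemma is_Linf_Pair:
  fixes f g :: "real \<Rightarrow> 'a::euclidean_space"
  assumes "is_Linf f" "is_Linf g" shows "is_Linf (\<lambda>t. (f t, g t))"
proof -
  obtain C where C: "C \<ge> 0" "AE t in mu. norm (f t) \<le> C" by (rule is_Linf_bound[OF assms(1)])
  obtain D where D: "D \<ge> 0" "AE t in mu. norm (g t) \<le> D" by (rule is_Linf_bound[OF assms(2)])
  show ?thesis
  proof (rule is_LinfI)
    show "AE t in mu. norm (f t, g t) \<le> C + D" using C(2) D(2)
    proof eventually_elim
      case (elim t)
      then show ?case using norm_Pair_le[of "f t" "g t"] by linarith
    qed
  qed (use assms[THEN is_Linf_measurable] in \<open>auto intro: borel_measurable_Pair\<close>)
qed

lemma is_Linf_cong:
  assumes "\<And>t. t \<in> I01 \<Longrightarrow> f t = g t" "is_Linf f" shows "is_Linf g"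
proof -
  obtain C where C: "AE t in mu. norm (f t) \<le> C" by (rule is_Linf_bound[OF assms(2)])
  show ?thesis
  proof (rule is_LinfI)
    show "g \<in> borel_measurable mu"
      using is_Linf_measurable[OF assms(2)] measurable_cong[of mu f g borel] assms(1) by simp
    show "AE t in mu. norm (g t) \<le> C"
      using C AE_space by eventually_elim (use assms(1) in auto)
  qed
qed

lemmas is_Linf_intros = is_Linf_add is_Linf_const is_Linf_norm is_Linf_mult is_Linf_scaleR is_Linf_inner is_Linf_Pair

lemma is_Linf_uminus: "is_Linf g \<Longrightarrow> is_Linf (\<lambda>t. - (g t::real))"
  using is_Linf_mult[OF is_Linf_const[of "-1"], of g] by simp

lemma is_Linf_diff: "is_Linf f \<Longrightarrow> is_Linf g \<Longrightarrow> is_Linf (\<lambda>t. f t - (g t::real))"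
  using is_Linf_add[OF _ is_Linf_uminus, of f g] by simp

lemma is_Linf_power2: "is_Linf f \<Longrightarrow> is_Linf (\<lambda>t. (f t::real)\<^sup>2)"
  unfolding power2_eq_square by (rule is_Linf_mult)

lemma integrable_Linf:
  fixes g :: "real \<Rightarrow> 'a::euclidean_space"
  assumes "is_Linf g" shows "integrable mu g"
proof -
  obtain C where "AE t in mu. norm (g t) \<le> C" by (rule is_Linf_bound[OF assms])
  then show ?thesis using mu.integrable_const_bound is_Linf_measurable[OF assms] by blast
qed

lemma norm_integral_le_AE:
  fixes f :: "'b \<Rightarrow> 'a::euclidean_space"
  assumes "integrable M f" "integrable M g" "AE t in M. norm (f t) \<le> g t"
  shows "norm (integral\<^sup>L M f) \<le> integral\<^sup>L M g"
proof -
  have "norm (integral\<^sup>L M f) \<le> (\<integral>t. norm (f t) \<partial>M)" by (rule integral_norm_bound)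
  also have "\<dots> \<le> integral\<^sup>L M g" using assms by (intro integral_mono_AE integrable_norm)
  finally show ?thesis .
qed

section \<open>The L2 norm on the unit interval\<close>

lemma L2n_mu: "L2n (g::real \<Rightarrow> 'a::euclidean_space) = sqrt (\<integral>t. (norm (g t))\<^sup>2 \<partial>mu)"
  unfolding L2n_def set_integral_mu ..

lemma L2n_nonneg [simp]: "L2n (g::real \<Rightarrow> 'a::euclidean_space) \<ge> 0" unfolding L2n_mu by simp

lemma L2n_sq: "(L2n (g::real \<Rightarrow> 'a::euclidean_space))\<^sup>2 = (\<integral>t. (norm (g t))\<^sup>2 \<partial>mu)"
  unfolding L2n_mu by simp

text \<open>The discriminant argument, isolated because it serves twice: for the L2 product and for
  the second variation. Both forms are only semidefinite, so \<open>C\<close> may vanish.\<close>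

lemma sq_le_mult_if_quadratic_nonneg:
  fixes A B C :: real
  assumes "\<And>s. A + 2 * s * B + s\<^sup>2 * C \<ge> 0" shows "B\<^sup>2 \<le> A * C"
proof (cases "C = 0")
  case True
  have "B = 0"
  proof (rule ccontr)
    assume "B \<noteq> 0"
    then show False using assms[of "(- A - 1) / (2 * B)"] True by (simp add: field_simps)
  qed
  then show ?thesis using True by simp
next
  case False
  have "C > 0"
  proof (rule ccontr)
    assume "\<not> C > 0"
    then have C: "C < 0" using False by simp
    \<comment> \<open>Chosen so that s is at least 1 and s (- C) exceeds 2 |B| by at least |A| + 1;
      the quadratic is then negative at s.\<close>
    define s where "s = (2 * \<bar>B\<bar> + \<bar>A\<bar> + 1) / (- C) + 1"
    have s: "s \<ge> 1" "s * (- C) = 2 * \<bar>B\<bar> + \<bar>A\<bar> + 1 - C" using C by (auto simp: s_def field_simps)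
    have "A + 2 * s * B + s\<^sup>2 * C = A + s * (2 * B - s * (- C))" by (simp add: power2_eq_square algebra_simps)
    also have "\<dots> \<le> A + s * (- (\<bar>A\<bar> + 1))" unfolding s(2) using C s(1)
      by (intro add_left_mono mult_left_mono) auto
    also have "\<dots> \<le> A - (\<bar>A\<bar> + 1)" using mult_right_mono[OF s(1), of "\<bar>A\<bar> + 1"] by (simp add: algebra_simps)
    finally show False using assms[of s] by linarith
  qed
  have "A + 2 * (- B / C) * B + (- B / C)\<^sup>2 * C \<ge> 0" using assms by blast
  then have "A - B\<^sup>2 / C \<ge> 0" using \<open>C > 0\<close> by (simp add: field_simps power2_eq_square)
  then show ?thesis using \<open>C > 0\<close> by (simp add: field_simps)
qed

lemma L2n_Cauchy_Schwarz:
  fixes f :: "real \<Rightarrow> 'a::euclidean_space" and g :: "real \<Rightarrow> 'b::euclidean_space"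
  assumes "is_Linf f" "is_Linf g"
  shows "(\<integral>t. norm (f t) * norm (g t) \<partial>mu) \<le> L2n f * L2n g"
proof -
  note I = assms[THEN is_Linf_norm]
  have int: "integrable mu (\<lambda>t. norm (f t) * norm (g t))" "integrable mu (\<lambda>t. (norm (f t))\<^sup>2)"
    "integrable mu (\<lambda>t. (norm (g t))\<^sup>2)"
    using I by (auto intro!: integrable_Linf is_Linf_mult is_Linf_power2)
  have "(\<integral>t. norm (f t) * norm (g t) \<partial>mu)\<^sup>2 \<le> (\<integral>t. (norm (f t))\<^sup>2 \<partial>mu) * (\<integral>t. (norm (g t))\<^sup>2 \<partial>mu)"
  proof (rule sq_le_mult_if_quadratic_nonneg)
    fix s :: real
    have "0 \<le> (\<integral>t. (norm (f t) + s * norm (g t))\<^sup>2 \<partial>mu)" by simp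
    also have "\<dots> = (\<integral>t. (norm (f t))\<^sup>2 + 2 * s * (norm (f t) * norm (g t)) + s\<^sup>2 * (norm (g t))\<^sup>2 \<partial>mu)"
      by (intro Bochner_Integration.integral_cong) (auto simp: power2_eq_square algebra_simps)
    also have "\<dots> = (\<integral>t. (norm (f t))\<^sup>2 \<partial>mu) + 2 * s * (\<integral>t. norm (f t) * norm (g t) \<partial>mu)
        + s\<^sup>2 * (\<integral>t. (norm (g t))\<^sup>2 \<partial>mu)" using int by simp
    finally show "0 \<le> \<dots>" .
  qed
  also have "\<dots> = (L2n f * L2n g)\<^sup>2" by (simp add: L2n_sq power_mult_distrib)
  finally show ?thesis by (rule power2_le_imp_le) simp
qed

lemma L2n_mono:
  fixes f :: "real \<Rightarrow> 'a::euclidean_space" and g :: "real \<Rightarrow> 'b::euclidean_space"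
  assumes "is_Linf f" "is_Linf g" "AE t in mu. norm (f t) \<le> norm (g t)"
  shows "L2n f \<le> L2n g"
  unfolding L2n_mu using assms
  by (intro real_sqrt_le_mono integral_mono_AE integrable_Linf is_Linf_power2 is_Linf_norm)
    (auto elim!: eventually_mono intro: power_mono)

lemma L2n_scaleR: "L2n (\<lambda>t. s *\<^sub>R g t) = \<bar>s\<bar> * L2n (g :: real \<Rightarrow> 'a::euclidean_space)"
  unfolding L2n_mu by (simp add: power_mult_distrib real_sqrt_mult)

lemma L2n_mult: "L2n (\<lambda>t. s * g t) = \<bar>s\<bar> * L2n (g :: real \<Rightarrow> real)"
  using L2n_scaleR[of s g] by simp

lemma L2n_norm: "L2n (\<lambda>t. norm (g t)) = L2n (g :: real \<Rightarrow> 'a::euclidean_space)"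
  unfolding L2n_mu by simp

lemma L2n_zero [simp]: "L2n (\<lambda>t. 0 :: 'a::euclidean_space) = 0"
  unfolding L2n_mu by simp

lemma L2n_const: "L2n (\<lambda>t. c :: 'a::euclidean_space) = norm c"
  unfolding L2n_mu by simp

lemma L2n_triangle:
  fixes f g :: "real \<Rightarrow> 'a::euclidean_space"
  assumes "is_Linf f" "is_Linf g"
  shows "L2n (\<lambda>t. f t + g t) \<le> L2n f + L2n g"
proof (rule power2_le_imp_le)
  note I = assms[THEN is_Linf_norm]
  have "(L2n (\<lambda>t. f t + g t))\<^sup>2 \<le> (\<integral>t. (norm (f t))\<^sup>2 + 2 * (norm (f t) * norm (g t)) + (norm (g t))\<^sup>2 \<partial>mu)"
    unfolding L2n_sq
  proof (intro integral_mono)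
    show "(norm (f t + g t))\<^sup>2 \<le> (norm (f t))\<^sup>2 + 2 * (norm (f t) * norm (g t)) + (norm (g t))\<^sup>2" for t
      using power_mono[OF norm_triangle_ineq[of "f t" "g t"], of 2] by (simp add: power2_sum)
  qed (use I assms in \<open>auto intro!: integrable_Linf is_Linf_mult is_Linf_power2 is_Linf_norm is_Linf_add is_Linf_const\<close>)
  also have "\<dots> = (L2n f)\<^sup>2 + 2 * (\<integral>t. norm (f t) * norm (g t) \<partial>mu) + (L2n g)\<^sup>2"
    unfolding L2n_sq using I by (simp add: integrable_Linf is_Linf_mult is_Linf_power2)
  also have "\<dots> \<le> (L2n f)\<^sup>2 + 2 * (L2n f * L2n g) + (L2n g)\<^sup>2"
    using L2n_Cauchy_Schwarz[OF assms] by simp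
  finally show "(L2n (\<lambda>t. f t + g t))\<^sup>2 \<le> (L2n f + L2n g)\<^sup>2" by (simp add: power2_sum)
qed simp

text \<open>The common route from pointwise to integral bounds: a product of two pointwise norms
  turns into a product of L2 norms, and integrability comes along.\<close>

lemma abs_integral_le_L2n:
  fixes f :: "real \<Rightarrow> 'a::euclidean_space" and g :: "real \<Rightarrow> 'b::euclidean_space" and \<phi> :: "real \<Rightarrow> real"
  assumes "is_Linf f" "is_Linf g" "\<phi> \<in> borel_measurable mu" "C \<ge> 0"
    and le: "AE t in mu. \<bar>\<phi> t\<bar> \<le> C * (norm (f t) * norm (g t))"
  shows "\<bar>\<integral>t. \<phi> t \<partial>mu\<bar> \<le> C * (L2n f * L2n g)" "integrable mu \<phi>"
proof -
  have I: "integrable mu (\<lambda>t. C * (norm (f t) * norm (g t)))"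
    using assms(1,2) by (intro integrable_Linf is_Linf_intros)
  show int: "integrable mu \<phi>"
    by (rule Bochner_Integration.integrable_bound[OF I assms(3)]) (use le assms(4) in \<open>auto elim!: eventually_mono\<close>)
  have "\<bar>\<integral>t. \<phi> t \<partial>mu\<bar> \<le> (\<integral>t. \<bar>\<phi> t\<bar> \<partial>mu)" by (rule integral_abs_bound)
  also have "\<dots> \<le> (\<integral>t. C * (norm (f t) * norm (g t)) \<partial>mu)"
    using int I le by (intro integral_mono_AE) auto
  also have "\<dots> = C * (\<integral>t. norm (f t) * norm (g t) \<partial>mu)" by simp
  also have "\<dots> \<le> C * (L2n f * L2n g)" by (intro mult_left_mono L2n_Cauchy_Schwarz assms)
  finally show "\<bar>\<integral>t. \<phi> t \<partial>mu\<bar> \<le> C * (L2n f * L2n g)" .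
qed

lemma integral_norm_le_L2n:
  fixes f :: "real \<Rightarrow> 'a::euclidean_space"
  assumes "is_Linf f" shows "(\<integral>t. norm (f t) \<partial>mu) \<le> L2n f"
  using L2n_Cauchy_Schwarz[OF assms is_Linf_const[of "1::real"]] by (simp add: L2n_const)

section \<open>Primitives and curves with essentially bounded derivative\<close>

definition prim :: "(real \<Rightarrow> 'a::euclidean_space) \<Rightarrow> real \<Rightarrow> 'a" where
  "prim g t = (\<integral>s. indicator {..t} s *\<^sub>R g s \<partial>mu)"

text \<open>Passing to \<open>mu\<close> changes the domain only by end points, a null set. Since
  \<open>mu\<close> itself cuts off at 0 and 1, \<open>prim\<close> makes sense for every real
  argument and is Lipschitz on the whole line.\<close>

lemma set_integral_eq_prim:
  fixes g :: "real \<Rightarrow> 'a::euclidean_space"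
  assumes "t \<in> {0..1}"
  shows "set_lebesgue_integral lborel {0..t} g = prim g t"
proof -
  have "prim g t = (\<integral>s. indicator I01 s *\<^sub>R (indicator {..t} s *\<^sub>R g s) \<partial>lborel)"
    unfolding prim_def mu_def by (rule integral_restrict_space[OF I01_sets])
  also have "\<dots> = (\<integral>s. indicator {0..t} s *\<^sub>R g s \<partial>lborel)"
    by (rule integral_discrete_difference[of "{0,1}"])
      (use assms in \<open>auto simp: I01_def indicator_def\<close>)
  finally show ?thesis by (simp add: set_lebesgue_integral_def)
qed

lemma W1inf_iff: "W1inf x x' \<longleftrightarrow> is_Linf x' \<and> (\<forall>t\<in>{0..1}. x t = x 0 + prim x' t)"
  unfolding W1inf_def by (intro conj_cong refl ball_cong) (simp only: set_integral_eq_prim)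

lemma is_Linf_indicator: "is_Linf (indicator {..t::real} :: real \<Rightarrow> real)"
  by (rule is_LinfI[of _ 1]) (auto intro!: borel_measurable_muI simp: indicator_def)

lemma integrable_prim:
  fixes g :: "real \<Rightarrow> 'a::euclidean_space"
  assumes "is_Linf g" shows "integrable mu (\<lambda>s. indicator {..t} s *\<^sub>R g s)"
  by (intro integrable_Linf is_Linf_scaleR assms is_Linf_indicator)

lemma prim_add:
  fixes f g :: "real \<Rightarrow> 'a::euclidean_space"
  assumes "is_Linf f" "is_Linf g" shows "prim (\<lambda>t. f t + g t) t = prim f t + prim g t"
  using integrable_prim[OF assms(1)] integrable_prim[OF assms(2)]
  unfolding prim_def by (simp add: scaleR_add_right)

lemma prim_scaleR: "prim (\<lambda>t. s *\<^sub>R g t) t = s *\<^sub>R prim g t"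
  unfolding prim_def by (subst integral_scaleR_right[symmetric]) (auto simp: mult.commute)

lemma prim_0 [simp]: "prim g 0 = 0"
proof -
  have "prim g 0 = (\<integral>s. 0 \<partial>mu)" unfolding prim_def
    by (intro Bochner_Integration.integral_cong) (auto simp: I01_def)
  then show ?thesis by simp
qed

lemma prim_1: "prim g 1 = integral\<^sup>L mu g"
  unfolding prim_def by (intro Bochner_Integration.integral_cong) (auto simp: I01_def)

lemma norm_prim_le:
  fixes g :: "real \<Rightarrow> 'a::euclidean_space"
  assumes "is_Linf g" shows "norm (prim g t) \<le> (\<integral>s. norm (g s) \<partial>mu)"
proof -
  have "norm (prim g t) \<le> (\<integral>s. norm (indicator {..t} s *\<^sub>R g s) \<partial>mu)" unfolding prim_def by (rule integral_norm_bound)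
  also have "\<dots> \<le> (\<integral>s. norm (g s) \<partial>mu)"
    by (intro integral_mono integrable_norm integrable_prim integrable_Linf assms)
      (auto simp: indicator_def)
  finally show ?thesis .
qed

text \<open>For mean zero the integral up to \<open>t\<close> is the negative of the integral after
  \<open>t\<close>, so twice its norm is bounded by the full integral of the norm. The factor 1/2
  enters the inf-sup constant.\<close>

lemma norm_prim_le_half:
  fixes g :: "real \<Rightarrow> 'a::euclidean_space"
  assumes "is_Linf g" "integral\<^sup>L mu g = 0"
  shows "norm (prim g t) \<le> 1/2 * (\<integral>s. norm (g s) \<partial>mu)"
proof -
  note int = integrable_prim[OF assms(1), of t] integrable_Linf[OF assms(1)]
  have eq: "(\<integral>s. (1 - indicator {..t} s) *\<^sub>R g s \<partial>mu) = - prim g t"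
    using int assms(2) by (simp add: scaleR_diff_left prim_def)
  have int2: "integrable mu (\<lambda>s. (1 - indicator {..t} s) *\<^sub>R g s)"
    using int by (simp add: scaleR_diff_left)
  have "norm (prim g t) + norm (- prim g t)
      \<le> (\<integral>s. norm (indicator {..t} s *\<^sub>R g s) \<partial>mu) + (\<integral>s. norm ((1 - indicator {..t} s) *\<^sub>R g s) \<partial>mu)"
    unfolding eq[symmetric] unfolding prim_def by (intro add_mono integral_norm_bound)
  also have "\<dots> = (\<integral>s. norm (indicator {..t} s *\<^sub>R g s) + norm ((1 - indicator {..t} s) *\<^sub>R g s) \<partial>mu)"
    using int int2 by (intro Bochner_Integration.integral_add[symmetric] integrable_norm)
  also have "\<dots> = (\<integral>s. norm (g s) \<partial>mu)"
    by (intro Bochner_Integration.integral_cong) (auto simp: indicator_def)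
  finally show ?thesis by simp
qed

lemma prim_diff_le:
  fixes g :: "real \<Rightarrow> 'a::euclidean_space"
  assumes "is_Linf g" "C \<ge> 0" "AE t in mu. norm (g t) \<le> C" "s \<le> t"
  shows "norm (prim g t - prim g s) \<le> C * (t - s)"
proof -
  have "prim g t - prim g s = (\<integral>r. indicator {s<..t} r *\<^sub>R g r \<partial>mu)"
    unfolding prim_def
    by (subst Bochner_Integration.integral_diff[OF integrable_prim[OF assms(1)] integrable_prim[OF assms(1)], symmetric],
        intro Bochner_Integration.integral_cong) (use \<open>s \<le> t\<close> in \<open>auto simp: indicator_def\<close>)
  also have "norm \<dots> \<le> (\<integral>r. C * indicator {s<..t} r \<partial>mu)"
  proof (rule norm_integral_le_AE)
    have i: "is_Linf (indicator {s<..t} :: real \<Rightarrow> real)"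
      by (rule is_LinfI[of _ 1]) (auto intro!: borel_measurable_muI simp: indicator_def)
    show "integrable mu (\<lambda>r. indicator {s<..t} r *\<^sub>R g r)"
      by (intro integrable_Linf is_Linf_scaleR i assms)
    show "integrable mu (\<lambda>r. C * indicator {s<..t} r)"
      by (intro integrable_Linf is_Linf_mult is_Linf_const i)
    show "AE r in mu. norm (indicator {s<..t} r *\<^sub>R g r) \<le> C * indicator {s<..t} r"
      using assms(3) by eventually_elim (auto simp: indicator_def)
  qed
  also have "\<dots> = C * measure mu ({s<..t} \<inter> I01)"
    by simp
  also have "\<dots> \<le> C * (t - s)"
  proof (intro mult_left_mono assms(2))
    have "measure mu ({s<..t} \<inter> I01) = measure lborel ({s<..t} \<inter> I01)"
      unfolding mu_def by (rule measure_restrict_space[OF I01_sets]) auto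
    also have "\<dots> \<le> measure lborel {s<..t}"
      using \<open>s \<le> t\<close> by (intro measure_mono_fmeasurable) (auto simp: I01_def fmeasurable_def)
    finally show "measure mu ({s<..t} \<inter> I01) \<le> t - s" using \<open>s \<le> t\<close> by simp
  qed
  finally show ?thesis .
qed

lemma continuous_prim:
  fixes g :: "real \<Rightarrow> 'a::euclidean_space"
  assumes "is_Linf g" shows "continuous_on S (prim g)"
proof -
  obtain C where C: "C \<ge> 0" "AE t in mu. norm (g t) \<le> C" by (rule is_Linf_bound[OF assms])
  have "C-lipschitz_on UNIV (prim g)"
  proof (rule lipschitz_onI)
    fix s t :: real
    show "dist (prim g s) (prim g t) \<le> C * dist s t"
      using prim_diff_le[OF assms C, of s t] prim_diff_le[OF assms C, of t s]
      by (cases "s \<le> t") (auto simp: dist_norm dist_real_def norm_minus_commute)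
  qed (rule C)
  then show ?thesis using lipschitz_on_continuous_on continuous_on_subset by blast
qed

lemma prim_measurable:
  fixes g :: "real \<Rightarrow> 'a::euclidean_space"
  assumes "is_Linf g" shows "prim g \<in> borel_measurable mu"
  by (intro borel_measurable_muI borel_measurable_continuous_onI continuous_prim assms)

lemma is_Linf_prim:
  fixes g :: "real \<Rightarrow> 'a::euclidean_space"
  assumes "is_Linf g" shows "is_Linf (prim g)"
  by (rule is_LinfI[OF prim_measurable]) (auto intro!: AE_I2 norm_prim_le assms)

lemma W1inf_imp_is_Linf:
  assumes "W1inf x x'" shows "is_Linf x" "is_Linf x'"
proof -
  show 1: "is_Linf x'" using assms by (simp add: W1inf_iff)
  show "is_Linf x"
  proof (rule is_Linf_cong[where f = "\<lambda>t. x 0 + prim x' t"])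
    show "x 0 + prim x' t = x t" if "t \<in> I01" for t
    proof -
      have "t \<in> {0..1}" using that by (simp add: I01_def)
      then show ?thesis using assms unfolding W1inf_iff by metis
    qed
  qed (intro is_Linf_add is_Linf_const is_Linf_prim 1)
qed

lemma W1inf_add:
  assumes "W1inf x x'" "W1inf y y'" shows "W1inf (\<lambda>t. x t + y t) (\<lambda>t. x' t + y' t)"
  unfolding W1inf_iff
proof (intro conjI ballI)
  have L: "is_Linf x'" "is_Linf y'" using assms W1inf_imp_is_Linf by blast+
  then show "is_Linf (\<lambda>t. x' t + y' t)" by (rule is_Linf_add)
  fix t :: real assume "t \<in> {0..1}"
  then have "x t = x 0 + prim x' t" "y t = y 0 + prim y' t" using assms unfolding W1inf_iff by blast+
  then show "x t + y t = x 0 + y 0 + prim (\<lambda>t. x' t + y' t) t"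
    by (simp only: prim_add[OF L] add_ac)
qed

lemma W1inf_scaleR:
  assumes "W1inf x x'" shows "W1inf (\<lambda>t. s *\<^sub>R x t) (\<lambda>t. s *\<^sub>R x' t)"
  unfolding W1inf_iff
proof (intro conjI ballI)
  have L: "is_Linf x'" using assms W1inf_imp_is_Linf by blast
  then show "is_Linf (\<lambda>t. s *\<^sub>R x' t)" by (intro is_Linf_scaleR is_Linf_const)
  fix t :: real assume "t \<in> {0..1}"
  then have "x t = x 0 + prim x' t" using assms unfolding W1inf_iff by blast
  then show "s *\<^sub>R x t = s *\<^sub>R x 0 + prim (\<lambda>t. s *\<^sub>R x' t) t"
    by (simp only: prim_scaleR scaleR_add_right)
qed

lemma W1inf_prim: "is_Linf g \<Longrightarrow> W1inf (\<lambda>t. a + prim g t) g"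
  unfolding W1inf_iff by simp

text \<open>Instead of dominated convergence, a quadratic remainder with a constant independent of
  \<open>t\<close> is assumed; over a space of mass 1 it integrates to the same bound.\<close>

lemma has_real_derivative_integral:
  fixes g :: "real \<Rightarrow> real \<Rightarrow> real"
  assumes "\<delta> > 0" and int: "\<And>s. \<bar>s\<bar> < \<delta> \<Longrightarrow> integrable mu (g s)" and int': "integrable mu g'"
    and le: "AE t in mu. \<forall>s. \<bar>s\<bar> < \<delta> \<longrightarrow> \<bar>g s t - g 0 t - s * g' t\<bar> \<le> C * s\<^sup>2"
  shows "((\<lambda>s. \<integral>t. g s t \<partial>mu) has_real_derivative (\<integral>t. g' t \<partial>mu)) (at 0)"
proof -
  \<comment> \<open>The sign of \<open>C\<close> is not assumed. It follows because
    \<open>mu\<close> is not the null measure, so the remainder estimate holds for some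
    \<open>t\<close>.\<close>
  have "AE t in mu. 0 \<le> C * (\<delta>/2)\<^sup>2"
    using le
  proof eventually_elim
    case (elim t)
    from elim[rule_format, of "\<delta>/2"] \<open>\<delta> > 0\<close> show ?case
      using abs_ge_zero[of "g (\<delta>/2) t - g 0 t - \<delta>/2 * g' t"] by linarith
  qed
  then have "AE t in mu. C \<ge> 0"
  proof eventually_elim
    case elim
    have "(\<delta>/2)\<^sup>2 > 0" using \<open>\<delta> > 0\<close> by simp
    with elim show ?case by (simp only: zero_le_mult_iff) linarith
  qed
  then have C: "C \<ge> 0" by (simp add: AE_mu_const)
  have bd: "\<bar>(\<integral>t. g s t \<partial>mu) - (\<integral>t. g 0 t \<partial>mu) - s * (\<integral>t. g' t \<partial>mu)\<bar> \<le> C * s\<^sup>2" if s: "\<bar>s\<bar> < \<delta>" for s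
  proof -
    have "(\<integral>t. g s t \<partial>mu) - (\<integral>t. g 0 t \<partial>mu) - s * (\<integral>t. g' t \<partial>mu) = (\<integral>t. g s t - g 0 t - s * g' t \<partial>mu)"
      using int[OF s] int[of 0] int' \<open>\<delta> > 0\<close> by simp
    also have "\<bar>\<dots>\<bar> \<le> (\<integral>t. C * s\<^sup>2 \<partial>mu)"
      unfolding real_norm_def[symmetric]
      by (rule norm_integral_le_AE) (use le s int[OF s] int[of 0] int' \<open>\<delta> > 0\<close> in \<open>auto elim!: eventually_mono\<close>)
    finally show ?thesis by simp
  qed
  let ?G = "\<lambda>s. \<integral>t. g s t \<partial>mu" and ?D = "\<integral>t. g' t \<partial>mu"
  have "(\<lambda>s. (?G (0 + s) - ?G 0) / s - ?D) \<midarrow>0\<rightarrow> 0"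
  proof (rule Lim_null_comparison)
    have "eventually (\<lambda>s::real. \<bar>s\<bar> < \<delta> \<and> s \<noteq> 0) (at 0)"
      unfolding eventually_at using \<open>\<delta> > 0\<close> by (auto simp: dist_real_def)
    then show "eventually (\<lambda>s. norm ((?G (0 + s) - ?G 0) / s - ?D) \<le> C * \<bar>s\<bar>) (at 0)"
    proof eventually_elim
      case (elim s)
      have "norm ((?G (0 + s) - ?G 0) / s - ?D) = \<bar>?G s - ?G 0 - s * ?D\<bar> / \<bar>s\<bar>"
        using elim by (simp add: abs_divide[symmetric] diff_divide_distrib)
      also have "\<dots> \<le> C * s\<^sup>2 / \<bar>s\<bar>" using bd elim by (intro divide_right_mono) auto
      also have "\<dots> = C * \<bar>s\<bar>" using elim by (cases "s > 0") (auto simp: power2_eq_square)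
      finally show ?case .
    qed
    have "((\<lambda>s::real. C * \<bar>s\<bar>) \<longlongrightarrow> C * \<bar>0\<bar>) (at 0)" by (intro tendsto_intros)
    then show "((\<lambda>s::real. C * \<bar>s\<bar>) \<longlongrightarrow> 0) (at 0)" by simp
  qed
  then show ?thesis unfolding DERIV_def by (simp add: LIM_zero_iff)
qed

section \<open>Derivatives of the travel time functional\<close>

definition pt :: "state \<Rightarrow> real \<Rightarrow> vec2 \<times> vec2" where "pt a t = (sxi a t, sdxi a t)"

definition bounded_state :: "state \<Rightarrow> bool" where
  "bounded_state a \<longleftrightarrow> is_Linf (sxi a) \<and> is_Linf (sdxi a) \<and> is_Linf (slam a)"

lemma state_simps [simp]:
  "sL (sadd a b) = sL a + sL b" "sxi (sadd a b) = (\<lambda>t. sxi a t + sxi b t)"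
  "sdxi (sadd a b) = (\<lambda>t. sdxi a t + sdxi b t)" "slam (sadd a b) = (\<lambda>t. slam a t + slam b t)"
  "sL (sscale s a) = s * sL a" "sxi (sscale s a) = (\<lambda>t. s *\<^sub>R sxi a t)"
  "sdxi (sscale s a) = (\<lambda>t. s *\<^sub>R sdxi a t)" "slam (sscale s a) = (\<lambda>t. s * slam a t)"
  "sL (sdiff a b) = sL a - sL b" "sxi (sdiff a b) = (\<lambda>t. sxi a t - sxi b t)"
  "sdxi (sdiff a b) = (\<lambda>t. sdxi a t - sdxi b t)" "slam (sdiff a b) = (\<lambda>t. slam a t - slam b t)"
  by (simp_all add: sadd_def sscale_def sdiff_def)

lemma state_eqI:
  "sL a = sL b \<Longrightarrow> sxi a = sxi b \<Longrightarrow> sdxi a = sdxi b \<Longrightarrow> slam a = slam b \<Longrightarrow> a = (b::state)"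
  by simp

lemma pt_simps [simp]:
  "pt (sadd a b) t = pt a t + pt b t" "pt (sscale s a) t = s *\<^sub>R pt a t" "pt (sdiff a b) t = pt a t - pt b t"
  by (simp_all add: pt_def)

lemma sadd_sdiff [simp]: "sadd b (sdiff a b) = a"
  by (intro state_eqI) (auto simp: fun_eq_iff)

lemma norm_pt_le: "norm (pt a t) \<le> norm (sxi a t) + norm (sdxi a t)"
  unfolding pt_def by (rule norm_Pair_le)

lemma bounded_state_sadd: "bounded_state a \<Longrightarrow> bounded_state b \<Longrightarrow> bounded_state (sadd a b)"
  unfolding bounded_state_def by (auto intro: is_Linf_add)

lemma bounded_state_sscale: "bounded_state a \<Longrightarrow> bounded_state (sscale s a)"
  unfolding bounded_state_def by (auto intro!: is_Linf_scaleR is_Linf_mult is_Linf_const)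

lemma is_Linf_pt: "bounded_state a \<Longrightarrow> is_Linf (pt a)"
  unfolding bounded_state_def pt_def[abs_def] by (auto intro: is_Linf_Pair)

lemma indZ_imp_is_Linf: "indZ a \<Longrightarrow> is_Linf (sxi a)" "indZ a \<Longrightarrow> is_Linf (sdxi a)"
  unfolding indZ_def using W1inf_imp_is_Linf by blast+

lemma indY_imp_bounded_state: "indY a \<Longrightarrow> bounded_state a"
  unfolding indY_def bounded_state_def using indZ_imp_is_Linf by blast

lemma inY_imp_bounded_state: "inY xO xD a \<Longrightarrow> bounded_state a"
  unfolding inY_def inZ_def bounded_state_def using W1inf_imp_is_Linf by blast

lemma indY_sadd: "indY a \<Longrightarrow> indY b \<Longrightarrow> indY (sadd a b)"
  unfolding indY_def indZ_def by (auto intro: W1inf_add is_Linf_add)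

lemma indY_sscale: "indY a \<Longrightarrow> indY (sscale s a)"
  unfolding indY_def indZ_def by (auto intro!: W1inf_scaleR is_Linf_mult is_Linf_const)

lemma indY_sdiff: "indY a \<Longrightarrow> indY b \<Longrightarrow> indY (sdiff a b)"
  unfolding sdiff_def by (intro indY_sadd indY_sscale)

lemma indY_sdiff_inY: 
  assumes "inY xO xD a" "inY xO xD b" shows "indY (sdiff a b)"
proof -
  have "W1inf (sxi (sdiff a b)) (sdxi (sdiff a b))"
    using W1inf_add[OF _ W1inf_scaleR[of _ _ "-1"], of "sxi a" "sdxi a" "sxi b" "sdxi b"] assms
    by (simp add: inY_def inZ_def)
  moreover have "is_Linf (slam (sdiff a b))"
    using is_Linf_diff assms by (simp add: inY_def)
  ultimately show ?thesis using assms by (simp add: indY_def indZ_def inY_def inZ_def)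
qed

lemma inY_sadd: 
  assumes "inY xO xD a" "indY b" shows "inY xO xD (sadd a b)"
  using assms unfolding inY_def inZ_def indY_def indZ_def by (auto intro: W1inf_add is_Linf_add)

lemma Z2n_nonneg: "Z2n a \<ge> 0" unfolding Z2n_def by simp
lemma Y2n_nonneg: "Y2n a \<ge> 0" unfolding Y2n_def using Z2n_nonneg by simp

lemma Y2n_ge:
  "\<bar>sL a\<bar> \<le> Z2n a" "L2n (sxi a) \<le> Z2n a" "L2n (sdxi a) \<le> Z2n a" "Z2n a \<le> Y2n a"
  "\<bar>sL a\<bar> \<le> Y2n a" "L2n (sxi a) \<le> Y2n a" "L2n (sdxi a) \<le> Y2n a" "L2n (slam a) \<le> Y2n a"
  unfolding Y2n_def Z2n_def by simp_all

lemma L2n_pt_le: assumes "is_Linf (sxi a)" "is_Linf (sdxi a)" shows "L2n (pt a) \<le> Z2n a"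
proof -
  have "L2n (pt a) \<le> L2n (\<lambda>t. norm (sxi a t) + norm (sdxi a t))"
    by (rule L2n_mono) (use assms norm_pt_le in \<open>auto simp: pt_def[abs_def] intro!: is_Linf_intros\<close>)
  also have "\<dots> \<le> L2n (\<lambda>t. norm (sxi a t)) + L2n (\<lambda>t. norm (sdxi a t))"
    by (intro L2n_triangle is_Linf_norm assms)
  also have "\<dots> \<le> Z2n a" by (simp add: L2n_norm Z2n_def)
  finally show ?thesis .
qed

lemma Z2n_sadd:
  assumes "is_Linf (sxi a)" "is_Linf (sdxi a)" "is_Linf (sxi b)" "is_Linf (sdxi b)"
  shows "Z2n (sadd a b) \<le> Z2n a + Z2n b"
  using L2n_triangle[OF assms(1,3)] L2n_triangle[OF assms(2,4)] abs_triangle_ineq[of "sL a" "sL b"]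
  unfolding Z2n_def by simp

lemma Y2n_sscale: "Y2n (sscale s a) = \<bar>s\<bar> * Y2n a"
  unfolding Y2n_def Z2n_def by (simp add: L2n_scaleR L2n_mult abs_mult algebra_simps)

text \<open>Two applications of the mean value inequality give \<open>C\<close> instead of C / 2;
  only the order in \<open>s\<close> matters for the uses below.\<close>

lemma taylor_remainder_bound:
  fixes \<phi> :: "real \<Rightarrow> real"
  assumes "\<And>r. \<bar>r\<bar> \<le> \<bar>s\<bar> \<Longrightarrow> (\<phi> has_real_derivative \<phi>' r) (at r)"
    and "\<And>r. \<bar>r\<bar> \<le> \<bar>s\<bar> \<Longrightarrow> (\<phi>' has_real_derivative \<phi>'' r) (at r)"
    and "\<And>r. \<bar>r\<bar> \<le> \<bar>s\<bar> \<Longrightarrow> \<bar>\<phi>'' r\<bar> \<le> C"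
  shows "\<bar>\<phi> s - \<phi> 0 - s * \<phi>' 0\<bar> \<le> C * s\<^sup>2"
proof -
  have C: "C \<ge> 0" using assms(3)[of 0] by simp
  let ?S = "{-\<bar>s\<bar>..\<bar>s\<bar>}"
  have S: "\<bar>r\<bar> \<le> \<bar>s\<bar>" if "r \<in> ?S" for r using that by auto
  have 1: "\<bar>\<phi>' r - \<phi>' 0\<bar> \<le> C * \<bar>s\<bar>" if r: "r \<in> ?S" for r
  proof -
    have "norm (\<phi>' r - \<phi>' 0) \<le> C * norm (r - 0)"
    proof (rule field_differentiable_bound[of ?S \<phi>' \<phi>''])
      fix z assume "z \<in> ?S"
      then show "(\<phi>' has_real_derivative \<phi>'' z) (at z within ?S)" "norm (\<phi>'' z) \<le> C"
        using assms(2,3) S by (simp_all add: has_field_derivative_at_within)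
    qed (use r in auto)
    also have "\<dots> \<le> C * \<bar>s\<bar>" using C S[OF r] by (auto intro: mult_left_mono)
    finally show ?thesis by simp
  qed
  have "norm ((\<phi> s - s * \<phi>' 0) - (\<phi> 0 - 0 * \<phi>' 0)) \<le> C * \<bar>s\<bar> * norm (s - 0)"
  proof (rule field_differentiable_bound[of ?S "\<lambda>r. \<phi> r - r * \<phi>' 0" "\<lambda>r. \<phi>' r - \<phi>' 0"])
    fix r assume r: "r \<in> ?S"
    show "((\<lambda>r. \<phi> r - r * \<phi>' 0) has_real_derivative \<phi>' r - \<phi>' 0) (at r within ?S)"
      by (rule derivative_eq_intros has_field_derivative_at_within[OF assms(1)[OF S[OF r]]] refl | simp)+
    show "norm (\<phi>' r - \<phi>' 0) \<le> C * \<bar>s\<bar>" using 1[OF r] by simp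
  qed auto
  then show ?thesis by (simp add: power2_eq_square algebra_simps)
qed

text \<open>A compact neighbourhood of the arguments along a curve with positions bounded by
  \<open>X\<close> and constant speed \<open>l\<close>. For r < l the velocity stays away from zero,
  so the integrand and its derivatives are bounded and uniformly continuous there. The solution
  itself has r = 0.\<close>

definition tube :: "real \<Rightarrow> real \<Rightarrow> real \<Rightarrow> (vec2 \<times> vec2) set" where
  "tube X l r = {y. norm (fst y) \<le> X + r \<and> l - r \<le> norm (snd y) \<and> norm (snd y) \<le> l + r}"

lemma tube_add: 
  assumes "y \<in> tube X l r" "norm h \<le> s" shows "y + h \<in> tube X l (r + s)"
proof -
  have "norm (fst h) \<le> s" "norm (snd h) \<le> s"
    using assms(2) norm_fst_le[of "fst h" "snd h"] norm_snd_le[of "snd h" "fst h"] by auto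
  then show ?thesis using assms(1) norm_triangle_ineq[of "fst y" "fst h"] norm_triangle_ineq[of "snd y" "snd h"]
      norm_triangle_ineq4[of "snd y + snd h" "snd h"]
    by (auto simp: tube_def)
qed

lemma tube_mono: "r \<le> s \<Longrightarrow> tube X l r \<subseteq> tube X l s" by (auto simp: tube_def)

lemma compact_tube: "compact (tube X l r)"
proof (rule compact_Int_closed[of "cball 0 (X+r) \<times> cball 0 (l+r)" "{y. l - r \<le> norm (snd y)}", THEN back_subst[where P=compact]])
  show "closed {y::vec2 \<times> vec2. l - r \<le> norm (snd y)}" by (intro closed_Collect_le continuous_intros)
  show "cball 0 (X+r) \<times> cball 0 (l+r) \<inter> {y. l - r \<le> norm (snd y)} = tube X l r"
    by (auto simp: tube_def)
qed (intro compact_Times compact_cball)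

lemma tube_subset: "r < l \<Longrightarrow> tube X l r \<subseteq> nonzero_velocity" by (auto simp: tube_def)

text \<open>The polar form of the constraint: on the diagonal it is \<open>h\<close>, and the
  derivative of \<open>h\<close> is twice this form.\<close>

definition constraint_form :: "state \<Rightarrow> state \<Rightarrow> real \<Rightarrow> real" where
  "constraint_form a d t = sdxi a t \<bullet> sdxi d t - sL a * sL d"

lemma constraint_form_sym: "constraint_form a d t = constraint_form d a t"
  by (simp add: constraint_form_def inner_commute mult.commute)

lemma constraint_form_lin [simp]:
  "constraint_form (sadd a b) d t = constraint_form a d t + constraint_form b d t" "constraint_form (sscale s a) d t = s * constraint_form a d t"
  "constraint_form (sdiff a b) d t = constraint_form a d t - constraint_form b d t"
  by (simp_all add: constraint_form_def inner_simps algebra_simps)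

lemma constraint_form_lin' [simp]:
  "constraint_form d (sadd a b) t = constraint_form d a t + constraint_form d b t" "constraint_form d (sscale s a) t = s * constraint_form d a t"
  "constraint_form d (sdiff a b) t = constraint_form d a t - constraint_form d b t"
  by (simp_all add: constraint_form_def inner_simps algebra_simps)

lemma is_Linf_constraint_form: "is_Linf (sdxi a) \<Longrightarrow> is_Linf (sdxi d) \<Longrightarrow> is_Linf (constraint_form a d)"
  unfolding constraint_form_def[abs_def] by (intro is_Linf_diff is_Linf_inner is_Linf_const)

lemma abs_int_constraint_form_le:
  fixes g :: "real \<Rightarrow> real"
  assumes "is_Linf (sdxi a)" "is_Linf (sdxi d)" "is_Linf g" "R \<ge> 0"
    and "AE t in mu. norm (sdxi a t) \<le> R" "\<bar>sL a\<bar> \<le> R"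
  shows "\<bar>\<integral>t. g t * constraint_form a d t \<partial>mu\<bar> \<le> R * L2n g * (L2n (sdxi d) + \<bar>sL d\<bar>)"
proof -
  have 1: "\<bar>\<integral>t. g t * (sdxi a t \<bullet> sdxi d t) \<partial>mu\<bar> \<le> R * (L2n g * L2n (sdxi d))"
  proof (rule abs_integral_le_L2n)
    show "AE t in mu. \<bar>g t * (sdxi a t \<bullet> sdxi d t)\<bar> \<le> R * (norm (g t) * norm (sdxi d t))"
      using assms(5)
    proof eventually_elim
      case (elim t)
      have "\<bar>g t * (sdxi a t \<bullet> sdxi d t)\<bar> \<le> \<bar>g t\<bar> * (norm (sdxi a t) * norm (sdxi d t))"
        unfolding abs_mult by (intro mult_left_mono Cauchy_Schwarz_ineq2) auto
      also have "\<dots> \<le> \<bar>g t\<bar> * (R * norm (sdxi d t))"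
        using elim by (intro mult_left_mono mult_right_mono) auto
      finally show ?case by (simp add: mult_ac)
    qed
  qed (use assms in \<open>auto intro!: is_Linf_measurable is_Linf_intros\<close>)
  have 2: "\<bar>\<integral>t. g t * (sL a * sL d) \<partial>mu\<bar> \<le> R * (L2n g * \<bar>sL d\<bar>)"
  proof -
    have "\<bar>\<integral>t. g t * (sL a * sL d) \<partial>mu\<bar> \<le> (R * \<bar>sL d\<bar>) * (L2n g * L2n (\<lambda>t. 1::real))"
    proof (rule abs_integral_le_L2n)
      show "AE t in mu. \<bar>g t * (sL a * sL d)\<bar> \<le> R * \<bar>sL d\<bar> * (norm (g t) * norm (1::real))"
        using mult_right_mono[OF assms(6), of "\<bar>sL d\<bar> * \<bar>g _\<bar>"] by (auto simp: abs_mult mult_ac)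
    qed (use assms in \<open>auto intro!: is_Linf_measurable is_Linf_intros\<close>)
    then show ?thesis by (simp add: L2n_const mult_ac)
  qed
  have "(\<integral>t. g t * constraint_form a d t \<partial>mu) = (\<integral>t. g t * (sdxi a t \<bullet> sdxi d t) \<partial>mu) - (\<integral>t. g t * (sL a * sL d) \<partial>mu)"
    unfolding constraint_form_def right_diff_distrib
    using assms by (intro Bochner_Integration.integral_diff integrable_Linf is_Linf_intros)
  then show ?thesis using 1 2 by (simp add: algebra_simps)
qed

section \<open>Closed forms of the first and second derivatives\<close>

locale flight = C3_function nonzero_velocity "ffp v w" f1 f2 f3
  for v :: real and w :: "vec2 \<Rightarrow> vec2" and f1 f2 f3 +
  assumes w_C3: "C3 w" and w_lt: "\<forall>x. norm (w x) < v"
begin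

lemma cont_w: "continuous_on S w"
  using has_derivative_continuous[OF C3_has_derivative_D1[OF w_C3]] continuous_at_imp_continuous_on by blast

lemma ffp_measurable: "ffp v w \<in> borel_measurable borel"
proof (rule borel_measurable_continuous_onI)
  have "v\<^sup>2 - w x \<bullet> w x \<noteq> 0" for x using norm_lt_imp_inner_pos w_lt by (metis less_irrefl)
  then show "continuous_on UNIV (ffp v w)" unfolding ff_def
    by (intro continuous_intros continuous_on_compose2[OF cont_w[of UNIV]]) auto
qed

text \<open>The KKT operator at \<open>a\<close> with direction \<open>e\<close> and test direction
  \<open>d\<close>: the second derivative of the travel time, followed by the variations of
  multiplier, curve and constraint.\<close>

definition FD_formula :: "state \<Rightarrow> state \<Rightarrow> state \<Rightarrow> real" where
  "FD_formula a e d = (\<integral>t. f2 (pt a t) (pt d t) (pt e t) \<partial>mu)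
     + 2 * (\<integral>t. slam e t * constraint_form a d t \<partial>mu) + 2 * (\<integral>t. slam a t * constraint_form e d t \<partial>mu)
     + 2 * (\<integral>t. slam d t * constraint_form a e t \<partial>mu)"

lemma integrable_f1:
  assumes "bounded_state a" "bounded_state d" "AE t in mu. pt a t \<in> tube X l r" "r < l"
  shows "integrable mu (\<lambda>t. f1 (pt a t) (pt d t))"
proof -
  obtain C where C: "C \<ge> 0" "\<forall>y\<in>tube X l r. \<forall>h. \<bar>f1 y h\<bar> \<le> C * norm h"
    using compact_bound[OF compact_tube tube_subset[OF assms(4)]] by metis
  show ?thesis
  proof (rule abs_integral_le_L2n(2)[of "pt d" "\<lambda>t. 1::real" _ C])
    show "AE t in mu. \<bar>f1 (pt a t) (pt d t)\<bar> \<le> C * (norm (pt d t) * norm (1::real))"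
      using assms(3)
    proof eventually_elim
      case (elim t)
      then show ?case using C(2)[rule_format, OF elim, of "pt d t"] by simp
    qed
    show "(\<lambda>t. f1 (pt a t) (pt d t)) \<in> borel_measurable mu"
      using assms(1,2) by (intro measurable_f1_comp is_Linf_measurable is_Linf_pt)
  qed (use assms C in \<open>auto intro: is_Linf_pt is_Linf_const\<close>)
qed

lemma integrable_f2:
  assumes "bounded_state a" "is_Linf (pt d)" "is_Linf (pt e)" "AE t in mu. pt a t \<in> tube X l r" "r < l"
  shows "integrable mu (\<lambda>t. f2 (pt a t) (pt d t) (pt e t))"
proof -
  obtain C where C: "C \<ge> 0" "\<forall>y\<in>tube X l r. \<forall>h k. \<bar>f2 y h k\<bar> \<le> C * norm h * norm k"
    using compact_bound[OF compact_tube tube_subset[OF assms(5)]] by metis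
  show ?thesis
  proof (rule abs_integral_le_L2n(2)[of "pt d" "pt e" _ C])
    show "AE t in mu. \<bar>f2 (pt a t) (pt d t) (pt e t)\<bar> \<le> C * (norm (pt d t) * norm (pt e t))"
      using assms(4)
    proof eventually_elim
      case (elim t)
      then show ?case using C(2)[rule_format, OF elim, of "pt d t" "pt e t"] by (simp add: mult.assoc)
    qed
    show "(\<lambda>t. f2 (pt a t) (pt d t) (pt e t)) \<in> borel_measurable mu"
      by (intro measurable_f2_comp is_Linf_measurable is_Linf_pt[OF assms(1)] assms(2,3))
  qed (use assms C in auto)
qed

text \<open>Along a bounded direction one step length serves almost all \<open>t\<close>. The tube
  grows only to the midpoint between \<open>r\<close> and \<open>l\<close>, so velocities remain
  bounded away from zero.\<close>

lemma AE_perturb: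
  assumes "bounded_state d" "AE t in mu. pt a t \<in> tube X l r" "r < l"
  obtains \<delta> r' D where "\<delta> > 0" "r' < l" "D \<ge> 0" "AE t in mu. norm (pt d t) \<le> D"
    "AE t in mu. \<forall>s. \<bar>s\<bar> \<le> \<delta> \<longrightarrow> pt a t + s *\<^sub>R pt d t \<in> tube X l r'"
proof -
  obtain D where D: "D \<ge> 0" "AE t in mu. norm (pt d t) \<le> D"
    by (rule is_Linf_bound[OF is_Linf_pt[OF assms(1)]])
  define \<delta> where "\<delta> = (l - r) / 2 / (D + 1)"
  have \<delta>: "\<delta> > 0" using D(1) assms(3) by (simp add: \<delta>_def)
  have dD: "\<delta> * D \<le> (l - r) / 2"
    using D(1) assms(3) by (simp add: \<delta>_def field_simps)
  have "AE t in mu. \<forall>s. \<bar>s\<bar> \<le> \<delta> \<longrightarrow> pt a t + s *\<^sub>R pt d t \<in> tube X l (r + (l - r) / 2)"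
    using assms(2) D(2)
  proof (eventually_elim, intro allI impI)
    fix t s assume H: "pt a t \<in> tube X l r" "norm (pt d t) \<le> D" and s: "\<bar>s\<bar> \<le> \<delta>"
    have "norm (s *\<^sub>R pt d t) \<le> \<delta> * D" using H s \<delta> by (auto intro!: mult_mono)
    then show "pt a t + s *\<^sub>R pt d t \<in> tube X l (r + (l - r) / 2)"
      using H dD by (intro tube_add) auto
  qed
  moreover have "r + (l - r) / 2 < l" using assms(3) by (simp add: field_simps)
  ultimately show ?thesis using that \<delta> D by blast
qed

lemma TT_eq: "TT v w (\<lambda>t. sxi a t + s *\<^sub>R sxi d t) (\<lambda>t. sdxi a t + s *\<^sub>R sdxi d t) = (\<integral>t. ffp v w (pt a t + s *\<^sub>R pt d t) \<partial>mu)"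
  unfolding TT_def set_integral_mu by (simp add: pt_def)

lemma TT_has_derivative:
  assumes "bounded_state a" "bounded_state d" "AE t in mu. pt a t \<in> tube X l r" "r < l"
  shows "((\<lambda>s. \<integral>t. ffp v w (pt a t + s *\<^sub>R pt d t) \<partial>mu) has_real_derivative (\<integral>t. f1 (pt a t) (pt d t) \<partial>mu)) (at 0)"
proof -
  obtain \<delta> r' D where P: "\<delta> > 0" "r' < l" "D \<ge> 0" "AE t in mu. norm (pt d t) \<le> D"
    "AE t in mu. \<forall>s. \<bar>s\<bar> \<le> \<delta> \<longrightarrow> pt a t + s *\<^sub>R pt d t \<in> tube X l r'"
    by (rule AE_perturb[OF assms(2-4)])
  obtain C where C: "C \<ge> 0" "\<forall>y\<in>tube X l r'. \<forall>h k. \<bar>ffp v w y\<bar> \<le> C \<and> \<bar>f2 y h k\<bar> \<le> C * norm h * norm k"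
    using compact_bound[OF compact_tube tube_subset[OF P(2)]] by metis
  show ?thesis
  proof (rule has_real_derivative_integral[OF P(1), where C = "C * D * D"])
    fix s :: real assume s: "\<bar>s\<bar> < \<delta>"
    show "integrable mu (\<lambda>t. ffp v w (pt a t + s *\<^sub>R pt d t))"
    proof (rule mu.integrable_const_bound[where B = C])
      show "AE t in mu. norm (ffp v w (pt a t + s *\<^sub>R pt d t)) \<le> C"
        using P(5)
      proof eventually_elim
        case (elim t)
        then have "pt a t + s *\<^sub>R pt d t \<in> tube X l r'" using s by auto
        then show ?case using C(2) unfolding real_norm_def by blast
      qed
      have [measurable]: "pt a \<in> borel_measurable mu" "pt d \<in> borel_measurable mu"
        using assms is_Linf_pt is_Linf_measurable by blast+
      show "(\<lambda>t. ffp v w (pt a t + s *\<^sub>R pt d t)) \<in> borel_measurable mu"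
        by (rule measurable_compose[OF _ ffp_measurable]) measurable
    qed
  next
    show "integrable mu (\<lambda>t. f1 (pt a t) (pt d t))" by (rule integrable_f1[OF assms])
    show "AE t in mu. \<forall>s. \<bar>s\<bar> < \<delta> \<longrightarrow>
        \<bar>ffp v w (pt a t + s *\<^sub>R pt d t) - ffp v w (pt a t + 0 *\<^sub>R pt d t) - s * f1 (pt a t) (pt d t)\<bar> \<le> C * D * D * s\<^sup>2"
      using P(4,5)
    proof (eventually_elim, intro allI impI)
      fix t s assume H: "norm (pt d t) \<le> D" "\<forall>s. \<bar>s\<bar> \<le> \<delta> \<longrightarrow> pt a t + s *\<^sub>R pt d t \<in> tube X l r'"
        and s: "\<bar>s\<bar> < \<delta>"
      have K: "pt a t + r *\<^sub>R pt d t \<in> tube X l r'" if "\<bar>r\<bar> \<le> \<bar>s\<bar>" for r using H(2) that s by auto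
      have U: "pt a t + r *\<^sub>R pt d t \<in> nonzero_velocity" if "\<bar>r\<bar> \<le> \<bar>s\<bar>" for r
        using K[OF that] tube_subset[OF P(2)] by blast
      have "\<bar>ffp v w (pt a t + s *\<^sub>R pt d t) - ffp v w (pt a t + 0 *\<^sub>R pt d t) - s * f1 (pt a t + 0 *\<^sub>R pt d t) (pt d t)\<bar> \<le> C * D * D * s\<^sup>2"
      proof (rule taylor_remainder_bound[where \<phi> = "\<lambda>r. ffp v w (pt a t + r *\<^sub>R pt d t)"
            and \<phi>' = "\<lambda>r. f1 (pt a t + r *\<^sub>R pt d t) (pt d t)" and \<phi>'' = "\<lambda>r. f2 (pt a t + r *\<^sub>R pt d t) (pt d t) (pt d t)"])
        fix r assume r: "\<bar>r\<bar> \<le> \<bar>s\<bar>"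
        show "((\<lambda>r. ffp v w (pt a t + r *\<^sub>R pt d t)) has_real_derivative f1 (pt a t + r *\<^sub>R pt d t) (pt d t)) (at r)"
          using directional_derivative_f[OF U[OF r]] .
        show "((\<lambda>r. f1 (pt a t + r *\<^sub>R pt d t) (pt d t)) has_real_derivative f2 (pt a t + r *\<^sub>R pt d t) (pt d t) (pt d t)) (at r)"
          using directional_derivative_f1[OF U[OF r]] .
        have "\<bar>f2 (pt a t + r *\<^sub>R pt d t) (pt d t) (pt d t)\<bar> \<le> C * norm (pt d t) * norm (pt d t)" using C K[OF r] by blast
        also have "\<dots> \<le> C * D * D" using H(1) C P by (intro mult_mono) auto
        finally show "\<bar>f2 (pt a t + r *\<^sub>R pt d t) (pt d t) (pt d t)\<bar> \<le> C * D * D" .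
      qed
      then show "\<bar>ffp v w (pt a t + s *\<^sub>R pt d t) - ffp v w (pt a t + 0 *\<^sub>R pt d t) - s * f1 (pt a t) (pt d t)\<bar> \<le> C * D * D * s\<^sup>2"
        by simp
    qed
  qed
qed

lemma TD1_eq:
  assumes "bounded_state a" "bounded_state d" "AE t in mu. pt a t \<in> tube X l r" "r < l"
  shows "TD1 v w a d = (\<integral>t. f1 (pt a t) (pt d t) \<partial>mu)"
  unfolding TD1_def TT_eq by (rule DERIV_imp_deriv[OF TT_has_derivative[OF assms]])

text \<open>\<open>FD\<close> differentiates \<open>FF\<close>, which contains \<open>TD1\<close>,
  itself a \<open>deriv\<close>. The closed form of \<open>TD1\<close> is therefore needed for all
  small \<open>s\<close>, which is the second claim.\<close>

lemma f1_has_derivative: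
  assumes "bounded_state a" "bounded_state d" "bounded_state e" "AE t in mu. pt a t \<in> tube X l r" "r < l"
  shows "((\<lambda>s. \<integral>t. f1 (pt a t + s *\<^sub>R pt e t) (pt d t) \<partial>mu) has_real_derivative (\<integral>t. f2 (pt a t) (pt d t) (pt e t) \<partial>mu)) (at 0)"
    and "\<exists>\<delta>>0. \<forall>s. \<bar>s\<bar> < \<delta> \<longrightarrow> TD1 v w (sadd a (sscale s e)) d = (\<integral>t. f1 (pt a t + s *\<^sub>R pt e t) (pt d t) \<partial>mu)"
proof -
  obtain \<delta> r' D where P: "\<delta> > 0" "r' < l" "D \<ge> 0" "AE t in mu. norm (pt e t) \<le> D"
    "AE t in mu. \<forall>s. \<bar>s\<bar> \<le> \<delta> \<longrightarrow> pt a t + s *\<^sub>R pt e t \<in> tube X l r'"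
    by (rule AE_perturb[OF assms(3-5)])
  have B: "bounded_state (sadd a (sscale s e))" for s using assms by (intro bounded_state_sadd bounded_state_sscale)
  have K: "AE t in mu. pt (sadd a (sscale s e)) t \<in> tube X l r'" if "\<bar>s\<bar> < \<delta>" for s
    using P(5) by eventually_elim (use that in auto)
  show "\<exists>\<delta>>0. \<forall>s. \<bar>s\<bar> < \<delta> \<longrightarrow> TD1 v w (sadd a (sscale s e)) d = (\<integral>t. f1 (pt a t + s *\<^sub>R pt e t) (pt d t) \<partial>mu)"
    using TD1_eq[OF B assms(2) K P(2)] P(1) by auto
  obtain C where C: "C \<ge> 0" "\<forall>y\<in>tube X l r'. \<forall>h k l. \<bar>f3 y h k l\<bar> \<le> C * norm h * norm k * norm l"
    using compact_bound[OF compact_tube tube_subset[OF P(2)]] by metis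
  obtain E where E: "E \<ge> 0" "AE t in mu. norm (pt d t) \<le> E"
    by (rule is_Linf_bound[OF is_Linf_pt[OF assms(2)]])
  show "((\<lambda>s. \<integral>t. f1 (pt a t + s *\<^sub>R pt e t) (pt d t) \<partial>mu) has_real_derivative (\<integral>t. f2 (pt a t) (pt d t) (pt e t) \<partial>mu)) (at 0)"
  proof (rule has_real_derivative_integral[OF P(1), where C = "C * E * D * D"])
    fix s :: real assume s: "\<bar>s\<bar> < \<delta>"
    show "integrable mu (\<lambda>t. f1 (pt a t + s *\<^sub>R pt e t) (pt d t))"
      using integrable_f1[OF B assms(2) K[OF s] P(2)] by simp
  next
    show "integrable mu (\<lambda>t. f2 (pt a t) (pt d t) (pt e t))"
      using integrable_f2[OF assms(1) _ _ assms(4,5)] assms is_Linf_pt by blast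
    show "AE t in mu. \<forall>s. \<bar>s\<bar> < \<delta> \<longrightarrow>
        \<bar>f1 (pt a t + s *\<^sub>R pt e t) (pt d t) - f1 (pt a t + 0 *\<^sub>R pt e t) (pt d t) - s * f2 (pt a t) (pt d t) (pt e t)\<bar> \<le> C * E * D * D * s\<^sup>2"
      using P(4,5) E(2)
    proof (eventually_elim, intro allI impI)
      fix t s assume H: "norm (pt e t) \<le> D" "\<forall>s. \<bar>s\<bar> \<le> \<delta> \<longrightarrow> pt a t + s *\<^sub>R pt e t \<in> tube X l r'" "norm (pt d t) \<le> E"
        and s: "\<bar>s\<bar> < \<delta>"
      have K: "pt a t + r *\<^sub>R pt e t \<in> tube X l r'" if "\<bar>r\<bar> \<le> \<bar>s\<bar>" for r using H(2) that s by auto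
      have U: "pt a t + r *\<^sub>R pt e t \<in> nonzero_velocity" if "\<bar>r\<bar> \<le> \<bar>s\<bar>" for r
        using K[OF that] tube_subset[OF P(2)] by blast
      have "\<bar>f1 (pt a t + s *\<^sub>R pt e t) (pt d t) - f1 (pt a t + 0 *\<^sub>R pt e t) (pt d t) - s * f2 (pt a t + 0 *\<^sub>R pt e t) (pt d t) (pt e t)\<bar> \<le> C * E * D * D * s\<^sup>2"
      proof (rule taylor_remainder_bound[where \<phi> = "\<lambda>r. f1 (pt a t + r *\<^sub>R pt e t) (pt d t)"
            and \<phi>' = "\<lambda>r. f2 (pt a t + r *\<^sub>R pt e t) (pt d t) (pt e t)" and \<phi>'' = "\<lambda>r. f3 (pt a t + r *\<^sub>R pt e t) (pt d t) (pt e t) (pt e t)"])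
        fix r assume r: "\<bar>r\<bar> \<le> \<bar>s\<bar>"
        show "((\<lambda>r. f1 (pt a t + r *\<^sub>R pt e t) (pt d t)) has_real_derivative f2 (pt a t + r *\<^sub>R pt e t) (pt d t) (pt e t)) (at r)"
          using directional_derivative_f1[OF U[OF r]] .
        show "((\<lambda>r. f2 (pt a t + r *\<^sub>R pt e t) (pt d t) (pt e t)) has_real_derivative f3 (pt a t + r *\<^sub>R pt e t) (pt d t) (pt e t) (pt e t)) (at r)"
          using directional_derivative_f2[OF U[OF r]] .
        have "\<bar>f3 (pt a t + r *\<^sub>R pt e t) (pt d t) (pt e t) (pt e t)\<bar> \<le> C * norm (pt d t) * norm (pt e t) * norm (pt e t)" using C K[OF r] by blast
        also have "\<dots> \<le> C * E * D * D" using H C P E by (intro mult_mono) auto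
        finally show "\<bar>f3 (pt a t + r *\<^sub>R pt e t) (pt d t) (pt e t) (pt e t)\<bar> \<le> C * E * D * D" .
      qed
      then show "\<bar>f1 (pt a t + s *\<^sub>R pt e t) (pt d t) - f1 (pt a t + 0 *\<^sub>R pt e t) (pt d t) - s * f2 (pt a t) (pt d t) (pt e t)\<bar> \<le> C * E * D * D * s\<^sup>2"
        by simp
    qed
  qed
qed

lemma FF_eq:
  assumes "bounded_state a" "bounded_state d" "AE t in mu. pt a t \<in> tube X l r" "r < l"
  shows "FF v w a d = (\<integral>t. f1 (pt a t) (pt d t) \<partial>mu) + 2 * (\<integral>t. slam a t * constraint_form a d t \<partial>mu) + (\<integral>t. slam d t * constraint_form a a t \<partial>mu)"
  unfolding FF_def TD1_eq[OF assms] set_integral_mu constraint_form_def power2_eq_square ..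

lemma FD_eq:
  assumes "bounded_state a" "bounded_state d" "bounded_state e" "AE t in mu. pt a t \<in> tube X l r" "r < l"
  shows "FD v w a e d = FD_formula a e d"
proof -
  note L = assms(1-3)[unfolded bounded_state_def]
  note LI = is_Linf_intros is_Linf_constraint_form
  define A where "A s = sadd a (sscale s e)" for s
  obtain \<delta> where \<delta>: "\<delta> > 0" "\<And>s. \<bar>s\<bar> < \<delta> \<Longrightarrow> TD1 v w (A s) d = (\<integral>t. f1 (pt a t + s *\<^sub>R pt e t) (pt d t) \<partial>mu)"
    using f1_has_derivative(2)[OF assms] unfolding A_def by blast
  have i0: "integrable mu (\<lambda>t. slam a t * constraint_form a d t)" "integrable mu (\<lambda>t. slam e t * constraint_form a d t)"
     "integrable mu (\<lambda>t. slam a t * constraint_form e d t)" "integrable mu (\<lambda>t. slam e t * constraint_form e d t)"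
     "integrable mu (\<lambda>t. slam d t * constraint_form a a t)" "integrable mu (\<lambda>t. slam d t * constraint_form a e t)" "integrable mu (\<lambda>t. slam d t * constraint_form e e t)"
    using L by (auto intro!: integrable_Linf LI)
  \<comment> \<open>The multiplier terms are polynomials in \<open>s\<close>; only their linear
    coefficients survive, and no limit has to be exchanged with the integral.\<close>
  have p1: "(\<integral>t. slam (A s) t * constraint_form (A s) d t \<partial>mu) = (\<integral>t. slam a t * constraint_form a d t \<partial>mu)
      + s * ((\<integral>t. slam e t * constraint_form a d t \<partial>mu) + (\<integral>t. slam a t * constraint_form e d t \<partial>mu)) + s\<^sup>2 * (\<integral>t. slam e t * constraint_form e d t \<partial>mu)" (is "_ = ?R s") for s
  proof -
    have "(\<integral>t. slam (A s) t * constraint_form (A s) d t \<partial>mu) = (\<integral>t. slam a t * constraint_form a d t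
      + s * (slam e t * constraint_form a d t + slam a t * constraint_form e d t) + s\<^sup>2 * (slam e t * constraint_form e d t) \<partial>mu)"
      by (intro Bochner_Integration.integral_cong) (auto simp: A_def algebra_simps power2_eq_square)
    also have "\<dots> = ?R s" using i0 by simp
    finally show ?thesis .
  qed
  have p2: "(\<integral>t. slam d t * constraint_form (A s) (A s) t \<partial>mu) = (\<integral>t. slam d t * constraint_form a a t \<partial>mu)
      + s * (2 * (\<integral>t. slam d t * constraint_form a e t \<partial>mu)) + s\<^sup>2 * (\<integral>t. slam d t * constraint_form e e t \<partial>mu)" (is "_ = ?R s") for s
  proof -
    have "(\<integral>t. slam d t * constraint_form (A s) (A s) t \<partial>mu) = (\<integral>t. slam d t * constraint_form a a t
      + s * (2 * (slam d t * constraint_form a e t)) + s\<^sup>2 * (slam d t * constraint_form e e t) \<partial>mu)"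
      by (intro Bochner_Integration.integral_cong) (auto simp: A_def algebra_simps power2_eq_square constraint_form_sym[of e a])
    also have "\<dots> = ?R s" using i0 by simp
    finally show ?thesis .
  qed
  let ?q = "\<lambda>s. (\<integral>t. f1 (pt a t + s *\<^sub>R pt e t) (pt d t) \<partial>mu) + 2 * (\<integral>t. slam (A s) t * constraint_form (A s) d t \<partial>mu)
    + (\<integral>t. slam d t * constraint_form (A s) (A s) t \<partial>mu)"
  have "(?q has_real_derivative FD_formula a e d) (at 0)"
    unfolding p1 p2 FD_formula_def
    by (rule derivative_eq_intros f1_has_derivative(1)[OF assms] refl | simp)+
  moreover have "eventually (\<lambda>s. FF v w (sadd a (sscale s e)) d = ?q s) (nhds 0)"
    unfolding eventually_nhds_metric
    using \<delta> by (intro exI[of _ \<delta>]) (auto simp: FF_def A_def[symmetric] set_integral_mu constraint_form_def power2_eq_square dist_real_def)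
  ultimately have "((\<lambda>s. FF v w (sadd a (sscale s e)) d) has_real_derivative FD_formula a e d) (at 0)"
    using DERIV_cong_ev[of 0 0 "\<lambda>s. FF v w (sadd a (sscale s e)) d" ?q] by auto
  then show ?thesis unfolding FD_def by (rule DERIV_imp_deriv)
qed

text \<open>The first derivative is provided near 0 and the second at 0 only. That is what both uses
  require: the identification of \<open>TD2\<close> and the comparison of a minimiser with its
  perturbations.\<close>

lemma TT_second_derivative:
  assumes "bounded_state a" "bounded_state d" "AE t in mu. pt a t \<in> tube X l r" "r < l"
  shows "\<exists>\<delta>>0. \<exists>\<phi>'. (\<forall>s. \<bar>s\<bar> < \<delta> \<longrightarrow>
      ((\<lambda>s. TT v w (\<lambda>t. sxi a t + s *\<^sub>R sxi d t) (\<lambda>t. sdxi a t + s *\<^sub>R sdxi d t)) has_real_derivative \<phi>' s) (at s))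
     \<and> (\<phi>' has_real_derivative (\<integral>t. f2 (pt a t) (pt d t) (pt d t) \<partial>mu)) (at 0)"
proof -
  obtain \<delta> r' D where P: "\<delta> > 0" "r' < l" "D \<ge> 0" "AE t in mu. norm (pt d t) \<le> D"
    "AE t in mu. \<forall>s. \<bar>s\<bar> \<le> \<delta> \<longrightarrow> pt a t + s *\<^sub>R pt d t \<in> tube X l r'"
    by (rule AE_perturb[OF assms(2-4)])
  have B: "bounded_state (sadd a (sscale s d))" for s using assms by (intro bounded_state_sadd bounded_state_sscale)
  have K: "AE t in mu. pt (sadd a (sscale s d)) t \<in> tube X l r'" if "\<bar>s\<bar> < \<delta>" for s
    using P(5) by eventually_elim (use that in auto)
  let ?\<phi> = "\<lambda>s. \<integral>t. ffp v w (pt a t + s *\<^sub>R pt d t) \<partial>mu"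
  let ?\<phi>' = "\<lambda>s. \<integral>t. f1 (pt a t + s *\<^sub>R pt d t) (pt d t) \<partial>mu"
  have "(?\<phi> has_real_derivative ?\<phi>' s) (at s)" if "\<bar>s\<bar> < \<delta>" for s
  proof -
    have "((\<lambda>r. \<integral>t. ffp v w (pt a t + s *\<^sub>R pt d t + r *\<^sub>R pt d t) \<partial>mu) has_real_derivative ?\<phi>' s) (at 0)"
      using TT_has_derivative[OF B assms(2) K[OF that] P(2)] by simp
    then have "((\<lambda>r. ?\<phi> (r + s)) has_real_derivative ?\<phi>' s) (at 0)" by (simp add: algebra_simps)
    then show ?thesis using DERIV_shift[of ?\<phi> "?\<phi>' s" 0 s] by simp
  qed
  then show ?thesis unfolding TT_eq
    by (intro exI[of _ \<delta>] conjI exI[of _ ?\<phi>'] P(1) f1_has_derivative(1)[OF assms(1,2,2,3,4)]) simp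
qed

lemma TD2_eq:
  assumes "bounded_state a" "bounded_state d" "AE t in mu. pt a t \<in> tube X l r" "r < l"
  shows "TD2 v w a d = (\<integral>t. f2 (pt a t) (pt d t) (pt d t) \<partial>mu)"
proof -
  obtain \<delta> \<phi>' where P: "\<delta> > 0" "\<forall>s. \<bar>s\<bar> < \<delta> \<longrightarrow>
      ((\<lambda>s. TT v w (\<lambda>t. sxi a t + s *\<^sub>R sxi d t) (\<lambda>t. sdxi a t + s *\<^sub>R sdxi d t)) has_real_derivative \<phi>' s) (at s)"
     "(\<phi>' has_real_derivative (\<integral>t. f2 (pt a t) (pt d t) (pt d t) \<partial>mu)) (at 0)"
    using TT_second_derivative[OF assms] by blast
  have "eventually (\<lambda>s. deriv (\<lambda>s. TT v w (\<lambda>t. sxi a t + s *\<^sub>R sxi d t) (\<lambda>t. sdxi a t + s *\<^sub>R sdxi d t)) s = \<phi>' s) (nhds 0)"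
    unfolding eventually_nhds_metric using P(1,2)
    by (intro exI[of _ \<delta>]) (auto simp: dist_real_def intro!: DERIV_imp_deriv)
  from deriv_cong_ev[OF this refl] show ?thesis unfolding TD2_def
    using DERIV_imp_deriv[OF P(3)] by (simp add: numeral_2_eq_2)
qed

end

section \<open>Newton defect and perturbation of the derivative\<close>

text \<open>Counterpart of \<open>abs_int_constraint_form_le\<close>. In a product of three factors
  one has to be small in the supremum norm; here it is the multiplier, and both states are measured
  in L2.\<close>

lemma abs_int_mult_constraint_form_le:
  fixes g :: "real \<Rightarrow> real"
  assumes "is_Linf (sdxi a)" "is_Linf (sdxi d)" "is_Linf g" "R \<ge> 0" "AE t in mu. \<bar>g t\<bar> \<le> R"
  shows "\<bar>\<integral>t. g t * constraint_form a d t \<partial>mu\<bar> \<le> R * (L2n (sdxi a) + \<bar>sL a\<bar>) * (L2n (sdxi d) + \<bar>sL d\<bar>)"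
proof -
  have 1: "\<bar>\<integral>t. g t * (sdxi a t \<bullet> sdxi d t) \<partial>mu\<bar> \<le> R * (L2n (sdxi a) * L2n (sdxi d))"
  proof (rule abs_integral_le_L2n)
    show "AE t in mu. \<bar>g t * (sdxi a t \<bullet> sdxi d t)\<bar> \<le> R * (norm (sdxi a t) * norm (sdxi d t))"
      using assms(5)
    proof eventually_elim
      case (elim t)
      then show ?case unfolding abs_mult by (intro mult_mono Cauchy_Schwarz_ineq2) (use assms in auto)
    qed
  qed (use assms in \<open>auto intro!: is_Linf_measurable is_Linf_intros\<close>)
  have 2: "\<bar>\<integral>t. g t * (sL a * sL d) \<partial>mu\<bar> \<le> R * (\<bar>sL a\<bar> * \<bar>sL d\<bar>)"
  proof -
    have "\<bar>\<integral>t. g t * (sL a * sL d) \<partial>mu\<bar> \<le> R * (L2n (\<lambda>t. sL a) * L2n (\<lambda>t. sL d))"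
    proof (rule abs_integral_le_L2n)
      show "AE t in mu. \<bar>g t * (sL a * sL d)\<bar> \<le> R * (norm (sL a) * norm (sL d))"
        using assms(5)
      proof eventually_elim
        case (elim t)
        then show ?case unfolding abs_mult by (intro mult_mono) (use assms in auto)
      qed
    qed (use assms in \<open>auto intro!: is_Linf_measurable is_Linf_intros\<close>)
    then show ?thesis by (simp add: L2n_const)
  qed
  have "(\<integral>t. g t * constraint_form a d t \<partial>mu) = (\<integral>t. g t * (sdxi a t \<bullet> sdxi d t) \<partial>mu) - (\<integral>t. g t * (sL a * sL d) \<partial>mu)"
    unfolding constraint_form_def right_diff_distrib
    using assms by (intro Bochner_Integration.integral_diff integrable_Linf is_Linf_intros)
  then have "\<bar>\<integral>t. g t * constraint_form a d t \<partial>mu\<bar> \<le> R * (L2n (sdxi a) * L2n (sdxi d) + \<bar>sL a\<bar> * \<bar>sL d\<bar>)"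
    using 1 2 by (simp add: algebra_simps)
  also have "\<dots> \<le> R * ((L2n (sdxi a) + \<bar>sL a\<bar>) * (L2n (sdxi d) + \<bar>sL d\<bar>))"
    by (intro mult_left_mono assms) (simp add: algebra_simps)
  finally show ?thesis by (simp add: mult.assoc)
qed

context flight
begin

text \<open>With k s = \<open>f1 (y + s e) d\<close> and g = k', both g 1 - (k 1 - k 0) and (g 1 - g
  (-1)) / 4 equal g' 0 / 2 up to the oscillation of g' on the segment. That oscillation is small
  uniformly, since \<open>f3\<close> is uniformly continuous on a compact tube.\<close>

lemma newton_defect_pointwise:
  assumes "l > 0" "\<epsilon> > 0"
  shows "\<exists>\<delta>>0. \<delta> \<le> l/4 \<and> (\<forall>y\<in>tube X l 0. \<forall>e d. norm e \<le> \<delta> \<longrightarrow>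
     \<bar>f2 (y + e) d e - (f1 (y + e) d - f1 y d) - 1/4 * (f2 (y + e) d e - f2 (y - e) d e)\<bar> \<le> \<epsilon> * (norm e * norm e * norm d))"
proof -
  have l2: "l/2 < l" using assms by simp
  obtain \<delta>0 where \<delta>0: "\<delta>0 > 0" "\<forall>y\<in>tube X l (l/2). \<forall>z\<in>tube X l (l/2). dist y z < \<delta>0 \<longrightarrow>
     (\<forall>h k m. \<bar>f3 y h k m - f3 z h k m\<bar> \<le> \<epsilon>/3 * norm h * norm k * norm m)"
    using uniformly_continuous_f3[OF compact_tube[of X l "l/2"] tube_subset[OF l2], of "\<epsilon>/3"] assms(2) by (meson divide_pos_pos zero_less_numeral)
  define \<delta> where "\<delta> = min (l/4) (\<delta>0/2)"
  have \<delta>: "\<delta> > 0" "\<delta> \<le> l/4" "\<delta> < \<delta>0" using assms \<delta>0(1) by (auto simp: \<delta>_def)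
  show ?thesis
  proof (intro exI[of _ \<delta>] conjI ballI allI impI \<delta>)
    fix y e d :: "vec2 \<times> vec2" assume y: "y \<in> tube X l 0" and e: "norm e \<le> \<delta>"
    define \<eta> where "\<eta> = \<epsilon>/3 * (norm e * norm e * norm d)"
    have \<eta>: "\<eta> \<ge> 0" using assms by (simp add: \<eta>_def)
    let ?S = "{-1..1::real}"
    have ns: "norm (s *\<^sub>R e) \<le> \<delta>" if "s \<in> ?S" for s
    proof -
      have "\<bar>s\<bar> * norm e \<le> 1 * \<delta>" using that e by (intro mult_mono) auto
      then show ?thesis by simp
    qed
    have K: "y + s *\<^sub>R e \<in> tube X l (l/2)" if "s \<in> ?S" for s
    proof -
      have "y + s *\<^sub>R e \<in> tube X l (0 + \<delta>)" by (rule tube_add[OF y ns[OF that]])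
      then show ?thesis using tube_mono[of "0 + \<delta>" "l/2" X l] \<delta> assms by auto
    qed
    have U: "y + s *\<^sub>R e \<in> nonzero_velocity" if "s \<in> ?S" for s using K[OF that] tube_subset[OF l2] by blast
    define g where "g s = f2 (y + s *\<^sub>R e) d e" for s
    define k where "k s = f1 (y + s *\<^sub>R e) d" for s
    define g' where "g' s = f3 (y + s *\<^sub>R e) d e e" for s
    have dk: "(k has_real_derivative g s) (at s within ?S)" if "s \<in> ?S" for s
      unfolding k_def[abs_def] g_def by (rule has_field_derivative_at_within[OF directional_derivative_f1[OF U[OF that]]])
    have dg: "(g has_real_derivative g' s) (at s within ?S)" if "s \<in> ?S" for s
      unfolding g_def[abs_def] g'_def by (rule has_field_derivative_at_within[OF directional_derivative_f2[OF U[OF that]]])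
    have g'b: "\<bar>g' s - g' 0\<bar> \<le> \<eta>" if "s \<in> ?S" for s
    proof -
      have "dist (y + s *\<^sub>R e) (y + 0 *\<^sub>R e) < \<delta>0" using ns[OF that] \<delta> by (simp add: dist_norm)
      then have "\<bar>g' s - g' 0\<bar> \<le> \<epsilon>/3 * norm d * norm e * norm e"
        unfolding g'_def using \<delta>0(2)[rule_format, OF K[OF that] K[of 0]] by auto
      then show ?thesis by (simp add: \<eta>_def mult_ac)
    qed
    have gb: "\<bar>g s - g 0 - s * g' 0\<bar> \<le> \<eta>" if s: "s \<in> ?S" for s
    proof -
      have "norm ((g s - s * g' 0) - (g 0 - 0 * g' 0)) \<le> \<eta> * norm (s - 0)"
      proof (rule field_differentiable_bound[of ?S _ "\<lambda>r. g' r - g' 0"])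
        fix r assume r: "r \<in> ?S"
        show "((\<lambda>r. g r - r * g' 0) has_real_derivative g' r - g' 0) (at r within ?S)"
          by (rule derivative_eq_intros dg[OF r] refl | simp)+
        show "norm (g' r - g' 0) \<le> \<eta>" using g'b[OF r] by simp
      qed (use s in auto)
      also have "\<dots> \<le> \<eta> * 1" using s \<eta> by (intro mult_left_mono) auto
      finally show ?thesis by (simp add: algebra_simps)
    qed
    have kb: "\<bar>k 1 - k 0 - g 0 - g' 0 / 2\<bar> \<le> \<eta>"
    proof -
      have "norm ((k 1 - 1 * g 0 - 1\<^sup>2 * (g' 0 / 2)) - (k 0 - 0 * g 0 - 0\<^sup>2 * (g' 0 / 2))) \<le> \<eta> * norm (1 - 0 :: real)"
      proof (rule field_differentiable_bound[of ?S "\<lambda>s. k s - s * g 0 - s\<^sup>2 * (g' 0 / 2)" "\<lambda>r. g r - g 0 - r * g' 0"])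
        fix r assume r: "r \<in> ?S"
        show "((\<lambda>s. k s - s * g 0 - s\<^sup>2 * (g' 0 / 2)) has_real_derivative g r - g 0 - r * g' 0) (at r within ?S)"
          by (rule derivative_eq_intros dk[OF r] refl | simp)+
        show "norm (g r - g 0 - r * g' 0) \<le> \<eta>" using gb[OF r] by simp
      qed auto
      then show ?thesis by (simp add: algebra_simps)
    qed
    have eq: "f2 (y + e) d e = g 1" "f1 (y + e) d = k 1" "f1 y d = k 0" "f2 (y - e) d e = g (-1)"
      by (auto simp: g_def k_def)
    \<comment> \<open>Each of g 1, g (-1) and k 1 - k 0 is its Taylor polynomial at 0 up to \<eta>.
      In the combination the polynomials cancel and the remainders carry weights 3/4, 1/4 and 1, so
      three times \<eta> is enough.\<close>
    have "\<bar>g 1 - (k 1 - k 0) - 1/4 * (g 1 - g (-1))\<bar> \<le> 3 * \<eta>"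
    proof -
      have a: "\<bar>g 1 - g 0 - g' 0\<bar> \<le> \<eta>" "\<bar>g (-1) - g 0 + g' 0\<bar> \<le> \<eta>" using gb[of 1] gb[of "-1"] by auto
      have gen: "\<bar>A - C - 1/4 * (A - B)\<bar> \<le> 3 * \<eta>"
        if "\<bar>A - q - p\<bar> \<le> \<eta>" "\<bar>B - q + p\<bar> \<le> \<eta>" "\<bar>C - q - p / 2\<bar> \<le> \<eta>" for A B C p q :: real
      proof -
        have "A - q - p \<le> \<eta>" "- (A - q - p) \<le> \<eta>" "B - q + p \<le> \<eta>" "- (B - q + p) \<le> \<eta>"
          "C - q - p / 2 \<le> \<eta>" "- (C - q - p / 2) \<le> \<eta>" using that by (simp_all only: abs_le_iff)
        then show ?thesis using \<eta> by (intro abs_leI) argo+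
      qed
      show ?thesis using gen[OF a kb] .
    qed
    then show "\<bar>f2 (y + e) d e - (f1 (y + e) d - f1 y d) - 1/4 * (f2 (y + e) d e - f2 (y - e) d e)\<bar> \<le> \<epsilon> * (norm e * norm e * norm d)"
      unfolding eq \<eta>_def by simp
  qed
qed

text \<open>The pointwise bound is quadratic in the error. One power is spent on the supremum norm
  and becomes \<rho>; the other, together with the test direction, is left to
  Cauchy-Schwarz.\<close>

lemma newton_defect:
  assumes "bounded_state cs" "bounded_state e" "bounded_state d" and K: "AE t in mu. pt cs t \<in> tube X l 0" and "l > 0" "\<epsilon> \<ge> 0" "\<delta> \<le> l/4"
    and pw: "\<forall>y\<in>tube X l 0. \<forall>e d. norm e \<le> \<delta> \<longrightarrow>
     \<bar>f2 (y + e) d e - (f1 (y + e) d - f1 y d) - 1/4 * (f2 (y + e) d e - f2 (y - e) d e)\<bar> \<le> \<epsilon> * (norm e * norm e * norm d)"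
    and "\<rho> \<le> \<delta>" "\<rho> \<ge> 0" and e: "AE t in mu. norm (pt e t) \<le> \<rho>"
  shows "\<bar>FD_formula (sadd cs e) e d - (FF v w (sadd cs e) d - FF v w cs d)
     - 1/4 * (FD_formula (sadd cs e) e d - FD_formula (sadd cs (sscale (-1) e)) e d)\<bar> \<le> \<epsilon> * \<rho> * (Z2n e * Z2n d)"
proof -
  note L = assms(1-3)[unfolded bounded_state_def]
  note LI = is_Linf_intros is_Linf_constraint_form
  let ?p = "sadd cs e" and ?m = "sadd cs (sscale (-1) e)"
  have B: "bounded_state ?p" "bounded_state ?m" using assms by (auto intro: bounded_state_sadd bounded_state_sscale)
  have Kp: "AE t in mu. pt ?p t \<in> tube X l (l/4)"
    using K e
  proof eventually_elim
    case (elim t)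
    have "pt cs t + pt e t \<in> tube X l (0 + l/4)" by (rule tube_add[OF elim(1)]) (use elim assms in auto)
    then show ?case by simp
  qed
  have Km: "AE t in mu. pt ?m t \<in> tube X l (l/4)"
    using K e
  proof eventually_elim
    case (elim t)
    have "pt cs t + - pt e t \<in> tube X l (0 + l/4)" by (rule tube_add[OF elim(1)]) (use elim assms in auto)
    then show ?case by simp
  qed
  have l4: "l/4 < l" using assms by simp
  have i0: "integrable mu (\<lambda>t. slam cs t * constraint_form cs d t)" "integrable mu (\<lambda>t. slam e t * constraint_form cs d t)"
     "integrable mu (\<lambda>t. slam cs t * constraint_form e d t)" "integrable mu (\<lambda>t. slam e t * constraint_form e d t)"
     "integrable mu (\<lambda>t. slam d t * constraint_form cs cs t)" "integrable mu (\<lambda>t. slam d t * constraint_form cs e t)" "integrable mu (\<lambda>t. slam d t * constraint_form e e t)"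
    using L by (auto intro!: integrable_Linf LI)
  define a1 where "a1 = (\<integral>t. slam cs t * constraint_form cs d t \<partial>mu)"
  define a2 where "a2 = (\<integral>t. slam cs t * constraint_form e d t \<partial>mu)"
  define a3 where "a3 = (\<integral>t. slam e t * constraint_form cs d t \<partial>mu)"
  define a4 where "a4 = (\<integral>t. slam e t * constraint_form e d t \<partial>mu)"
  define b1 where "b1 = (\<integral>t. slam d t * constraint_form cs cs t \<partial>mu)"
  define b2 where "b2 = (\<integral>t. slam d t * constraint_form cs e t \<partial>mu)"
  define b3 where "b3 = (\<integral>t. slam d t * constraint_form e e t \<partial>mu)"
  note ab = a1_def a2_def a3_def a4_def b1_def b2_def b3_def
  define F2p where "F2p = (\<integral>t. f2 (pt ?p t) (pt d t) (pt e t) \<partial>mu)"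
  define F2m where "F2m = (\<integral>t. f2 (pt ?m t) (pt d t) (pt e t) \<partial>mu)"
  define F1p where "F1p = (\<integral>t. f1 (pt ?p t) (pt d t) \<partial>mu)"
  define F10 where "F10 = (\<integral>t. f1 (pt cs t) (pt d t) \<partial>mu)"
  have e1: "FD_formula ?p e d = F2p + 2 * (a3 + a4) + 2 * (a2 + a4) + 2 * (b2 + b3)"
    unfolding FD_formula_def F2p_def ab using i0 by (simp add: distrib_left distrib_right del: pt_simps)
  have e2: "FD_formula ?m e d = F2m + 2 * (a3 - a4) + 2 * (a2 - a4) + 2 * (b2 - b3)"
    unfolding FD_formula_def F2m_def ab using i0 by (simp add: distrib_left distrib_right left_diff_distrib right_diff_distrib del: pt_simps)
  have e3: "FF v w cs d = F10 + 2 * a1 + b1"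
    unfolding FF_eq[OF assms(1,3) K \<open>l > 0\<close>] F10_def ab by simp
  have q: "slam d t * constraint_form ?p ?p t = slam d t * constraint_form cs cs t + 2 * (slam d t * constraint_form cs e t) + slam d t * constraint_form e e t" for t
    by (simp add: constraint_form_sym[of e cs] algebra_simps)
  have e4: "FF v w ?p d = F1p + 2 * (a1 + a2 + a3 + a4) + (b1 + 2 * b2 + b3)"
    unfolding FF_eq[OF B(1) assms(3) Kp l4] F1p_def ab q using i0
    by (simp add: distrib_left distrib_right del: pt_simps)
  \<comment> \<open>Along the segment the constraint part of the KKT operator is affine in the
    parameter, and for affine functions the rule with 1/4 is exact. Both sides contain 2
    \<open>a4\<close> + \<open>b3\<close>, so only the travel time contributes.\<close>
  have E1: "FD_formula ?p e d - (FF v w ?p d - FF v w cs d) - 1/4 * (FD_formula ?p e d - FD_formula ?m e d)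
      = F2p - (F1p - F10) - 1/4 * (F2p - F2m)"
    unfolding e1 e2 e3 e4 by (simp add: field_simps)
  have E2: "F2p - (F1p - F10) - 1/4 * (F2p - F2m) = (\<integral>t. f2 (pt ?p t) (pt d t) (pt e t) - (f1 (pt ?p t) (pt d t) - f1 (pt cs t) (pt d t))
       - 1/4 * (f2 (pt ?p t) (pt d t) (pt e t) - f2 (pt ?m t) (pt d t) (pt e t)) \<partial>mu)" (is "_ = (\<integral>t. ?I t \<partial>mu)")
  proof -
    have "integrable mu (\<lambda>t. f2 (pt ?p t) (pt d t) (pt e t))" "integrable mu (\<lambda>t. f2 (pt ?m t) (pt d t) (pt e t))"
      "integrable mu (\<lambda>t. f1 (pt ?p t) (pt d t))" "integrable mu (\<lambda>t. f1 (pt cs t) (pt d t))"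
      using integrable_f2[OF B(1) _ _ Kp l4] integrable_f2[OF B(2) _ _ Km l4] integrable_f1[OF B(1) assms(3) Kp l4]
        integrable_f1[OF assms(1,3) K \<open>l > 0\<close>] is_Linf_pt assms by blast+
    then show ?thesis unfolding F2p_def F1p_def F10_def F2m_def by (simp del: pt_simps)
  qed
  have "\<bar>\<integral>t. ?I t \<partial>mu\<bar> \<le> \<epsilon> * \<rho> * (L2n (pt e) * L2n (pt d))"
  proof (rule abs_integral_le_L2n)
    show "AE t in mu. \<bar>?I t\<bar> \<le> \<epsilon> * \<rho> * (norm (pt e t) * norm (pt d t))"
      using K e
    proof eventually_elim
      case (elim t)
      have "\<bar>?I t\<bar> \<le> \<epsilon> * (norm (pt e t) * norm (pt e t) * norm (pt d t))"
        using pw[rule_format, OF elim(1), of "pt e t" "pt d t"] elim(2) assms by simp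
      also have "\<dots> \<le> \<epsilon> * (\<rho> * norm (pt e t) * norm (pt d t))"
        using elim assms by (intro mult_left_mono mult_right_mono) auto
      finally show ?case by (simp add: mult_ac)
    qed
    show "?I \<in> borel_measurable mu"
      by (intro borel_measurable_diff borel_measurable_times borel_measurable_const measurable_f2_comp measurable_f1_comp
          is_Linf_measurable[OF is_Linf_pt] B assms)
  qed (use assms(2,3) \<open>\<epsilon> \<ge> 0\<close> \<open>\<rho> \<ge> 0\<close> in \<open>simp_all add: is_Linf_pt\<close>)
  also have "\<dots> \<le> \<epsilon> * \<rho> * (Z2n e * Z2n d)"
    using L \<open>\<epsilon> \<ge> 0\<close> \<open>\<rho> \<ge> 0\<close> by (intro mult_left_mono mult_mono L2n_pt_le) (simp_all add: Z2n_nonneg)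
  finally show ?thesis unfolding E1 E2 .
qed

text \<open>Three constraint integrals, each doubled and each with one factor of supremum size
  \<open>R\<close>, account for 6 R. Uniform continuity of \<open>f2\<close> contributes
  \<epsilon>.\<close>

lemma FD_formula_perturb:
  assumes "bounded_state cs" "bounded_state e" "bounded_state h" "bounded_state d" and K: "AE t in mu. pt cs t \<in> tube X l 0" and "l > 0" "\<epsilon> \<ge> 0"
    and u2: "\<forall>y\<in>tube X l (l/4). \<forall>z\<in>tube X l (l/4). dist y z < \<delta> \<longrightarrow> (\<forall>h k. \<bar>f2 y h k - f2 z h k\<bar> \<le> \<epsilon> * norm h * norm k)"
    and "\<rho> < \<delta>" "\<rho> \<le> l/4" and e: "AE t in mu. norm (pt e t) \<le> \<rho>"
    and R: "R \<ge> 0" "AE t in mu. norm (sdxi e t) \<le> R" "\<bar>sL e\<bar> \<le> R" "AE t in mu. \<bar>slam e t\<bar> \<le> R"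
  shows "\<bar>FD_formula (sadd cs e) h d - FD_formula cs h d\<bar> \<le> (\<epsilon> + 6 * R) * (Y2n h * Y2n d)"
proof -
  note L = assms(1-4)[unfolded bounded_state_def]
  note LI = is_Linf_intros is_Linf_constraint_form
  let ?p = "sadd cs e"
  have B: "bounded_state ?p" using assms by (auto intro: bounded_state_sadd)
  have Kp: "AE t in mu. pt ?p t \<in> tube X l (l/4)"
    using K e
  proof eventually_elim
    case (elim t)
    have "pt cs t + pt e t \<in> tube X l (0 + l/4)" by (rule tube_add[OF elim(1)]) (use elim assms in auto)
    then show ?case by simp
  qed
  have l4: "l/4 < l" using assms by simp
  have i0: "integrable mu (\<lambda>t. slam h t * constraint_form cs d t)" "integrable mu (\<lambda>t. slam h t * constraint_form e d t)"
     "integrable mu (\<lambda>t. slam cs t * constraint_form h d t)" "integrable mu (\<lambda>t. slam e t * constraint_form h d t)"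
     "integrable mu (\<lambda>t. slam d t * constraint_form cs h t)" "integrable mu (\<lambda>t. slam d t * constraint_form e h t)"
    using L by (auto intro!: integrable_Linf LI)
  have if2: "integrable mu (\<lambda>t. f2 (pt ?p t) (pt d t) (pt h t))" "integrable mu (\<lambda>t. f2 (pt cs t) (pt d t) (pt h t))"
    using integrable_f2[OF B _ _ Kp l4] integrable_f2[OF assms(1) _ _ K \<open>l > 0\<close>] is_Linf_pt assms by blast+
  have eq: "FD_formula ?p h d - FD_formula cs h d = (\<integral>t. f2 (pt ?p t) (pt d t) (pt h t) - f2 (pt cs t) (pt d t) (pt h t) \<partial>mu)
     + 2 * (\<integral>t. slam h t * constraint_form e d t \<partial>mu) + 2 * (\<integral>t. slam e t * constraint_form h d t \<partial>mu) + 2 * (\<integral>t. slam d t * constraint_form e h t \<partial>mu)"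
    unfolding FD_formula_def using i0 if2 by (simp add: distrib_left distrib_right del: pt_simps)
  have 1: "\<bar>\<integral>t. f2 (pt ?p t) (pt d t) (pt h t) - f2 (pt cs t) (pt d t) (pt h t) \<partial>mu\<bar> \<le> \<epsilon> * (L2n (pt d) * L2n (pt h))"
  proof (rule abs_integral_le_L2n)
    show "AE t in mu. \<bar>f2 (pt ?p t) (pt d t) (pt h t) - f2 (pt cs t) (pt d t) (pt h t)\<bar> \<le> \<epsilon> * (norm (pt d t) * norm (pt h t))"
      using K Kp e
    proof eventually_elim
      case (elim t)
      have "pt cs t \<in> tube X l (l/4)" using elim(1) tube_mono[of 0 "l/4" X l] \<open>l > 0\<close> by auto
      moreover have "dist (pt ?p t) (pt cs t) < \<delta>" using elim(3) \<open>\<rho> < \<delta>\<close> by (simp add: dist_norm)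
      ultimately show ?case using u2[rule_format, OF elim(2), of "pt cs t" "pt d t" "pt h t"] by (simp only: mult.assoc)
    qed
    show "(\<lambda>t. f2 (pt ?p t) (pt d t) (pt h t) - f2 (pt cs t) (pt d t) (pt h t)) \<in> borel_measurable mu"
      using if2 by (intro borel_measurable_diff) auto
  qed (use assms(2-4) \<open>\<epsilon> \<ge> 0\<close> in \<open>simp_all add: is_Linf_pt\<close>)
  also have "\<dots> \<le> \<epsilon> * (Y2n d * Y2n h)"
    using L \<open>\<epsilon> \<ge> 0\<close> by (intro mult_left_mono mult_mono order_trans[OF L2n_pt_le Y2n_ge(4)]) (simp_all add: Y2n_nonneg)
  finally have 1: "\<bar>\<integral>t. f2 (pt ?p t) (pt d t) (pt h t) - f2 (pt cs t) (pt d t) (pt h t) \<partial>mu\<bar> \<le> \<epsilon> * (Y2n h * Y2n d)"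
    by (simp add: mult_ac)
  have dd: "L2n (sdxi a) + \<bar>sL a\<bar> \<le> Y2n a" "0 \<le> L2n (sdxi a) + \<bar>sL a\<bar>" for a by (simp_all add: Y2n_def Z2n_def)
  have 2: "\<bar>\<integral>t. slam h t * constraint_form e d t \<partial>mu\<bar> \<le> R * (Y2n h * Y2n d)"
  proof -
    have "\<bar>\<integral>t. slam h t * constraint_form e d t \<partial>mu\<bar> \<le> R * L2n (slam h) * (L2n (sdxi d) + \<bar>sL d\<bar>)"
      using L R by (intro abs_int_constraint_form_le) auto
    also have "\<dots> = R * (L2n (slam h) * (L2n (sdxi d) + \<bar>sL d\<bar>))" by simp
    also have "\<dots> \<le> R * (Y2n h * Y2n d)" by (intro mult_left_mono mult_mono R dd Y2n_ge) (simp_all add: Y2n_nonneg)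
    finally show ?thesis .
  qed
  have 3: "\<bar>\<integral>t. slam e t * constraint_form h d t \<partial>mu\<bar> \<le> R * (Y2n h * Y2n d)"
  proof -
    have "\<bar>\<integral>t. slam e t * constraint_form h d t \<partial>mu\<bar> \<le> R * (L2n (sdxi h) + \<bar>sL h\<bar>) * (L2n (sdxi d) + \<bar>sL d\<bar>)"
      using L R by (intro abs_int_mult_constraint_form_le) auto
    also have "\<dots> = R * ((L2n (sdxi h) + \<bar>sL h\<bar>) * (L2n (sdxi d) + \<bar>sL d\<bar>))" by simp
    also have "\<dots> \<le> R * (Y2n h * Y2n d)" by (intro mult_left_mono mult_mono R dd) (simp_all add: Y2n_nonneg)
    finally show ?thesis .
  qed
  have 4: "\<bar>\<integral>t. slam d t * constraint_form e h t \<partial>mu\<bar> \<le> R * (Y2n h * Y2n d)"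
  proof -
    have "\<bar>\<integral>t. slam d t * constraint_form e h t \<partial>mu\<bar> \<le> R * L2n (slam d) * (L2n (sdxi h) + \<bar>sL h\<bar>)"
      using L R by (intro abs_int_constraint_form_le) auto
    also have "\<dots> = R * ((L2n (sdxi h) + \<bar>sL h\<bar>) * L2n (slam d))" by simp
    also have "\<dots> \<le> R * (Y2n h * Y2n d)" by (intro mult_left_mono mult_mono R dd Y2n_ge) (simp_all add: Y2n_nonneg)
    finally show ?thesis .
  qed
  show ?thesis unfolding eq using 1 2 3 4 by (simp add: algebra_simps)
qed

end

section \<open>Stability of the saddle point problem\<close>

context flight
begin

definition second_variation :: "state \<Rightarrow> state \<Rightarrow> state \<Rightarrow> real" where
  "second_variation cs e d = (\<integral>t. f2 (pt cs t) (pt d t) (pt e t) \<partial>mu)"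

lemma second_variation_sym: "second_variation cs e d = second_variation cs d e"
  unfolding second_variation_def by (subst f2_sym) simp

context
  fixes cs :: state and X l :: real
  assumes cs: "bounded_state cs" and K: "AE t in mu. pt cs t \<in> tube X l 0" and l: "l > 0"
begin

lemma second_variation_sadd: "bounded_state a \<Longrightarrow> bounded_state b \<Longrightarrow> bounded_state d \<Longrightarrow> second_variation cs (sadd a b) d = second_variation cs a d + second_variation cs b d"
  unfolding second_variation_def
  using integrable_f2[OF cs is_Linf_pt[of d] is_Linf_pt[of a] K l] integrable_f2[OF cs is_Linf_pt[of d] is_Linf_pt[of b] K l]
  by (simp add: linear_add[OF linear_f2])

lemma second_variation_sscale: "second_variation cs (sscale s a) d = s * second_variation cs a d"
  unfolding second_variation_def by (simp add: linear_scale[OF linear_f2])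

lemma second_variation_sdiff: "bounded_state a \<Longrightarrow> bounded_state b \<Longrightarrow> bounded_state d \<Longrightarrow> second_variation cs (sdiff a b) d = second_variation cs a d - second_variation cs b d"
  unfolding sdiff_def using second_variation_sadd[of a "sscale (-1) b" d] second_variation_sscale[of "-1" b d] bounded_state_sscale by simp

text \<open>Since \<open>indY\<close> is a linear space, semidefiniteness makes the form at e + s d
  a nonnegative quadratic in \<open>s\<close>.\<close>

lemma second_variation_Cauchy_Schwarz:
  assumes psd: "\<And>d. indY d \<Longrightarrow> second_variation cs d d \<ge> 0" and "indY e" "indY d"
  shows "\<bar>second_variation cs e d\<bar> \<le> sqrt (second_variation cs e e) * sqrt (second_variation cs d d)"
proof -
  note B = assms(2,3)[THEN indY_imp_bounded_state]
  have "(second_variation cs e d)\<^sup>2 \<le> second_variation cs e e * second_variation cs d d"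
  proof (rule sq_le_mult_if_quadratic_nonneg)
    fix s
    have "0 \<le> second_variation cs (sadd e (sscale s d)) (sadd e (sscale s d))"
      by (intro psd indY_sadd indY_sscale assms)
    also have "\<dots> = second_variation cs e e + s * second_variation cs d e + s * (second_variation cs e d + s * second_variation cs d d)"
    proof -
      define E where "E = sadd e (sscale s d)"
      have E: "second_variation cs E q = second_variation cs e q + s * second_variation cs d q" if "bounded_state q" for q
        unfolding E_def using B bounded_state_sscale that by (simp add: second_variation_sadd second_variation_sscale)
      have "bounded_state E" using B bounded_state_sscale bounded_state_sadd by (simp add: E_def)
      from E[OF this] have "second_variation cs E E = second_variation cs e E + s * second_variation cs d E" .
      also have "second_variation cs e E = second_variation cs E e" by (rule second_variation_sym)
      also have "second_variation cs d E = second_variation cs E d" by (rule second_variation_sym)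
      finally show ?thesis using E B unfolding E_def by simp
    qed
    finally show "0 \<le> second_variation cs e e + 2 * s * second_variation cs e d + s\<^sup>2 * second_variation cs d d"
      by (simp add: second_variation_sym[of cs d e] power2_eq_square algebra_simps)
  qed
  then have "sqrt ((second_variation cs e d)\<^sup>2) \<le> sqrt (second_variation cs e e * second_variation cs d d)" by (rule real_sqrt_le_mono)
  then show ?thesis by (simp add: real_sqrt_mult)
qed

text \<open>The standard saddle-point estimate gives a multiplier bound that is worse by the factor
  \<open>1 + B/Bl\<close>. Semidefiniteness of the second variation on all directions, not only on the kernel of
  the constraint, removes this factor through the Cauchy-Schwarz inequality for the form \<open>second_variation\<close>.\<close>

lemma saddle_point_stability:
  assumes lam: "AE t in mu. slam cs t = 0"
    and psd: "\<And>d. indY d \<Longrightarrow> second_variation cs d d \<ge> 0"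
    and bnd: "\<And>d. indY d \<Longrightarrow> second_variation cs d d \<le> B * (Z2n d)\<^sup>2"
    and coer: "\<And>d. indY d \<Longrightarrow> (AE t in mu. constraint_form cs d t = 0) \<Longrightarrow> second_variation cs d d \<ge> Bl * (Z2n d)\<^sup>2"
    and lift: "\<And>g. is_Linf g \<Longrightarrow> \<exists>d. indY d \<and> slam d = (\<lambda>t. 0) \<and> (AE t in mu. 2 * constraint_form cs d t = g t) \<and> Z2n d \<le> L2n g / \<kappa>"
    and pos: "B \<ge> 0" "Bl > 0" "\<kappa> > 0" "N \<ge> 0"
    and e: "indY e" and N: "\<And>d. indY d \<Longrightarrow> \<bar>FD_formula cs e d\<bar> \<le> N * Y2n d"
  shows "Y2n e \<le> N * (1 / Bl + (2 + 2 * sqrt (B / Bl)) / \<kappa> + B / \<kappa>\<^sup>2)"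
proof -
  note LI = is_Linf_intros is_Linf_constraint_form
  have be: "bounded_state e" using e indY_imp_bounded_state by blast
  note Lc = cs[unfolded bounded_state_def] and Le = be[unfolded bounded_state_def]
  have l0: "(\<integral>t. slam cs t * q t \<partial>mu) = 0" for q
    using lam by (intro integral_eq_zero_AE) (auto elim: eventually_mono)
  have FD_formula: "FD_formula cs a d = second_variation cs a d + 2 * (\<integral>t. slam a t * constraint_form cs d t \<partial>mu) + 2 * (\<integral>t. slam d t * constraint_form cs a t \<partial>mu)" for a d
    unfolding FD_formula_def second_variation_def l0 by simp
  define g where "g t = 2 * constraint_form cs e t" for t
  have gL: "is_Linf g" unfolding g_def[abs_def] using Lc Le by (intro LI) auto
  have gN: "L2n g \<le> N"
  proof -
    \<comment> \<open>A test direction consisting of the multiplier \<open>g\<close> alone isolates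
      the residual of the linearised constraint: the operator returns exactly the square of its L2
      norm.\<close>
    define D where "D = \<lparr>sL = 0, sxi = (\<lambda>t. 0), sdxi = (\<lambda>t. 0), slam = g\<rparr>"
    have D: "indY D" using gL W1inf_scaleR[of _ _ 0] W1inf_prim[OF is_Linf_const[of "0::vec2"], of 0]
      by (auto simp: D_def indY_def indZ_def W1inf_iff is_Linf_const prim_def)
    have "pt D t = 0" for t by (simp add: D_def pt_def zero_prod_def)
    then have "second_variation cs e D = 0" unfolding second_variation_def by (simp add: linear_0[OF linear_f2_fst])
    then have "FD_formula cs e D = (\<integral>t. g t * g t \<partial>mu)"
      unfolding FD_formula by (simp add: D_def constraint_form_def[of cs "\<lparr>sL = 0, sxi = _, sdxi = _, slam = _\<rparr>"] g_def mult_ac)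
    also have "\<dots> = (L2n g)\<^sup>2" unfolding L2n_sq by (simp add: power2_eq_square)
    finally have "(L2n g)\<^sup>2 \<le> N * Y2n D" using N[OF D] by simp
    also have "Y2n D = L2n g" by (simp add: D_def Y2n_def Z2n_def)
    finally show ?thesis using L2n_nonneg[of g] pos by (cases "L2n g = 0") (auto simp: power2_eq_square)
  qed
  \<comment> \<open>The direction \<open>e1\<close> carries the whole residual, so what remains of
    the primal part lies in the kernel of the constraint, where coercivity is available.\<close>
  obtain e1 where e1: "indY e1" "slam e1 = (\<lambda>t. 0)" "AE t in mu. 2 * constraint_form cs e1 t = g t" "Z2n e1 \<le> L2n g / \<kappa>"
    using lift[OF gL] by blast
  define z where "z = e\<lparr>slam := \<lambda>t. 0\<rparr>"
  have z: "indY z" using e is_Linf_const by (simp add: z_def indY_def indZ_def)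
  have ptz: "pt z = pt e" "constraint_form cs z = constraint_form cs e" "Z2n z = Z2n e"
    by (auto simp: z_def pt_def constraint_form_def Z2n_def fun_eq_iff)
  have aaz: "second_variation cs e d = second_variation cs z d" for d by (simp add: second_variation_def ptz)
  define e0 where "e0 = sdiff z e1"
  have e0: "indY e0" "slam e0 = (\<lambda>t. 0)" using z e1 by (auto simp: e0_def indY_sdiff z_def)
  note bounded_state = z[THEN indY_imp_bounded_state] e1(1)[THEN indY_imp_bounded_state] e0(1)[THEN indY_imp_bounded_state]
  have ker: "AE t in mu. constraint_form cs e0 t = 0"
    using e1(3) by eventually_elim (simp add: e0_def ptz g_def)
  define XX where "XX = sqrt (second_variation cs e0 e0)"
  define YY where "YY = sqrt (second_variation cs e1 e1)"
  define W where "W = sqrt (second_variation cs z z)"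
  define \<beta> where "\<beta> = sqrt Bl"
  define \<gamma> where "\<gamma> = sqrt B"
  have sq: "XX\<^sup>2 = second_variation cs e0 e0" "YY\<^sup>2 = second_variation cs e1 e1" "W\<^sup>2 = second_variation cs z z" "\<beta>\<^sup>2 = Bl" "\<gamma>\<^sup>2 = B"
    using psd e0 e1 z pos by (auto simp: XX_def YY_def W_def \<beta>_def \<gamma>_def)
  have nn: "XX \<ge> 0" "YY \<ge> 0" "W \<ge> 0" "\<beta> > 0" "\<gamma> \<ge> 0"
    using psd e0 e1 z pos by (auto simp: XX_def YY_def W_def \<beta>_def \<gamma>_def)
  have Ze0: "Z2n e0 \<le> XX / \<beta>"
  proof -
    have "(\<beta> * Z2n e0)\<^sup>2 \<le> XX\<^sup>2" using coer[OF e0(1) ker] by (simp add: sq power_mult_distrib)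
    then have "\<beta> * Z2n e0 \<le> XX" by (rule power2_le_imp_le) (rule nn)
    then show ?thesis using nn by (simp add: field_simps)
  qed
  have Ze1: "Z2n e1 \<le> N / \<kappa>" using e1(4) gN pos by (meson divide_right_mono less_imp_le order_trans)
  have up: "sqrt (second_variation cs d d) \<le> \<gamma> * Z2n d" if "indY d" for d
    using real_sqrt_le_mono[OF bnd[OF that]] pos Z2n_nonneg[of d] by (simp add: real_sqrt_mult \<gamma>_def)
  have YYb: "YY \<le> \<gamma> * (N / \<kappa>)"
    using up[OF e1(1)] Ze1 nn unfolding YY_def by (meson mult_left_mono order_trans)
  \<comment> \<open>Testing with a kernel direction removes the multiplier of \<open>e\<close>; the
    primal part is thus estimated before anything is known about the multiplier.\<close>
  have ze0: "\<bar>second_variation cs z e0\<bar> \<le> N * (XX / \<beta>)"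
  proof -
    have "(\<integral>t. slam e t * constraint_form cs e0 t \<partial>mu) = 0"
      using ker by (intro integral_eq_zero_AE) (auto elim: eventually_mono)
    then have "FD_formula cs e e0 = second_variation cs z e0" unfolding FD_formula aaz by (simp add: e0)
    then have "\<bar>second_variation cs z e0\<bar> \<le> N * Y2n e0" using N[OF e0(1)] by simp
    also have "Y2n e0 = Z2n e0" by (simp add: Y2n_def e0)
    finally show ?thesis using Ze0 pos by (meson mult_left_mono order_trans)
  qed
  have zsplit: "z = sadd e0 e1" unfolding e0_def by (intro state_eqI) (auto simp: fun_eq_iff)
  have "second_variation cs z e0 = XX\<^sup>2 + second_variation cs e1 e0" unfolding sq using second_variation_sadd[OF bounded_state(3,2,3)] zsplit by simp
  moreover have "\<bar>second_variation cs e1 e0\<bar> \<le> YY * XX" unfolding XX_def YY_def by (rule second_variation_Cauchy_Schwarz[OF psd e1(1) e0(1)])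
  ultimately have "XX * XX \<le> XX * (YY + N / \<beta>)"
    using ze0 by (simp add: power2_eq_square algebra_simps)
  then have XXb: "XX \<le> YY + N / \<beta>" using nn pos by (cases "XX = 0") auto
  \<comment> \<open>The triangle inequality W \<le> XX + YY would count \<open>YY\<close> twice.
    Expanding the form at \<open>e1\<close> = z - e0 and completing the square keeps it once, which
    gives the term B / \<kappa>^2 the coefficient 1.\<close>
  have Wb: "W \<le> YY + N / \<beta>"
  proof (rule power2_le_imp_le)
    have "second_variation cs e1 e1 = second_variation cs z z - 2 * second_variation cs z e0 + second_variation cs e0 e0"
    proof -
      have e1d: "e1 = sdiff z e0" unfolding e0_def by (intro state_eqI) (auto simp: fun_eq_iff)
      have "second_variation cs e1 e1 = second_variation cs z e1 - second_variation cs e0 e1" using second_variation_sdiff[OF bounded_state(1,3,2)] e1d by metis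
      also have "second_variation cs z e1 = second_variation cs z z - second_variation cs z e0" using second_variation_sdiff[OF bounded_state(1,3,1)] e1d second_variation_sym by metis
      also have "second_variation cs e0 e1 = second_variation cs z e0 - second_variation cs e0 e0" using second_variation_sdiff[OF bounded_state(1,3,3)] e1d second_variation_sym by metis
      finally show ?thesis by simp
    qed
    then have "W\<^sup>2 = YY\<^sup>2 + 2 * second_variation cs z e0 - XX\<^sup>2" by (simp add: sq)
    also have "\<dots> \<le> YY\<^sup>2 + 2 * (N * (XX / \<beta>)) - XX\<^sup>2" using ze0 by linarith
    also have "2 * (N * (XX / \<beta>)) = 2 * XX * (N / \<beta>)" by simp
    also have "YY\<^sup>2 + 2 * XX * (N / \<beta>) - XX\<^sup>2 \<le> YY\<^sup>2 + (N / \<beta>)\<^sup>2"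
      using zero_le_power2[of "XX - N / \<beta>"] unfolding power2_diff by linarith
    also have "\<dots> \<le> (YY + N / \<beta>)\<^sup>2" using nn pos by (simp add: power2_sum)
    finally show "W\<^sup>2 \<le> (YY + N / \<beta>)\<^sup>2" .
  qed (use nn pos in auto)
  \<comment> \<open>The multiplier is tested against a lift of itself, so that its pairing with the
    constraint is the square of its own norm.\<close>
  obtain d where d: "indY d" "slam d = (\<lambda>t. 0)" "AE t in mu. 2 * constraint_form cs d t = slam e t" "Z2n d \<le> L2n (slam e) / \<kappa>"
    using lift[of "slam e"] Le by blast
  have lamb: "L2n (slam e) \<le> (N + W * \<gamma>) / \<kappa>"
  proof -
    have "(\<integral>t. 2 * (slam e t * constraint_form cs d t) \<partial>mu) = (\<integral>t. (slam e t)\<^sup>2 \<partial>mu)"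
    proof (rule integral_cong_AE)
      show "AE t in mu. 2 * (slam e t * constraint_form cs d t) = (slam e t)\<^sup>2"
        using d(3)
      proof eventually_elim
        case (elim t)
        have "2 * (slam e t * constraint_form cs d t) = slam e t * (2 * constraint_form cs d t)" by simp
        then show ?case unfolding elim by (simp add: power2_eq_square)
      qed
      show "(\<lambda>t. 2 * (slam e t * constraint_form cs d t)) \<in> borel_measurable mu" "(\<lambda>t. (slam e t)\<^sup>2) \<in> borel_measurable mu"
        using Lc Le d(1)[THEN indY_imp_bounded_state, unfolded bounded_state_def]
        by (auto intro!: is_Linf_measurable LI is_Linf_power2)
    qed
    then have "2 * (\<integral>t. slam e t * constraint_form cs d t \<partial>mu) = (L2n (slam e))\<^sup>2" by (simp add: L2n_sq)
    then have "FD_formula cs e d = second_variation cs z d + (L2n (slam e))\<^sup>2" unfolding FD_formula aaz by (simp add: d)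
    moreover have "\<bar>FD_formula cs e d\<bar> \<le> N * Z2n d" using N[OF d(1)] by (simp add: Y2n_def d)
    moreover have "\<bar>second_variation cs z d\<bar> \<le> W * (\<gamma> * Z2n d)"
      using second_variation_Cauchy_Schwarz[OF psd z d(1)] mult_left_mono[OF up[OF d(1)] nn(3)] unfolding W_def by linarith
    ultimately have "(L2n (slam e))\<^sup>2 \<le> (N + W * \<gamma>) * Z2n d" by (simp add: algebra_simps)
    also have "\<dots> \<le> (N + W * \<gamma>) * (L2n (slam e) / \<kappa>)" using nn pos d by (intro mult_left_mono) auto
    finally have "L2n (slam e) * L2n (slam e) \<le> L2n (slam e) * ((N + W * \<gamma>) / \<kappa>)"
      by (simp add: power2_eq_square mult_ac)
    moreover have "0 \<le> (N + W * \<gamma>) / \<kappa>" using nn pos by simp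
    ultimately show ?thesis using L2n_nonneg[of "slam e"] by (metis less_eq_real_def mult_le_cancel_left_pos)
  qed
  have "Z2n e \<le> Z2n e0 + Z2n e1"
    using Z2n_sadd[of e0 e1] bounded_state(2,3) zsplit ptz(3) unfolding bounded_state_def by metis
  also have "\<dots> \<le> (YY + N / \<beta>) / \<beta> + N / \<kappa>"
    using Ze0 Ze1 divide_right_mono[OF XXb, of \<beta>] nn by linarith
  also have "\<dots> \<le> (\<gamma> * (N / \<kappa>) + N / \<beta>) / \<beta> + N / \<kappa>"
    using divide_right_mono[OF add_right_mono[OF YYb, of "N / \<beta>"], of \<beta>] nn by linarith
  finally have 1: "Z2n e \<le> (\<gamma> * (N / \<kappa>) + N / \<beta>) / \<beta> + N / \<kappa>" .
  have "W * \<gamma> \<le> (\<gamma> * (N / \<kappa>) + N / \<beta>) * \<gamma>"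
    using order_trans[OF Wb add_right_mono[OF YYb]] nn(5) by (rule mult_right_mono)
  then have 2: "L2n (slam e) \<le> (N + (\<gamma> * (N / \<kappa>) + N / \<beta>) * \<gamma>) / \<kappa>"
    using lamb pos(3) by (meson add_left_mono divide_right_mono less_imp_le order_trans)
  have "Y2n e \<le> ((\<gamma> * (N / \<kappa>) + N / \<beta>) / \<beta> + N / \<kappa>) + (N + (\<gamma> * (N / \<kappa>) + N / \<beta>) * \<gamma>) / \<kappa>"
    using 1 2 by (simp add: Y2n_def)
  also have "\<dots> = N * (1 / \<beta>\<^sup>2 + (2 + 2 * (\<gamma> / \<beta>)) / \<kappa> + \<gamma>\<^sup>2 / \<kappa>\<^sup>2)"
    using nn pos by (simp add: field_simps power2_eq_square)
  also have "\<gamma> / \<beta> = sqrt (B / Bl)" by (simp add: \<gamma>_def \<beta>_def real_sqrt_divide)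
  finally show ?thesis by (simp add: sq)
qed

end

end

section \<open>The constraint has a bounded right inverse\<close>

text \<open>Adding velocity \<phi> u changes the constraint by \<phi> times the component of the
  velocity along \<open>u\<close>, which is at least \<open>c\<close>. Fixed end points force \<phi>
  to have mean zero, and a change of \<open>L\<close> makes up for the constant that has to be
  removed. Velocity, position and \<open>L\<close> contribute 1 + 1/2 + 1 times the norm of
  \<open>h\<close> over \<open>c\<close>, and h = g / 2; hence 5 / (4 c).\<close>

lemma constraint_lift:
  fixes c :: real and u :: vec2
  assumes cs: "is_Linf (sdxi cs)" and c: "c > 0" and u: "norm u = 1"
    and dir: "AE t in mu. u \<bullet> sdxi cs t \<ge> c" and speed: "AE t in mu. norm (sdxi cs t) \<le> \<bar>sL cs\<bar>"
    and g: "is_Linf g"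
  shows "\<exists>d. indY d \<and> slam d = (\<lambda>t. 0) \<and> (AE t in mu. 2 * constraint_form cs d t = g t) \<and> Z2n d \<le> L2n g / (4 * c / 5)"
proof -
  define L where "L = sL cs"
  define p where "p t = u \<bullet> sdxi cs t" for t
  define q where "q t = inverse (p t)" for t
  define h where "h t = g t / 2" for t
  have pL: "is_Linf p" unfolding p_def[abs_def] by (intro is_Linf_inner is_Linf_const cs)
  have pb: "AE t in mu. c \<le> p t \<and> p t \<le> \<bar>L\<bar>"
    using dir speed
  proof eventually_elim
    case (elim t)
    then show ?case using norm_cauchy_schwarz[of u "sdxi cs t"] u by (simp add: p_def L_def)
  qed
  then have "AE t in mu. c \<le> \<bar>L\<bar>" by eventually_elim simp
  then have cL: "c \<le> \<bar>L\<bar>" by (simp add: AE_mu_const)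
  have qb: "AE t in mu. q t > 0 \<and> inverse \<bar>L\<bar> \<le> q t \<and> q t \<le> inverse c"
    using pb by eventually_elim (use c in \<open>auto simp: q_def intro: le_imp_inverse_le\<close>)
  have qL: "is_Linf q"
  proof (rule is_LinfI)
    show "q \<in> borel_measurable mu" unfolding q_def[abs_def] using is_Linf_measurable[OF pL] by measurable
    show "AE t in mu. norm (q t) \<le> inverse c" using qb by eventually_elim auto
  qed
  have hL: "is_Linf h" unfolding h_def[abs_def] using is_Linf_mult[OF g is_Linf_const[of "1/2::real"]] by simp
  have Lh: "L2n h = L2n g / 2" using L2n_mult[of "1/2" g] by (simp add: h_def[abs_def])
  note LI = is_Linf_intros is_Linf_diff is_Linf_power2 qL hL
  have int: "integrable mu q" "integrable mu (\<lambda>t. q t * h t)" "integrable mu (\<lambda>t. q t * (h t)\<^sup>2)" "integrable mu (\<lambda>t. (h t)\<^sup>2)"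
    by (intro integrable_Linf LI)+
  define Q where "Q = (\<integral>t. q t \<partial>mu)"
  have Qb: "Q \<ge> inverse \<bar>L\<bar>"
  proof -
    have "(\<integral>t. inverse \<bar>L\<bar> \<partial>mu) \<le> Q" unfolding Q_def
      using qb int by (intro integral_mono_AE) (auto elim: eventually_mono)
    then show ?thesis by simp
  qed
  have Qpos: "Q > 0" using Qb cL c by (meson less_le_trans positive_imp_inverse_positive)
  \<comment> \<open>The mean is weighted by \<open>q\<close> because it is q (h - m), not h - m,
    that has to integrate to zero.\<close>
  define m where "m = (\<integral>t. q t * h t \<partial>mu) / Q"
  have mQ: "(\<integral>t. q t * h t \<partial>mu) = m * Q" using Qpos by (simp add: m_def)
  define \<phi> where "\<phi> t = q t * (h t - m)" for t
  have \<phi>L: "is_Linf \<phi>" unfolding \<phi>_def[abs_def] by (intro LI)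
  have \<phi>0: "(\<integral>t. \<phi> t \<partial>mu) = 0"
    unfolding \<phi>_def right_diff_distrib using int mQ by (simp add: Q_def[symmetric])
  have qh2: "(\<integral>t. q t * (h t)\<^sup>2 \<partial>mu) \<le> (L2n h)\<^sup>2 / c"
  proof -
    have "(\<integral>t. q t * (h t)\<^sup>2 \<partial>mu) \<le> (\<integral>t. inverse c * (h t)\<^sup>2 \<partial>mu)"
    proof (rule integral_mono_AE)
      show "AE t in mu. q t * (h t)\<^sup>2 \<le> inverse c * (h t)\<^sup>2"
        using qb by eventually_elim (auto intro: mult_right_mono)
    qed (use int in auto)
    then show ?thesis by (simp add: L2n_sq divide_inverse mult.commute)
  qed
  \<comment> \<open>The variance identity for the weight \<open>q\<close>. Removing the mean does
    not increase the integral, so \<phi> obeys the bound for q h, and nonnegativity of the variance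
    bounds \<open>m\<close> as well.\<close>
  have weighted: "(\<integral>t. q t * (h t - m)\<^sup>2 \<partial>mu) = (\<integral>t. q t * (h t)\<^sup>2 \<partial>mu) - m\<^sup>2 * Q"
  proof -
    have "(\<integral>t. q t * (h t - m)\<^sup>2 \<partial>mu) = (\<integral>t. q t * (h t)\<^sup>2 - (2 * m) * (q t * h t) + m\<^sup>2 * q t \<partial>mu)"
      by (intro Bochner_Integration.integral_cong) (auto simp: power2_eq_square algebra_simps)
    also have "\<dots> = (\<integral>t. q t * (h t)\<^sup>2 \<partial>mu) - (2 * m) * (m * Q) + m\<^sup>2 * Q"
      using int mQ by (simp add: Q_def)
    finally show ?thesis by (simp add: power2_eq_square algebra_simps)
  qed
  have w0: "(\<integral>t. q t * (h t - m)\<^sup>2 \<partial>mu) \<ge> 0"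
    using qb by (intro integral_nonneg_AE) (auto elim!: eventually_mono)
  have \<phi>n: "L2n \<phi> \<le> L2n h / c"
  proof (rule power2_le_imp_le)
    have "(L2n \<phi>)\<^sup>2 = (\<integral>t. (\<phi> t)\<^sup>2 \<partial>mu)" by (simp add: L2n_sq)
    also have "\<dots> \<le> (\<integral>t. inverse c * (q t * (h t - m)\<^sup>2) \<partial>mu)"
    proof (rule integral_mono_AE)
      show "AE t in mu. (\<phi> t)\<^sup>2 \<le> inverse c * (q t * (h t - m)\<^sup>2)"
        using qb
      proof eventually_elim
        case (elim t)
        have "(\<phi> t)\<^sup>2 = q t * (q t * (h t - m)\<^sup>2)" by (simp add: \<phi>_def power2_eq_square mult_ac)
        also have "\<dots> \<le> inverse c * (q t * (h t - m)\<^sup>2)" using elim by (intro mult_right_mono) auto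
        finally show ?case .
      qed
    qed (intro integrable_Linf LI \<phi>L)+
    also have "\<dots> = inverse c * ((\<integral>t. q t * (h t)\<^sup>2 \<partial>mu) - m\<^sup>2 * Q)" using weighted by simp
    also have "\<dots> \<le> inverse c * ((L2n h)\<^sup>2 / c)"
    proof (intro mult_left_mono)
      have "m\<^sup>2 * Q \<ge> 0" using Qpos by simp
      then show "(\<integral>t. q t * (h t)\<^sup>2 \<partial>mu) - m\<^sup>2 * Q \<le> (L2n h)\<^sup>2 / c" using qh2 by linarith
    qed (use c in auto)
    also have "\<dots> = (L2n h / c)\<^sup>2" by (simp add: power2_eq_square divide_inverse mult_ac)
    finally show "(L2n \<phi>)\<^sup>2 \<le> (L2n h / c)\<^sup>2" .
  qed (use c in auto)
  \<comment> \<open>One factor 1 / |L| comes from the lower bound on \<open>Q\<close>; the other is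
    estimated by 1 / c.\<close>
  have mL: "\<bar>m / L\<bar> \<le> L2n h / c"
  proof (rule power2_le_imp_le)
    have "m\<^sup>2 * inverse \<bar>L\<bar> \<le> m\<^sup>2 * Q" using Qb by (intro mult_left_mono) auto
    also have "\<dots> \<le> (L2n h)\<^sup>2 / c" using w0 weighted qh2 by linarith
    finally have "m\<^sup>2 * inverse \<bar>L\<bar> * inverse \<bar>L\<bar> \<le> (L2n h)\<^sup>2 / c * inverse c"
      using c cL by (intro mult_mono) (auto intro: le_imp_inverse_le)
    then show "\<bar>m / L\<bar>\<^sup>2 \<le> (L2n h / c)\<^sup>2"
      by (simp add: power_divide power2_eq_square divide_inverse mult_ac abs_mult)
  qed (use c in auto)
  define d where "d = \<lparr>sL = - m / L, sxi = (\<lambda>t. 0 + prim (\<lambda>t. \<phi> t *\<^sub>R u) t), sdxi = (\<lambda>t. \<phi> t *\<^sub>R u), slam = (\<lambda>t. 0)\<rparr>"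
  have uL: "is_Linf (\<lambda>t. \<phi> t *\<^sub>R u)" by (intro is_Linf_scaleR \<phi>L is_Linf_const)
  have u0: "integral\<^sup>L mu (\<lambda>t. \<phi> t *\<^sub>R u) = 0"
    using \<phi>0 integrable_Linf[OF \<phi>L] by simp
  have "indY d"
    unfolding indY_def indZ_def d_def using W1inf_prim[OF uL, of 0] u0
    by (simp add: prim_1 is_Linf_const)
  moreover have "AE t in mu. 2 * constraint_form cs d t = g t"
    using pb
  proof eventually_elim
    case (elim t)
    then have "p t \<noteq> 0" "L \<noteq> 0" using c by auto
    then have "\<phi> t * p t = h t - m" "L * (m / L) = m" by (simp_all add: \<phi>_def q_def)
    then show ?case unfolding constraint_form_def d_def
      by (simp add: inner_commute p_def[symmetric] L_def[symmetric]) (simp add: h_def)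
  qed
  moreover have "Z2n d \<le> L2n g / (4 * c / 5)"
  proof -
    have nu: "L2n (\<lambda>t. \<phi> t *\<^sub>R u) = L2n \<phi>" unfolding L2n_mu by (simp add: u)
    have "L2n (prim (\<lambda>t. \<phi> t *\<^sub>R u)) \<le> L2n (\<lambda>t. 1/2 * L2n \<phi>)"
    proof (rule L2n_mono)
      have "norm (prim (\<lambda>t. \<phi> t *\<^sub>R u) t) \<le> 1/2 * L2n \<phi>" for t
        using norm_prim_le_half[OF uL u0, of t] integral_norm_le_L2n[OF uL] nu by linarith
      then show "AE t in mu. norm (prim (\<lambda>t. \<phi> t *\<^sub>R u) t) \<le> norm (1/2 * L2n \<phi>)" by simp
    qed (intro is_Linf_prim uL is_Linf_const)+
    then have "L2n (prim (\<lambda>t. \<phi> t *\<^sub>R u)) \<le> 1/2 * L2n \<phi>" by (simp add: L2n_const)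
    then have "Z2n d \<le> L2n h / c + 1/2 * (L2n h / c) + L2n h / c"
      using \<phi>n mL unfolding Z2n_def d_def by (simp add: nu)
    also have "\<dots> = L2n g / (4 * c / 5)" using c by (simp add: Lh field_simps)
    finally show ?thesis .
  qed
  moreover have "slam d = (\<lambda>t. 0)" by (simp add: d_def)
  ultimately show ?thesis by blast
qed

section \<open>Nonnegativity of the second variation\<close>

text \<open>Monotonicity of a primitive from a lower bound on its density, with no differentiation
  involved.\<close>

lemma prim_increment_ge:
  fixes g :: "real \<Rightarrow> real"
  assumes g: "is_Linf g" and "AE t in mu. k \<le> g t" and "0 \<le> s" "s \<le> t" "t \<le> 1"
  shows "k * (t - s) \<le> prim g t - prim g s"
proof -
  have i: "is_Linf (indicator {s<..t} :: real \<Rightarrow> real)"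
    by (rule is_LinfI[of _ 1]) (auto intro!: borel_measurable_muI simp: indicator_def)
  have meas: "measure mu ({s<..t} \<inter> I01) = t - s"
  proof -
    have "measure mu ({s<..t} \<inter> I01) = measure lborel ({s<..t} \<inter> I01)"
      unfolding mu_def by (rule measure_restrict_space[OF I01_sets]) auto
    also have "\<dots> = measure lborel {s<..t}"
    proof (cases "t = 1")
      case True
      have "{s<..t} \<inter> I01 = {s<..<1}" using assms True by (auto simp: I01_def)
      then show ?thesis using True assms by simp
    next
      case False
      then have "{s<..t} \<inter> I01 = {s<..t}" using assms by (auto simp: I01_def)
      then show ?thesis by simp
    qed
    finally show ?thesis using assms by simp
  qed
  have "k * (t - s) = (\<integral>r. indicator {s<..t} r * k \<partial>mu)" by (simp add: meas mult.commute)
  also have "\<dots> \<le> (\<integral>r. indicator {s<..t} r * g r \<partial>mu)"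
    using assms(2) by (intro integral_mono_AE integrable_Linf is_Linf_mult i is_Linf_const g)
      (auto elim!: eventually_mono simp: indicator_def)
  also have "\<dots> = prim g t - prim g s"
    unfolding prim_def
    by (subst Bochner_Integration.integral_diff[OF integrable_prim[OF g] integrable_prim[OF g], symmetric],
        intro Bochner_Integration.integral_cong) (use \<open>s \<le> t\<close> in \<open>auto simp: indicator_def\<close>)
  finally show ?thesis .
qed

text \<open>The probability integral transform: a positive density on the unit interval is pushed forward
  to Lebesgue measure by its own primitive. It replaces a change of variables, for which the primitive
  would have to be differentiable.\<close>

lemma probability_integral_transform:
  fixes \<rho> :: "real \<Rightarrow> real"
  assumes \<rho>: "is_Linf \<rho>" and k: "k > 0" "\<And>t. t \<in> I01 \<Longrightarrow> k \<le> \<rho> t" and one: "(\<integral>t. \<rho> t \<partial>mu) = 1"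
  obtains \<tau> where "continuous_on {0..1} \<tau>" "\<tau> ` {0..1} \<subseteq> {0..1}" "\<tau> ` I01 \<subseteq> I01" "\<tau> 0 = 0" "\<tau> 1 = 1"
    "\<forall>t\<in>{0..1}. \<forall>s\<in>{0..1}. prim \<rho> t \<le> s \<longleftrightarrow> t \<le> \<tau> s"
    "\<forall>t\<in>{0..1}. \<tau> (prim \<rho> t) = t"
    "\<forall>t\<in>I01. prim \<rho> t \<in> I01"
    "distr (density mu (\<lambda>t. ennreal (\<rho> t))) borel (prim \<rho>) = distr mu borel (\<lambda>t. t)"
proof -
  define \<sigma> where "\<sigma> = prim \<rho>"
  have \<sigma>01: "\<sigma> 0 = 0" "\<sigma> 1 = 1" by (simp_all add: \<sigma>_def prim_1 one)
  have kae: "AE t in mu. k \<le> \<rho> t" using k by (intro AE_I2) auto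
  have mono: "\<sigma> s < \<sigma> t" if "0 \<le> s" "s < t" "t \<le> 1" for s t
  proof -
    have "0 < k * (t - s)" using k that by simp
    then show ?thesis using prim_increment_ge[OF \<rho> kae that(1) _ that(3)] that by (simp add: \<sigma>_def)
  qed
  have cont: "continuous_on {0..1} \<sigma>" unfolding \<sigma>_def by (rule continuous_prim[OF \<rho>])
  have inj: "inj_on \<sigma> {0..1}"
    by (rule linorder_inj_onI) (use mono in \<open>force\<close>)+
  have im: "\<sigma> ` {0..1} = {0..1}"
  proof
    show "\<sigma> ` {0..1} \<subseteq> {0..1}"
    proof
      fix y assume "y \<in> \<sigma> ` {0..1}"
      then obtain t where t: "t \<in> {0..1}" "y = \<sigma> t" by auto
      show "y \<in> {0..1}"
        using t mono[of 0 t] mono[of t 1] \<sigma>01 by (cases "t = 0"; cases "t = 1") (auto simp: less_imp_le)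
    qed
    show "{0..1} \<subseteq> \<sigma> ` {0..1}"
    proof
      fix y :: real assume "y \<in> {0..1}"
      then have "\<exists>x. 0 \<le> x \<and> x \<le> 1 \<and> \<sigma> x = y" using IVT'[of \<sigma> 0 y 1] cont \<sigma>01 by auto
      then show "y \<in> \<sigma> ` {0..1}" by auto
    qed
  qed
  define \<tau> where "\<tau> = inv_into {0..1} \<sigma>"
  have \<tau>\<sigma>: "\<tau> (\<sigma> t) = t" if "t \<in> {0..1}" for t unfolding \<tau>_def by (rule inv_into_f_f[OF inj that])
  have \<sigma>\<tau>: "\<sigma> (\<tau> s) = s" if "s \<in> {0..1}" for s unfolding \<tau>_def using f_inv_into_f[of s \<sigma> "{0..1}"] im that by auto
  have \<tau>r: "\<tau> s \<in> {0..1}" if "s \<in> {0..1}" for s unfolding \<tau>_def using inv_into_into[of s \<sigma> "{0..1}"] im that by auto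
  have \<tau>01: "\<tau> 0 = 0" "\<tau> 1 = 1" using \<tau>\<sigma>[of 0] \<tau>\<sigma>[of 1] \<sigma>01 by auto
  have \<tau>I: "\<tau> s \<in> I01" if "s \<in> I01" for s
  proof -
    have s: "s \<in> {0..1}" "0 < s" "s < 1" using that by (auto simp: I01_def)
    have "\<tau> s \<noteq> 0" "\<tau> s \<noteq> 1" using \<sigma>\<tau>[OF s(1)] \<sigma>01 s by auto
    then show ?thesis using \<tau>r[OF s(1)] by (auto simp: I01_def)
  qed
  have \<sigma>I: "\<sigma> t \<in> I01" if "t \<in> I01" for t
    using that mono[of 0 t] mono[of t 1] \<sigma>01 by (auto simp: I01_def)
  have iff: "\<sigma> t \<le> s \<longleftrightarrow> t \<le> \<tau> s" if "t \<in> {0..1}" "s \<in> {0..1}" for t s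
    using mono[of t "\<tau> s"] mono[of "\<tau> s" t] \<sigma>\<tau>[OF that(2)] \<tau>r[OF that(2)] that
    by (cases t "\<tau> s" rule: linorder_cases) auto
  have \<tau>c: "continuous_on {0..1} \<tau>"
    using continuous_on_inv[OF cont] \<tau>\<sigma> im by auto
  have [measurable]: "\<rho> \<in> borel_measurable mu" by (rule is_Linf_measurable[OF \<rho>])
  have [measurable]: "\<sigma> \<in> borel_measurable mu" unfolding \<sigma>_def by (rule prim_measurable[OF \<rho>])
  have \<rho>0: "AE t in mu. 0 \<le> \<rho> t" using kae by eventually_elim (use k in auto)
  define M1 where "M1 = distr (density mu (\<lambda>t. ennreal (\<rho> t))) borel \<sigma>"
  define M2 where "M2 = distr mu borel (\<lambda>t. t)"
  have idm: "(\<lambda>t. t) \<in> borel_measurable mu" by (rule borel_measurable_muI) simp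
  have "M1 = M2"
  \<comment> \<open>Both measures are compared on half-lines to the right. For the pushed measure
    the half-line pulls back to another half-line, because the primitive is strictly
    increasing.\<close>
  proof (rule measure_eqI_lessThan)
    have intind: "integrable mu (\<lambda>t. \<rho> t * indicator {a<..} t)" for a :: real
    proof (rule integrable_Linf[OF is_Linf_mult[OF \<rho>]])
      show "is_Linf (indicator {a<..} :: real \<Rightarrow> real)"
        by (rule is_LinfI[of _ 1]) (auto intro!: borel_measurable_muI simp: indicator_def)
    qed
    have E1: "emeasure M1 {x<..} = ennreal (\<integral>t. \<rho> t * indicator {a<..} t \<partial>mu)"
      if "\<And>t. t \<in> I01 \<Longrightarrow> x < \<sigma> t \<longleftrightarrow> a < t" for x a
    proof -
      have "emeasure M1 {x<..} = (\<integral>\<^sup>+t. ennreal (\<rho> t) * indicator (\<sigma> -` {x<..} \<inter> space mu) t \<partial>mu)"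
        unfolding M1_def using measurable_sets[OF \<open>\<sigma> \<in> borel_measurable mu\<close>, of "{x<..}"]
        by (subst emeasure_distr) (auto intro!: emeasure_density)
      also have "\<dots> = (\<integral>\<^sup>+t. ennreal (\<rho> t * indicator {a<..} t) \<partial>mu)"
        by (intro nn_integral_cong) (use that in \<open>auto simp: indicator_def\<close>)
      also have "\<dots> = ennreal (\<integral>t. \<rho> t * indicator {a<..} t \<partial>mu)"
        by (rule nn_integral_eq_integral[OF intind]) (use \<rho>0 in \<open>auto elim!: eventually_mono\<close>)
      finally show ?thesis .
    qed
    have I: "(\<integral>t. \<rho> t * indicator {a<..} t \<partial>mu) = 1 - \<sigma> a" for a
    proof -
      have "(\<integral>t. \<rho> t * indicator {a<..} t \<partial>mu) = (\<integral>t. \<rho> t - indicator {..a} t *\<^sub>R \<rho> t \<partial>mu)"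
        by (intro Bochner_Integration.integral_cong) (auto simp: indicator_def)
      also have "\<dots> = 1 - \<sigma> a"
        using integrable_Linf[OF \<rho>] integrable_prim[OF \<rho>, of a] one by (simp add: \<sigma>_def prim_def)
      finally show ?thesis .
    qed
    \<comment> \<open>Clamping \<open>x\<close> to the unit interval puts it into the range of the
      primitive, so a single formula covers every real \<open>x\<close>.\<close>
    have M1x: "emeasure M1 {x<..} = ennreal (1 - max 0 (min 1 x))" for x
    proof -
      define a where "a = \<tau> (max 0 (min 1 x))"
      have b: "max 0 (min 1 x) \<in> {0..1}" by auto
      have "x < \<sigma> t \<longleftrightarrow> a < t" if t: "t \<in> I01" for t
        using iff[of t "max 0 (min 1 x)"] \<sigma>I[OF t] t b unfolding a_def I01_def by auto
      from E1[OF this] have "emeasure M1 {x<..} = ennreal (1 - \<sigma> a)" by (simp add: I)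
      then show ?thesis unfolding a_def using \<sigma>\<tau>[OF b] by simp
    qed
    have M2x: "emeasure M2 {x<..} = ennreal (1 - max 0 (min 1 x))" for x
    proof -
      have "emeasure M2 {x<..} = emeasure mu ({x<..} \<inter> I01)"
        unfolding M2_def by (subst emeasure_distr[OF idm]) auto
      also have "\<dots> = emeasure lborel ({x<..} \<inter> I01)"
        unfolding mu_def by (rule emeasure_restrict_space[OF I01_sets]) auto
      also have "{x<..} \<inter> I01 = {max 0 x<..<1}" by (auto simp: I01_def)
      also have "emeasure lborel {max 0 x<..<1} = ennreal (1 - max 0 (min 1 x))"
        by (cases "x \<ge> 1") (auto simp: max_def min_def)
      finally show ?thesis .
    qed
    show "emeasure M1 {x<..} = emeasure M2 {x<..}" for x unfolding M1x M2x ..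
    show "emeasure M1 {x<..} < \<infinity>" for x unfolding M1x by simp
  qed (auto simp: M1_def M2_def)
  show ?thesis
    by (rule that[of \<tau>]) (use \<tau>c \<tau>r \<tau>I \<tau>01 iff \<tau>\<sigma> \<sigma>I \<open>M1 = M2\<close> in \<open>auto simp: \<sigma>_def M1_def M2_def\<close>)
qed

lemma integral_pushforward:
  fixes h :: "real \<Rightarrow> 'a::euclidean_space"
  assumes push: "distr (density mu (\<lambda>t. ennreal (\<rho> t))) borel \<sigma> = distr mu borel (\<lambda>t. t)"
    and [measurable]: "\<rho> \<in> borel_measurable mu" "\<sigma> \<in> borel_measurable mu"
    and \<rho>0: "AE t in mu. 0 \<le> \<rho> t" and \<sigma>I: "\<And>t. t \<in> I01 \<Longrightarrow> \<sigma> t \<in> I01" and h: "h \<in> borel_measurable mu"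
  shows "(\<integral>t. h t \<partial>mu) = (\<integral>t. \<rho> t *\<^sub>R h (\<sigma> t) \<partial>mu)"
proof -
  \<comment> \<open>The two measures live on the whole line, but \<open>h\<close> is only measurable
    on the interval; extension by zero bridges the gap.\<close>
  define h0 where "h0 t = indicator I01 t *\<^sub>R h t" for t
  have idm: "(\<lambda>t. t) \<in> borel_measurable mu" by (rule borel_measurable_muI) simp
  have h0 [measurable]: "h0 \<in> borel_measurable borel"
    using h unfolding mu_def borel_measurable_restrict_space_iff[OF I01_sets] h0_def[abs_def] by simp
  have "(\<integral>t. h t \<partial>mu) = (\<integral>t. h0 t \<partial>mu)" by (intro Bochner_Integration.integral_cong) (auto simp: h0_def)
  also have "\<dots> = (\<integral>t. h0 t \<partial>distr mu borel (\<lambda>t. t))" by (rule integral_distr[OF idm h0, symmetric])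
  also have "\<dots> = (\<integral>t. h0 (\<sigma> t) \<partial>density mu (\<lambda>t. ennreal (\<rho> t)))"
    unfolding push[symmetric] by (rule integral_distr) auto
  also have "\<dots> = (\<integral>t. \<rho> t *\<^sub>R h0 (\<sigma> t) \<partial>mu)"
    by (rule integral_density) (use \<rho>0 in auto)
  also have "\<dots> = (\<integral>t. \<rho> t *\<^sub>R h (\<sigma> t) \<partial>mu)"
    by (intro Bochner_Integration.integral_cong) (auto simp: h0_def \<sigma>I)
  finally show ?thesis .
qed

text \<open>Degree one in the velocity, for nonnegative factors only since the wind breaks the
  symmetry under reversal. This is what makes the travel time independent of the
  parametrisation.\<close>

lemma ff_homogeneous:
  assumes "r \<ge> 0" shows "ff v w x (r *\<^sub>R p) = r * ff v w x p"
proof -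
  have "(r * (p \<bullet> w x))\<^sup>2 + (v\<^sup>2 - w x \<bullet> w x) * (r * (r * (p \<bullet> p))) = r\<^sup>2 * ((p \<bullet> w x)\<^sup>2 + (v\<^sup>2 - w x \<bullet> w x) * (p \<bullet> p))"
    by (simp add: power2_eq_square algebra_simps)
  then show ?thesis unfolding ff_def using assms
    by (simp add: real_sqrt_mult right_diff_distrib)
qed

context flight
begin

lemma ff_measurable_comp:
  assumes "x \<in> borel_measurable M" "p \<in> borel_measurable M"
  shows "(\<lambda>t. ff v w (x t) (p t)) \<in> borel_measurable M"
  using measurable_compose[OF borel_measurable_Pair[OF assms] ffp_measurable] by simp

text \<open>Normalised arc length is the new parameter: speed divided by length is a probability
  density bounded below, its primitive is the new time, and \<tau> inverts it.\<close>

lemma constant_speed_reparametrisation: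
  assumes W: "W1inf \<xi> \<xi>'" and m: "m > 0" "AE t in mu. m \<le> norm (\<xi>' t)"
  obtains b where "feasible (\<xi> 0) (\<xi> 1) b" "TT v w (sxi b) (sdxi b) = TT v w \<xi> \<xi>'"
proof -
  have L: "is_Linf \<xi>" "is_Linf \<xi>'" using W1inf_imp_is_Linf[OF W] by auto
  note meas = L[THEN is_Linf_measurable]
  obtain C where C: "C \<ge> 0" "AE t in mu. norm (\<xi>' t) \<le> C" by (rule is_Linf_bound[OF L(2)])
  define \<Lambda> where "\<Lambda> = (\<integral>t. norm (\<xi>' t) \<partial>mu)"
  have \<Lambda>: "\<Lambda> > 0"
  proof -
    have "(\<integral>t. m \<partial>mu) \<le> \<Lambda>" unfolding \<Lambda>_def
      using m(2) by (intro integral_mono_AE integrable_norm integrable_Linf L is_Linf_const)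
    then show ?thesis using m by simp
  qed
  \<comment> \<open>The density has to be bounded below at every point, while the speed is
    controlled only almost everywhere. On the exceptional null set the density is set to 1 and the
    direction to an arbitrary vector of length \<Lambda>.\<close>
  define good where "good t \<longleftrightarrow> m \<le> norm (\<xi>' t) \<and> norm (\<xi>' t) \<le> C" for t
  have goodAE: "AE t in mu. good t" using m(2) C(2) by eventually_elim (simp add: good_def)
  have [measurable]: "Measurable.pred mu good" unfolding good_def[abs_def] using meas by measurable
  have [measurable]: "\<xi>' \<in> borel_measurable mu" "\<xi> \<in> borel_measurable mu" by (rule meas)+
  define \<rho> where "\<rho> t = (if good t then norm (\<xi>' t) / \<Lambda> else 1)" for t
  obtain u0 :: vec2 where u0: "norm u0 = 1" using vector_choose_size[of 1] by auto
  define n where "n t = (if good t then (\<Lambda> / norm (\<xi>' t)) *\<^sub>R \<xi>' t else \<Lambda> *\<^sub>R u0)" for t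
  have \<rho>m [measurable]: "\<rho> \<in> borel_measurable mu" unfolding \<rho>_def[abs_def] by measurable
  have nm [measurable]: "n \<in> borel_measurable mu" unfolding n_def[abs_def] by measurable
  have nn: "norm (n t) = \<Lambda>" for t using \<Lambda> u0 m by (auto simp: n_def good_def)
  have \<rho>n: "AE t in mu. \<rho> t *\<^sub>R n t = \<xi>' t"
    using goodAE by eventually_elim (use \<Lambda> m in \<open>auto simp: \<rho>_def n_def good_def\<close>)
  define k where "k = min 1 (m / \<Lambda>)"
  have k: "k > 0" "\<And>t. k \<le> \<rho> t" using m \<Lambda> by (auto simp: k_def \<rho>_def good_def divide_right_mono min_le_iff_disj)
  have \<rho>L: "is_Linf \<rho>"
    by (rule is_LinfI[OF \<rho>m, of "max 1 (C / \<Lambda>)"])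
      (use \<Lambda> C in \<open>auto simp: \<rho>_def good_def divide_right_mono le_max_iff_disj\<close>)
  have \<rho>1: "(\<integral>t. \<rho> t \<partial>mu) = 1"
  proof -
    have "(\<integral>t. \<rho> t \<partial>mu) = (\<integral>t. norm (\<xi>' t) / \<Lambda> \<partial>mu)"
    proof (rule integral_cong_AE)
      show "AE t in mu. \<rho> t = norm (\<xi>' t) / \<Lambda>" using goodAE by eventually_elim (simp add: \<rho>_def)
    qed measurable
    also have "\<dots> = \<Lambda> / \<Lambda>" by (simp add: \<Lambda>_def)
    finally show ?thesis using \<Lambda> by simp
  qed
  have k': "k \<le> \<rho> t" if "t \<in> I01" for t using k by simp
  have \<rho>0: "\<rho> t \<ge> 0" for t using k by (meson less_imp_le order_trans)
  obtain \<tau> where \<tau>: "continuous_on {0..1} \<tau>" "\<tau> ` {0..1} \<subseteq> {0..1}" "\<tau> ` I01 \<subseteq> I01" "\<tau> 0 = 0" "\<tau> 1 = 1"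
    "\<forall>t\<in>{0..1}. \<forall>s\<in>{0..1}. prim \<rho> t \<le> s \<longleftrightarrow> t \<le> \<tau> s"
    "\<forall>t\<in>{0..1}. \<tau> (prim \<rho> t) = t" "\<forall>t\<in>I01. prim \<rho> t \<in> I01"
    "distr (density mu (\<lambda>t. ennreal (\<rho> t))) borel (prim \<rho>) = distr mu borel (\<lambda>t. t)"
    by (rule probability_integral_transform[OF \<rho>L k(1) k'(1) \<rho>1])
  note push = integral_pushforward[OF \<tau>(9) \<rho>m prim_measurable[OF \<rho>L] AE_I2[OF \<rho>0] \<tau>(8)[rule_format]]
  have \<tau>m: "\<tau> \<in> measurable mu mu"
  proof -
    have "\<tau> \<in> borel_measurable (restrict_space borel I01)"
      by (rule borel_measurable_continuous_on_restrict, rule continuous_on_subset[OF \<tau>(1)]) (auto simp: I01_def)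
    then have "\<tau> \<in> measurable mu lborel" unfolding mu_def by (simp cong: measurable_cong_sets sets_restrict_space_cong)
    then show ?thesis unfolding mu_def[of] using \<tau>(3)
      by (intro measurable_restrict_space2) (auto simp: space_restrict_space)
  qed
  define \<eta>' where "\<eta>' s = n (\<tau> s)" for s
  define \<eta> where "\<eta> s = \<xi> (\<tau> s)" for s
  have \<eta>'m: "\<eta>' \<in> borel_measurable mu" unfolding \<eta>'_def[abs_def] by (rule measurable_compose[OF \<tau>m nm])
  have \<eta>m: "\<eta> \<in> borel_measurable mu" unfolding \<eta>_def[abs_def] by (rule measurable_compose[OF \<tau>m meas(1)])
  have \<eta>'L: "is_Linf \<eta>'" by (rule is_LinfI[OF \<eta>'m, of \<Lambda>]) (simp add: \<eta>'_def nn)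
  have I01_01: "t \<in> {0..1}" if "t \<in> I01" for t :: real using that by (auto simp: I01_def)
  have "W1inf \<eta> \<eta>'"
    unfolding W1inf_iff
  proof (intro conjI ballI \<eta>'L)
    fix s :: real assume s: "s \<in> {0..1}"
    have \<tau>s: "\<tau> s \<in> {0..1}" using s \<tau>(2) by blast
    \<comment> \<open>The pushforward replaces the chain rule. The condition
      \<open>prim \<rho> t \<le> s\<close> becomes t \<le> \<tau> s, and the density times the
      constant-speed vector is again the old velocity.\<close>
    have "prim \<eta>' s = (\<integral>t. \<rho> t *\<^sub>R (indicator {..s} (prim \<rho> t) *\<^sub>R \<eta>' (prim \<rho> t)) \<partial>mu)"
      unfolding prim_def[of \<eta>']
      by (rule push) (simp, intro is_Linf_measurable is_Linf_scaleR is_Linf_indicator \<eta>'L)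
    also have "\<dots> = (\<integral>t. indicator {..\<tau> s} t *\<^sub>R (\<rho> t *\<^sub>R n t) \<partial>mu)"
    proof (rule Bochner_Integration.integral_cong)
      fix t assume "t \<in> space mu"
      then have t: "t \<in> {0..1}" using I01_01 by simp
      show "\<rho> t *\<^sub>R (indicator {..s} (prim \<rho> t) *\<^sub>R \<eta>' (prim \<rho> t)) = indicator {..\<tau> s} t *\<^sub>R (\<rho> t *\<^sub>R n t)"
        unfolding \<eta>'_def \<tau>(7)[rule_format, OF t] using \<tau>(6)[rule_format, OF t s] by (auto simp: indicator_def)
    qed simp
    also have "\<dots> = prim \<xi>' (\<tau> s)" unfolding prim_def
    proof (rule integral_cong_AE)
      show "AE t in mu. indicator {..\<tau> s} t *\<^sub>R (\<rho> t *\<^sub>R n t) = indicator {..\<tau> s} t *\<^sub>R \<xi>' t"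
        using \<rho>n by eventually_elim simp
      have [measurable]: "(indicator {..\<tau> s} :: real \<Rightarrow> real) \<in> borel_measurable mu"
        by (rule is_Linf_measurable[OF is_Linf_indicator])
      show "(\<lambda>t. indicator {..\<tau> s} t *\<^sub>R (\<rho> t *\<^sub>R n t)) \<in> borel_measurable mu"
        "(\<lambda>t. indicator {..\<tau> s} t *\<^sub>R \<xi>' t) \<in> borel_measurable mu" by measurable
    qed
    finally show "\<eta> s = \<eta> 0 + prim \<eta>' s"
      unfolding \<eta>_def \<tau>(4) using W \<tau>s unfolding W1inf_iff by metis
  qed
  define b where "b = \<lparr>sL = \<Lambda>, sxi = \<eta>, sdxi = \<eta>', slam = (\<lambda>t. 0)\<rparr>"
  have "feasible (\<xi> 0) (\<xi> 1) b"
    unfolding feasible_def AE_mu inZ_def b_def using \<open>W1inf \<eta> \<eta>'\<close> \<tau>(4,5)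
    by (simp add: \<eta>_def \<eta>'_def nn power2_norm_eq_inner[symmetric])
  \<comment> \<open>The density produced by the pushforward is moved into the velocity argument by
    homogeneity, where it restores the original velocity.\<close>
  moreover have "TT v w (sxi b) (sdxi b) = TT v w \<xi> \<xi>'"
  proof -
    have "TT v w (sxi b) (sdxi b) = (\<integral>s. ff v w (\<eta> s) (\<eta>' s) \<partial>mu)"
      unfolding TT_def set_integral_mu b_def by simp
    also have "\<dots> = (\<integral>t. \<rho> t *\<^sub>R ff v w (\<eta> (prim \<rho> t)) (\<eta>' (prim \<rho> t)) \<partial>mu)"
      by (rule push) (simp, rule ff_measurable_comp[OF \<eta>m \<eta>'m])
    also have "\<dots> = (\<integral>t. ff v w (\<xi> t) (\<rho> t *\<^sub>R n t) \<partial>mu)"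
    proof (rule Bochner_Integration.integral_cong)
      fix t assume "t \<in> space mu"
      then have t: "t \<in> {0..1}" using I01_01 by simp
      show "\<rho> t *\<^sub>R ff v w (\<eta> (prim \<rho> t)) (\<eta>' (prim \<rho> t)) = ff v w (\<xi> t) (\<rho> t *\<^sub>R n t)"
        unfolding \<eta>_def \<eta>'_def \<tau>(7)[rule_format, OF t] ff_homogeneous[OF \<rho>0] by simp
    qed simp
    also have "\<dots> = (\<integral>t. ff v w (\<xi> t) (\<xi>' t) \<partial>mu)"
    proof (rule integral_cong_AE)
      show "AE t in mu. ff v w (\<xi> t) (\<rho> t *\<^sub>R n t) = ff v w (\<xi> t) (\<xi>' t)"
        using \<rho>n by eventually_elim simp
    qed (intro ff_measurable_comp, measurable)+
    finally show ?thesis unfolding TT_def set_integral_mu .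
  qed
  ultimately show ?thesis by (rule that)
qed

end

text \<open>The second derivative exists at 0 only, so a second-order Taylor formula with
  intermediate point is out of reach. A negative value would make \<phi>' negative just to the right
  of 0, against minimality.\<close>

lemma second_derivative_nonneg_at_min:
  fixes \<phi> :: "real \<Rightarrow> real"
  assumes "\<delta> > 0" and d: "\<And>s. \<bar>s\<bar> < \<delta> \<Longrightarrow> (\<phi> has_real_derivative \<phi>' s) (at s)"
    and d2: "(\<phi>' has_real_derivative D) (at 0)" and mn: "\<And>s. \<bar>s\<bar> < \<delta> \<Longrightarrow> \<phi> 0 \<le> \<phi> s"
  shows "D \<ge> 0"
proof (rule ccontr)
  assume "\<not> D \<ge> 0"
  then have D: "D < 0" by simp
  have 0: "\<phi>' 0 = 0"
    by (rule DERIV_local_min[OF d[of 0] \<open>\<delta> > 0\<close>]) (use assms in auto)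
  obtain e where e: "e > 0" "\<And>h. 0 < h \<Longrightarrow> h < e \<Longrightarrow> \<phi>' (0 + h) < \<phi>' 0"
    using DERIV_neg_dec_right[OF d2 D] by blast
  define h where "h = min e \<delta> / 2"
  have h: "0 < h" "h < e" "h < \<delta>" using e \<open>\<delta> > 0\<close> by (auto simp: h_def)
  obtain z where z: "0 < z" "z < h" "\<phi> h - \<phi> 0 = (h - 0) * \<phi>' z"
    using MVT2[of 0 h \<phi> \<phi>'] h d by auto
  have "\<phi>' z < 0" using e(2)[of z] z h 0 by simp
  then have "\<phi> h - \<phi> 0 < 0" using z h by (simp add: mult_pos_neg)
  then show False using mn[of h] h by simp
qed

context flight
begin

lemma second_variation_nonneg:
  assumes glob: "global_sol v w xO xD cs" and cs: "bounded_state cs" and K: "AE t in mu. pt cs t \<in> tube X l 0" and l: "l > 0"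
    and d: "indY d"
  shows "(\<integral>t. f2 (pt cs t) (pt d t) (pt d t) \<partial>mu) \<ge> 0"
proof -
  have bd: "bounded_state d" using d indY_imp_bounded_state by blast
  obtain \<delta>1 \<phi>' where P: "\<delta>1 > 0" "\<forall>s. \<bar>s\<bar> < \<delta>1 \<longrightarrow>
      ((\<lambda>s. TT v w (\<lambda>t. sxi cs t + s *\<^sub>R sxi d t) (\<lambda>t. sdxi cs t + s *\<^sub>R sdxi d t)) has_real_derivative \<phi>' s) (at s)"
     "(\<phi>' has_real_derivative (\<integral>t. f2 (pt cs t) (pt d t) (pt d t) \<partial>mu)) (at 0)"
    using TT_second_derivative[OF cs bd K l] by blast
  obtain \<delta>2 r' D where Q: "\<delta>2 > 0" "r' < l" "0 \<le> D" "AE t in mu. norm (pt d t) \<le> D"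
      "AE t in mu. \<forall>s. \<bar>s\<bar> \<le> \<delta>2 \<longrightarrow> pt cs t + s *\<^sub>R pt d t \<in> tube X l r'"
    by (rule AE_perturb[OF bd K l])
  have W: "W1inf (sxi cs) (sdxi cs)" "sxi cs 0 = xO" "sxi cs 1 = xD"
    using glob by (auto simp: global_sol_def feasible_def inZ_def)
  have Wd: "W1inf (sxi d) (sdxi d)" "sxi d 0 = 0" "sxi d 1 = 0" using d by (auto simp: indY_def indZ_def)
  show ?thesis
  proof (rule second_derivative_nonneg_at_min[OF _ _ P(3), where \<delta> = "min \<delta>1 \<delta>2"])
    fix s :: real assume s: "\<bar>s\<bar> < min \<delta>1 \<delta>2"
    let ?x = "\<lambda>t. sxi cs t + s *\<^sub>R sxi d t" and ?x' = "\<lambda>t. sdxi cs t + s *\<^sub>R sdxi d t"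
    have W1: "W1inf ?x ?x'" by (intro W1inf_add W1inf_scaleR W Wd)
    \<comment> \<open>The tube bounds the perturbed speed from below, which is the condition for
      passing to constant speed and hence to a feasible competitor.\<close>
    have "AE t in mu. l - r' \<le> norm (?x' t)"
      using Q(5) by eventually_elim (use s in \<open>auto simp: tube_def pt_def\<close>)
    then obtain b where b: "feasible (?x 0) (?x 1) b" "TT v w (sxi b) (sdxi b) = TT v w ?x ?x'"
      using constant_speed_reparametrisation[OF W1, of "l - r'"] Q(2) by auto
    have "feasible xO xD b" using b(1) W Wd by simp
    then have "TT v w (sxi cs) (sdxi cs) \<le> TT v w ?x ?x'" using glob b(2) unfolding global_sol_def by metis
    then show "TT v w (\<lambda>t. sxi cs t + 0 *\<^sub>R sxi d t) (\<lambda>t. sdxi cs t + 0 *\<^sub>R sdxi d t) \<le> TT v w ?x ?x'" by simp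
  qed (use P(1,2) Q(1) in auto)
qed

end

section \<open>Upper bound for the second variation\<close>

text \<open>A trajectory is a null set in the plane, so an essential bound says nothing about it
  until continuity makes it pointwise. A point of the boundary is moved towards the midpoint of the
  foci: since \<open>ae\<close> exceeds the focal distance this leads at once into the open ellipse,
  where a violation would occur on a nonempty open set.\<close>

lemma ellipse_bound_everywhere:
  fixes g :: "vec2 \<Rightarrow> real"
  assumes "ae > dist xO xD" and \<Omega>: "\<Omega> = {x. dist x xO + dist x xD \<le> ae}"
    and g: "continuous_on UNIV g" and AE: "Linf_bound_on \<Omega> g C" and x: "x \<in> \<Omega>"
  shows "g x \<le> C"
proof (rule ccontr)
  assume "\<not> g x \<le> C"
  then have gx: "g x > C" by simp
  define V where "V = {y. dist y xO + dist y xD < ae} \<inter> {y. g y > C}"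
  have "open V" unfolding V_def
    by (intro open_Int open_Collect_less continuous_intros g)
  have "((\<lambda>s. g (x + s *\<^sub>R (midpoint xO xD - x))) \<longlongrightarrow> g (x + 0 *\<^sub>R (midpoint xO xD - x))) (at_right 0)"
    by (rule isCont_tendsto_compose[of _ g], use g in \<open>simp add: continuous_on_eq_continuous_at\<close>,
        intro tendsto_intros)
  then have "\<forall>\<^sub>F s in at_right 0. g (x + s *\<^sub>R (midpoint xO xD - x)) > C"
    using gx by (auto dest: order_tendstoD(1))
  moreover have "\<forall>\<^sub>F s in at_right (0::real). s < 1"
    using order_tendstoD(2)[of "\<lambda>s::real. s" 0 "at_right 0" 1] by (simp add: tendsto_ident_at)
  moreover have "\<forall>\<^sub>F s in at_right (0::real). 0 < s" by (rule eventually_at_right_less)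
  ultimately have "\<forall>\<^sub>F s in at_right (0::real). g (x + s *\<^sub>R (midpoint xO xD - x)) > C \<and> 0 < s \<and> s < 1"
    by eventually_elim auto
  then obtain s where s: "g (x + s *\<^sub>R (midpoint xO xD - x)) > C" "0 < s" "s < 1"
    using eventually_happens'[of "at_right (0::real)"] by force
  define y where "y = x + s *\<^sub>R (midpoint xO xD - x)"
  have conv: "dist y z \<le> (1 - s) * dist x z + s * dist (midpoint xO xD) z" for z
  proof -
    have "y - z = (1 - s) *\<^sub>R (x - z) + s *\<^sub>R (midpoint xO xD - z)" by (simp add: y_def algebra_simps)
    then have "norm (y - z) \<le> (1 - s) * norm (x - z) + s * norm (midpoint xO xD - z)"
      using norm_triangle_ineq[of "(1 - s) *\<^sub>R (x - z)" "s *\<^sub>R (midpoint xO xD - z)"] s by simp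
    then show ?thesis by (simp add: dist_norm)
  qed
  have "dist y xO + dist y xD \<le> (1 - s) * (dist x xO + dist x xD) + s * (dist (midpoint xO xD) xO + dist (midpoint xO xD) xD)"
    using conv[of xO] conv[of xD] by (simp add: algebra_simps)
  also have "dist (midpoint xO xD) xO + dist (midpoint xO xD) xD = dist xO xD"
    by (simp add: dist_midpoint)
  also have "(1 - s) * (dist x xO + dist x xD) + s * dist xO xD < (1 - s) * ae + s * ae"
    using s x assms(1) by (intro add_le_less_mono mult_left_mono mult_strict_left_mono) (auto simp: \<Omega>)
  finally have "y \<in> V" using s by (simp add: V_def y_def algebra_simps)
  have "AE z in lebesgue. z \<notin> V"
    using AE unfolding Linf_bound_on_def by eventually_elim (auto simp: V_def \<Omega>)
  then have "V \<in> null_sets lebesgue"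
    using AE_iff_null_sets[of V lebesgue] sets_completionI_sets[of V lborel] \<open>open V\<close> by simp
  then have "negligible V" by (simp add: negligible_iff_null_sets)
  then show False using open_not_negligible[OF \<open>open V\<close>] \<open>y \<in> V\<close> by auto
qed

text \<open>The quantities \<open>nD1\<close> and \<open>nD2\<close> are Frobenius norms; this is
  their domination of the operator norm, used once for the first derivative and twice for the
  second.\<close>

lemma linear_norm_le_frobenius:
  fixes l :: "'a::euclidean_space \<Rightarrow> 'b::real_normed_vector"
  assumes "linear l"
  shows "norm (l a) \<le> sqrt (\<Sum>b\<in>Basis. (norm (l b))\<^sup>2) * norm a"
proof -
  have "l a = l (\<Sum>b\<in>Basis. (a \<bullet> b) *\<^sub>R b)" by (simp add: euclidean_representation)
  also have "\<dots> = (\<Sum>b\<in>Basis. (a \<bullet> b) *\<^sub>R l b)"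
    by (simp add: linear_sum[OF assms] linear_scale[OF assms])
  also have "norm \<dots> \<le> (\<Sum>b\<in>Basis. \<bar>a \<bullet> b\<bar> * \<bar>norm (l b)\<bar>)"
    by (rule sum_norm_le) simp
  also have "\<dots> \<le> L2_set (\<lambda>b. a \<bullet> b) Basis * L2_set (\<lambda>b. norm (l b)) Basis"
    by (rule L2_set_mult_ineq)
  also have "L2_set (\<lambda>b. a \<bullet> b) Basis = norm a"
    unfolding L2_set_def by (simp add: norm_eq_sqrt_inner euclidean_inner[of a a] power2_eq_square)
  finally show ?thesis by (simp add: L2_set_def mult.commute)
qed

lemma norm_D1_le: "C3 w \<Longrightarrow> norm (D1 w x a) \<le> nD1 w x * norm a"
  unfolding nD1_def by (rule linear_norm_le_frobenius[OF has_derivative_linear[OF C3_has_derivative_D1]])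

lemma linear_D2_left:
  assumes "C3 w" shows "linear (\<lambda>a. D2 w x a b)"
proof (rule linearI)
  note l = has_derivative_linear[OF C3_has_derivative_D1[OF assms]]
  fix a a' r
  have "((\<lambda>y. D1 w y (a + a')) has_derivative (\<lambda>b. D2 w x a b + D2 w x a' b)) (at x)"
    unfolding linear_add[OF l] by (intro has_derivative_add C3_has_derivative_D2 assms)
  from has_derivative_unique[OF this C3_has_derivative_D2[OF assms]] show "D2 w x (a + a') b = D2 w x a b + D2 w x a' b" by metis
  have "((\<lambda>y. D1 w y (r *\<^sub>R a)) has_derivative (\<lambda>b. r *\<^sub>R D2 w x a b)) (at x)"
    unfolding linear_scale[OF l] by (intro has_derivative_scaleR_right C3_has_derivative_D2 assms)
  from has_derivative_unique[OF this C3_has_derivative_D2[OF assms]] show "D2 w x (r *\<^sub>R a) b = r *\<^sub>R D2 w x a b" by metis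
qed

lemma norm_D2_le:
  assumes "C3 w" shows "norm (D2 w x a b) \<le> nD2 w x * norm a * norm b"
proof -
  have "(\<Sum>c\<in>Basis. (norm (D2 w x a c))\<^sup>2) \<le> (\<Sum>c\<in>Basis. (\<Sum>b\<in>Basis. (norm (D2 w x b c))\<^sup>2) * (norm a)\<^sup>2)"
  proof (rule sum_mono)
    fix c
    have "(norm (D2 w x a c))\<^sup>2 \<le> (sqrt (\<Sum>b\<in>Basis. (norm (D2 w x b c))\<^sup>2) * norm a)\<^sup>2"
      by (intro power_mono linear_norm_le_frobenius[OF linear_D2_left[OF assms]]) auto
    then show "(norm (D2 w x a c))\<^sup>2 \<le> (\<Sum>b\<in>Basis. (norm (D2 w x b c))\<^sup>2) * (norm a)\<^sup>2"
      by (simp add: power_mult_distrib sum_nonneg)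
  qed
  also have "\<dots> = (\<Sum>c\<in>Basis. \<Sum>b\<in>Basis. (norm (D2 w x b c))\<^sup>2) * (norm a)\<^sup>2"
    by (rule sum_distrib_right[symmetric])
  also have "(\<Sum>c\<in>Basis. \<Sum>b\<in>Basis. (norm (D2 w x b c))\<^sup>2) = (\<Sum>b\<in>Basis. \<Sum>c\<in>Basis. (norm (D2 w x b c))\<^sup>2)"
    by (rule sum.swap)
  also have "\<dots> * (norm a)\<^sup>2 = (nD2 w x * norm a)\<^sup>2"
    unfolding nD2_def by (simp add: power_mult_distrib sum_nonneg)
  finally have "sqrt (\<Sum>c\<in>Basis. (norm (D2 w x a c))\<^sup>2) \<le> nD2 w x * norm a"
    by (intro real_le_lsqrt) (auto simp: sum_nonneg nD2_def)
  then show ?thesis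
    using linear_norm_le_frobenius[OF has_derivative_linear[OF C3_has_derivative_D2[OF assms]], of x a b]
    by (meson mult_right_mono norm_ge_zero order_trans)
qed

lemma continuous_nD1: "C3 w \<Longrightarrow> continuous_on UNIV (nD1 w)"
  unfolding nD1_def[abs_def]
  by (intro continuous_intros continuous_at_imp_continuous_on ballI has_derivative_continuous[OF C3_has_derivative_D2])

lemma continuous_nD2: "C3 w \<Longrightarrow> continuous_on UNIV (nD2 w)"
  unfolding nD2_def[abs_def]
  by (intro continuous_intros continuous_at_imp_continuous_on ballI has_derivative_continuous[OF C3_has_derivative_D3])

section \<open>The implicit equation of the integrand and its consequences\<close>

lemma ff_nonneg:
  assumes "v\<^sup>2 - w x \<bullet> w x > 0" shows "ff v w x p \<ge> 0"
proof -
  have "sqrt ((p \<bullet> w x)\<^sup>2) \<le> sqrt ((p \<bullet> w x)\<^sup>2 + (v\<^sup>2 - w x \<bullet> w x) * (p \<bullet> p))"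
    using assms by (intro real_sqrt_le_mono) simp
  then show ?thesis unfolding ff_def using assms by simp
qed

text \<open>With A = v^2 - w . w and B = p . w, the integrand is the nonnegative root of A F^2 + 2 B
  F = p . p. Physically, the displacement \<open>p\<close> minus the drift F w is flown at airspeed
  \<open>v\<close> in time F.\<close>

lemma ff_implicit:
  assumes "v\<^sup>2 - w x \<bullet> w x > 0"
  shows "(p - ff v w x p *\<^sub>R w x) \<bullet> (p - ff v w x p *\<^sub>R w x) = v\<^sup>2 * (ff v w x p)\<^sup>2"
proof -
  define A where "A = v\<^sup>2 - w x \<bullet> w x"
  define B where "B = p \<bullet> w x"
  define F where "F = ff v w x p"
  have A: "A > 0" using assms by (simp add: A_def)
  have "A * F + B = sqrt (B\<^sup>2 + A * (p \<bullet> p))"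
    unfolding F_def ff_def A_def[symmetric] B_def[symmetric] using A by simp
  then have "(A * F + B)\<^sup>2 = B\<^sup>2 + A * (p \<bullet> p)" using A by simp
  then have "A * (A * F\<^sup>2 + 2 * B * F) = A * (p \<bullet> p)" by (simp add: power2_eq_square algebra_simps)
  then have "A * F\<^sup>2 + 2 * B * F = p \<bullet> p" using A by simp
  then show ?thesis unfolding F_def[symmetric]
    by (simp add: A_def B_def inner_diff_left inner_diff_right inner_commute power2_eq_square algebra_simps)
qed

lemma ff_norm:
  assumes "norm (w x) < v"
  shows "norm (p - ff v w x p *\<^sub>R w x) = v * ff v w x p"
proof -
  have pos: "v\<^sup>2 - w x \<bullet> w x > 0" by (rule norm_lt_imp_inner_pos[OF assms])
  have v: "v > 0" using assms norm_ge_zero[of "w x"] by linarith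
  have "(norm (p - ff v w x p *\<^sub>R w x))\<^sup>2 = (v * ff v w x p)\<^sup>2"
    using ff_implicit[of v w x p, OF pos] by (simp add: power2_norm_eq_inner power_mult_distrib)
  then show ?thesis using v ff_nonneg[of v w x p, OF pos] by (simp add: power2_eq_iff_nonneg)
qed

text \<open>The triangle inequality in \<open>ff_norm\<close>: pure tail wind corresponds to v + c0,
  pure head wind to v - c0.\<close>

lemma ff_bounds:
  assumes "norm (w x) < v" "norm (w x) \<le> c0" "c0 < v"
  shows "norm p / (v + c0) \<le> ff v w x p" "ff v w x p \<le> norm p / (v - c0)"
proof -
  define F where "F = ff v w x p"
  have F: "F \<ge> 0" unfolding F_def by (rule ff_nonneg[of v w x, OF norm_lt_imp_inner_pos[OF assms(1)]])
  have n: "norm (p - F *\<^sub>R w x) = v * F" unfolding F_def by (rule ff_norm[of w x, OF assms(1)])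
  have Fw: "norm (F *\<^sub>R w x) \<le> F * c0" using F assms by (simp add: mult_left_mono)
  have c0: "c0 \<ge> 0" using assms(2) norm_ge_zero order_trans by blast
  have "norm p \<le> v * F + F * c0" using norm_triangle_ineq[of "p - F *\<^sub>R w x" "F *\<^sub>R w x"] n Fw by simp
  then show "norm p / (v + c0) \<le> ff v w x p" unfolding F_def[symmetric] using c0 assms by (simp add: field_simps)
  have "v * F \<le> norm p + F * c0" using norm_triangle_ineq4[of p "F *\<^sub>R w x"] n Fw by simp
  then show "ff v w x p \<le> norm p / (v - c0)" unfolding F_def[symmetric] using assms by (simp add: field_simps)
qed

lemma has_vector_derivative_directional:
  fixes g :: "'a::real_normed_vector \<Rightarrow> 'b::real_normed_vector"
  assumes "(g has_derivative g') (at (y + s *\<^sub>R h))"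
  shows "((\<lambda>r. g (y + r *\<^sub>R h)) has_vector_derivative g' h) (at s)"
proof -
  have 1: "((\<lambda>r. y + r *\<^sub>R h) has_derivative (\<lambda>r. r *\<^sub>R h)) (at s)"
    by (auto intro!: derivative_eq_intros)
  have "((\<lambda>r. g (y + r *\<^sub>R h)) has_derivative (\<lambda>r. g' (r *\<^sub>R h))) (at s)"
    using has_derivative_compose[OF 1 assms] .
  then show ?thesis unfolding has_vector_derivative_def
    by (simp add: linear_scale[OF has_derivative_linear[OF assms]])
qed

lemma has_real_derivative_inner:
  fixes q r :: "real \<Rightarrow> 'a::real_inner"
  assumes "(q has_vector_derivative q') (at s)" "(r has_vector_derivative r') (at s)"
  shows "((\<lambda>s. q s \<bullet> r s) has_real_derivative (q s \<bullet> r' + q' \<bullet> r s)) (at s)"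
  using bounded_bilinear.has_vector_derivative[OF bounded_bilinear_inner assms]
  by (simp add: has_real_derivative_iff_has_vector_derivative)

text \<open>For the travel time \<open>F\<close> the vector \<open>q = p - F w\<close> satisfies \<open>norm q = v F\<close>; the equational
  hypotheses are this identity and its first two derivatives along a line.\<close>

lemma implicit_second_derivative_bound:
  fixes p q q' b w w' w'' :: "'a::real_inner" and F F' F'' v c0 c1 c2 a :: real
  assumes q: "q = p - F *\<^sub>R w" and q': "q' = b - F' *\<^sub>R w - F *\<^sub>R w'"
    and e0: "norm q = v * F" and e1: "q \<bullet> q' = v\<^sup>2 * (F * F')"
    and e2: "q' \<bullet> q' + q \<bullet> (- F'' *\<^sub>R w - (2 * F') *\<^sub>R w' - F *\<^sub>R w'') = v\<^sup>2 * (F'\<^sup>2 + F * F'')"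
    and F: "F > 0" and v: "v > 0" and c0: "norm w \<le> c0" "c0 \<le> v / sqrt 5"
    and c1: "norm w' \<le> c1 * a" and c2: "norm w'' \<le> c2 * a\<^sup>2" and nn: "c1 \<ge> 0" "c2 \<ge> 0" "a \<ge> 0"
  defines "V \<equiv> sqrt (v\<^sup>2 - c0\<^sup>2)"
  shows "F'' \<le> norm p * (14 * c1\<^sup>2 / V ^ 3 + 4 * c2 / V\<^sup>2) * a\<^sup>2 + 2 * (7 * c1 / V\<^sup>2) * a * norm b
     + 2 / V / norm p * (norm b)\<^sup>2"
proof -
  have c0n: "c0 \<ge> 0" using c0(1) norm_ge_zero order_trans by blast
  \<comment> \<open>A decimal upper bound for 1 / sqrt 5, which is about 0.4472; all numerical
    margins of this proof are taken relative to it.\<close>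
  have c0': "c0 \<le> 0.4475 * v"
  proof -
    have "2.235 \<le> sqrt 5" by (rule real_le_rsqrt) (simp add: power2_eq_square)
    then have "v / sqrt 5 \<le> v / 2.235" using v by (intro divide_left_mono) auto
    then show ?thesis using c0(2) v by simp
  qed
  have c0v: "c0 < v" using c0' v by simp
  have V2: "V\<^sup>2 = v\<^sup>2 - c0\<^sup>2" unfolding V_def using c0v c0n by (simp add: power_mono)
  have Vpos: "V > 0" unfolding V_def using c0v c0n by (simp add: power_strict_mono)
  \<comment> \<open>The unit vector \<open>n\<close> is the heading through the air. Its product
    with the wind is \<open>wn\<close>, and \<open>m\<close> is the resulting ground speed along the
    heading.\<close>
  define n where "n = (1 / (v * F)) *\<^sub>R q"
  have vF: "v * F > 0" using v F by simp
  have qn: "q = (v * F) *\<^sub>R n" using v F by (simp add: n_def)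
  have nn1: "norm n = 1" using e0 v F by (simp add: n_def)
  have nin: "n \<bullet> n = 1" using nn1 by (simp add: norm_eq_1)
  define wn where "wn = n \<bullet> w"
  define m where "m = v + wn"
  have wnb: "\<bar>wn\<bar> \<le> c0" unfolding wn_def using Cauchy_Schwarz_ineq2[of n w] nn1 c0(1) by simp
  have m: "m \<ge> v - c0" using wnb by (simp add: m_def)
  have mpos: "m > 0" using m c0v by simp
  define r where "r = b - F *\<^sub>R w'"
  have nq': "n \<bullet> q' = v * F'"
  proof -
    have "(v * F) * (n \<bullet> q') = (v * F) * (v * F')" using e1 unfolding qn by (simp add: power2_eq_square mult_ac)
    then show ?thesis using v F by simp
  qed
  have F'm: "F' * m = n \<bullet> r"
    using nq' unfolding q' r_def m_def wn_def by (simp add: inner_diff_right algebra_simps)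
  have F'b: "\<bar>F'\<bar> \<le> norm r / m"
  proof -
    have "\<bar>F'\<bar> * m = \<bar>n \<bullet> r\<bar>" using F'm mpos by (metis abs_mult abs_of_pos)
    also have "\<dots> \<le> norm r" using Cauchy_Schwarz_ineq2[of n r] nn1 by simp
    finally show ?thesis using mpos by (simp add: field_simps)
  qed
  have perp: "(norm (x - (n \<bullet> x) *\<^sub>R n))\<^sup>2 = x \<bullet> x - (n \<bullet> x)\<^sup>2" for x
    unfolding power2_norm_eq_inner
    by (simp add: inner_diff_left inner_diff_right nin inner_commute power2_eq_square algebra_simps)
  define wp where "wp = norm (w - wn *\<^sub>R n)"
  have wp2: "wp\<^sup>2 = w \<bullet> w - wn\<^sup>2" unfolding wp_def wn_def by (rule perp)
  \<comment> \<open>The gap is the square of c0^2 + v wn. Estimating the cross wind by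
    \<open>c0\<close> and the speed \<open>m\<close> by v - c0 separately would give a larger
    factor, since both extremes cannot occur together.\<close>
  have wpm: "wp\<^sup>2 * V\<^sup>2 \<le> c0\<^sup>2 * m\<^sup>2"
  proof -
    have "w \<bullet> w \<le> c0\<^sup>2" using power_mono[OF c0(1), of 2] by (simp add: power2_norm_eq_inner)
    then have "wp\<^sup>2 * V\<^sup>2 \<le> (c0\<^sup>2 - wn\<^sup>2) * V\<^sup>2" unfolding wp2 by (intro mult_right_mono) auto
    also have "\<dots> \<le> c0\<^sup>2 * m\<^sup>2"
    proof -
      have "c0\<^sup>2 * m\<^sup>2 - (c0\<^sup>2 - wn\<^sup>2) * V\<^sup>2 = (c0\<^sup>2 + v * wn)\<^sup>2"
        unfolding V2 m_def by (simp add: power2_eq_square algebra_simps)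
      then show ?thesis using zero_le_power2[of "c0\<^sup>2 + v * wn"] by linarith
    qed
    finally show ?thesis .
  qed
  have fac: "1 + (wp / m)\<^sup>2 \<le> v\<^sup>2 / V\<^sup>2"
  proof -
    have "(wp / m)\<^sup>2 \<le> c0\<^sup>2 / V\<^sup>2" using wpm mpos Vpos by (simp add: power_divide field_simps)
    moreover have "1 + c0\<^sup>2 / V\<^sup>2 = v\<^sup>2 / V\<^sup>2" using Vpos V2 by (simp add: field_simps)
    ultimately show ?thesis by linarith
  qed
  \<comment> \<open>The component of q' along \<open>n\<close> cancels against v^2 F'^2, so only the
    orthogonal part matters. As F' = (n . r) / m, Cauchy-Schwarz for pairs merges both components of
    \<open>r\<close> into its norm, with the factor 1 + (wp / m)^2.\<close>
  have T: "q' \<bullet> q' - (n \<bullet> q')\<^sup>2 \<le> (norm r)\<^sup>2 * (v\<^sup>2 / V\<^sup>2)"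
  proof -
    have eq: "q' - (n \<bullet> q') *\<^sub>R n = (r - (n \<bullet> r) *\<^sub>R n) - F' *\<^sub>R (w - wn *\<^sub>R n)"
      unfolding q' r_def wn_def by (simp add: inner_diff_right algebra_simps)
    define rp where "rp = norm (r - (n \<bullet> r) *\<^sub>R n)"
    have rp2: "rp\<^sup>2 + (n \<bullet> r)\<^sup>2 = (norm r)\<^sup>2" unfolding rp_def perp by (simp add: power2_norm_eq_inner)
    have "norm (q' - (n \<bullet> q') *\<^sub>R n) \<le> rp + \<bar>F'\<bar> * wp"
      unfolding eq rp_def wp_def using norm_triangle_ineq4[of "r - (n \<bullet> r) *\<^sub>R n" "F' *\<^sub>R (w - wn *\<^sub>R n)"] by simp
    also have "\<dots> = rp * 1 + \<bar>n \<bullet> r\<bar> * (wp / m)"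
    proof -
      have "\<bar>F'\<bar> = \<bar>n \<bullet> r\<bar> / m" using F'm mpos by (metis abs_mult abs_of_pos nonzero_eq_divide_eq less_irrefl)
      then show ?thesis by simp
    qed
    finally have "(norm (q' - (n \<bullet> q') *\<^sub>R n))\<^sup>2 \<le> (rp * 1 + \<bar>n \<bullet> r\<bar> * (wp / m))\<^sup>2"
      by (intro power_mono) auto
    also have "\<dots> \<le> (rp\<^sup>2 + (n \<bullet> r)\<^sup>2) * (1 + (wp / m)\<^sup>2)"
    proof -
      have "(rp\<^sup>2 + (n \<bullet> r)\<^sup>2) * (1 + (wp / m)\<^sup>2) - (rp * 1 + \<bar>n \<bullet> r\<bar> * (wp / m))\<^sup>2 = (rp * (wp / m) - \<bar>n \<bullet> r\<bar>)\<^sup>2"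
        by (simp add: power2_eq_square algebra_simps)
      then show ?thesis using zero_le_power2[of "rp * (wp / m) - \<bar>n \<bullet> r\<bar>"] by linarith
    qed
    also have "\<dots> \<le> (norm r)\<^sup>2 * (v\<^sup>2 / V\<^sup>2)" unfolding rp2 using fac by (intro mult_left_mono) auto
    finally show ?thesis unfolding perp .
  qed
  define k where "k = norm p"
  have pq: "p = F *\<^sub>R (v *\<^sub>R n + w)"
  proof -
    have "p = q + F *\<^sub>R w" using q by simp
    then show ?thesis unfolding qn by (simp add: algebra_simps)
  qed
  have Fmk: "F * m \<le> k"
  proof -
    have "n \<bullet> p = F * m" unfolding pq m_def wn_def by (simp add: inner_add_right nin algebra_simps)
    then show ?thesis using Cauchy_Schwarz_ineq2[of n p] nn1 by (simp add: k_def)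
  qed
  have kpos: "k > 0" using Fmk F mpos by (meson less_le_trans mult_pos_pos)
  \<comment> \<open>The reverse of \<open>Fmk\<close> up to the factor v / V; the same cross wind
    estimate bounds \<open>p\<close> by its component along the heading.\<close>
  have kFm: "k * V \<le> v * (F * m)"
  proof (rule power2_le_imp_le)
    have "k\<^sup>2 = F\<^sup>2 * ((v *\<^sub>R n + w) \<bullet> (v *\<^sub>R n + w))"
      unfolding k_def power2_norm_eq_inner unfolding pq inner_scaleR_left inner_scaleR_right by (simp add: power2_eq_square)
    also have "(v *\<^sub>R n + w) \<bullet> (v *\<^sub>R n + w) = m\<^sup>2 + wp\<^sup>2"
      unfolding wp2 m_def wn_def by (simp add: inner_add_left inner_add_right nin inner_commute power2_eq_square algebra_simps)
    finally have "(k * V)\<^sup>2 = F\<^sup>2 * (m\<^sup>2 * V\<^sup>2 + wp\<^sup>2 * V\<^sup>2)" by (simp add: power_mult_distrib algebra_simps)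
    also have "\<dots> \<le> F\<^sup>2 * (m\<^sup>2 * V\<^sup>2 + c0\<^sup>2 * m\<^sup>2)" using wpm by (intro mult_left_mono) auto
    also have "\<dots> = (v * (F * m))\<^sup>2" unfolding V2 by (simp add: power2_eq_square algebra_simps)
    finally show "(k * V)\<^sup>2 \<le> (v * (F * m))\<^sup>2" .
  qed (use v F mpos in auto)
  define B where "B = norm b"
  have rb: "norm r \<le> B + F * c1 * a"
  proof -
    have "norm r \<le> norm b + F * norm w'" unfolding r_def using norm_triangle_ineq4[of b "F *\<^sub>R w'"] F by simp
    also have "\<dots> \<le> B + F * (c1 * a)" unfolding B_def using c1 F by (intro add_left_mono mult_left_mono) auto
    finally show ?thesis by (simp add: mult.assoc)
  qed
  define \<rho> where "\<rho> = B + F * c1 * a"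
  have \<rho>0: "\<rho> \<ge> 0" using rb norm_ge_zero[of r] unfolding \<rho>_def by linarith
  have main: "F'' * (v * F * m) \<le> \<rho>\<^sup>2 * (v\<^sup>2 / V\<^sup>2) + 2 * (\<rho> / m) * (v * F) * (c1 * a) + F * (v * F) * (c2 * a\<^sup>2)"
  proof -
    have "F'' * (v * F * m) = q' \<bullet> q' - (n \<bullet> q')\<^sup>2 - 2 * F' * (v * F) * (n \<bullet> w') - F * (v * F) * (n \<bullet> w'')"
      using e2 unfolding nq' qn m_def wn_def
      by (simp add: inner_diff_right power2_eq_square algebra_simps)
    moreover have "q' \<bullet> q' - (n \<bullet> q')\<^sup>2 \<le> \<rho>\<^sup>2 * (v\<^sup>2 / V\<^sup>2)"
    proof -
      have "(norm r)\<^sup>2 \<le> \<rho>\<^sup>2" using rb unfolding \<rho>_def by (intro power_mono) auto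
      then have "(norm r)\<^sup>2 * (v\<^sup>2 / V\<^sup>2) \<le> \<rho>\<^sup>2 * (v\<^sup>2 / V\<^sup>2)" by (intro mult_right_mono) auto
      then show ?thesis using T by linarith
    qed
    moreover have "- (2 * F' * (v * F) * (n \<bullet> w')) \<le> 2 * (\<rho> / m) * (v * F) * (c1 * a)"
    proof -
      have "\<bar>n \<bullet> w'\<bar> \<le> c1 * a" using Cauchy_Schwarz_ineq2[of n w'] nn1 c1 by simp
      moreover have "\<bar>F'\<bar> \<le> \<rho> / m" using F'b rb mpos unfolding \<rho>_def by (meson divide_right_mono less_imp_le order_trans)
      ultimately have "\<bar>F'\<bar> * \<bar>n \<bullet> w'\<bar> \<le> (\<rho> / m) * (c1 * a)" using \<rho>0 mpos by (intro mult_mono) auto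
      then have "(2 * (v * F)) * (\<bar>F'\<bar> * \<bar>n \<bullet> w'\<bar>) \<le> (2 * (v * F)) * ((\<rho> / m) * (c1 * a))" using vF by (intro mult_left_mono) auto
      moreover have "- (2 * F' * (v * F) * (n \<bullet> w')) \<le> (2 * (v * F)) * (\<bar>F'\<bar> * \<bar>n \<bullet> w'\<bar>)"
      proof -
        have "- (F' * (n \<bullet> w')) \<le> \<bar>F'\<bar> * \<bar>n \<bullet> w'\<bar>" by (metis abs_ge_minus_self abs_mult)
        then have "(2 * (v * F)) * (- (F' * (n \<bullet> w'))) \<le> (2 * (v * F)) * (\<bar>F'\<bar> * \<bar>n \<bullet> w'\<bar>)" using vF by (intro mult_left_mono) auto
        then show ?thesis by (simp add: mult_ac)
      qed
      ultimately show ?thesis by (simp add: mult_ac)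
    qed
    moreover have "- (F * (v * F) * (n \<bullet> w'')) \<le> F * (v * F) * (c2 * a\<^sup>2)"
    proof -
      have "- (n \<bullet> w'') \<le> c2 * a\<^sup>2" using Cauchy_Schwarz_ineq2[of n w''] nn1 c2 by simp
      then have "F * (v * F) * (- (n \<bullet> w'')) \<le> F * (v * F) * (c2 * a\<^sup>2)" using F vF by (intro mult_left_mono) auto
      then show ?thesis by simp
    qed
    ultimately show ?thesis by linarith
  qed
  \<comment> \<open>From c0 \<le> 0.4475 v one gets v / (v - c0) \<le> 1.82, and (v + c0) / (v - c0)
    \<le> 1.65^2 = 2.7225 for the bound on \<open>V\<close>.\<close>
  have vm: "v \<le> 1.82 * m" using m c0' v by simp
  have Vm: "V \<le> 1.65 * m"
  proof (rule power2_le_imp_le)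
    have "V\<^sup>2 = (v - c0) * (v + c0)" unfolding V2 by (simp add: power2_eq_square algebra_simps)
    also have "\<dots> \<le> (v - c0) * (2.7225 * (v - c0))" using c0v c0' by (intro mult_left_mono) auto
    also have "\<dots> = (1.65 * (v - c0))\<^sup>2" by (simp add: power2_eq_square algebra_simps)
    also have "\<dots> \<le> (1.65 * m)\<^sup>2" using m c0v by (intro power_mono) auto
    finally show "V\<^sup>2 \<le> (1.65 * m)\<^sup>2" .
  qed (use mpos in auto)
  have vV: "v\<^sup>2 \<le> 2 * V\<^sup>2"
  proof -
    have "c0\<^sup>2 \<le> (0.4475 * v)\<^sup>2" using c0n c0' by (intro power_mono) auto
    moreover have "(0.4475 * v)\<^sup>2 \<le> v\<^sup>2 / 2" by (simp add: power_mult_distrib power2_eq_square)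
    ultimately have "c0\<^sup>2 \<le> v\<^sup>2 / 2" by (rule order_trans)
    then show ?thesis unfolding V2 by simp
  qed
  have "F'' \<le> (\<rho>\<^sup>2 * (v\<^sup>2 / V\<^sup>2) + 2 * (\<rho> / m) * (v * F) * (c1 * a) + F * (v * F) * (c2 * a\<^sup>2)) / (v * F * m)"
    using main vF mpos by (simp add: pos_le_divide_eq)
  also have "\<dots> = B\<^sup>2 * (v / (V\<^sup>2 * (F * m))) + 2 * (c1 * a * B) * (v / (V\<^sup>2 * m) + 1 / m\<^sup>2)
      + a\<^sup>2 * (c1\<^sup>2 * (F * v / (V\<^sup>2 * m) + 2 * F / m\<^sup>2) + c2 * (F / m))"
    unfolding \<rho>_def using v F mpos Vpos by (simp add: field_simps power2_eq_square)
  \<comment> \<open>The terms are compared coefficient by coefficient. In units of \<open>m\<close>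
    they need 1.82 + 2.7225 against 7, 2.7225 against 4, and 1.82 * 1.65 + 2 * 1.65^3, which is just
    below 12, against 14. The last coefficient is kept at 2 / V, half of the constant in
    \<open>Bbar\<close>, because that slack is spent later.\<close>
  also have "\<dots> \<le> B\<^sup>2 * (2 / V / k) + 2 * (c1 * a * B) * (7 / V\<^sup>2) + a\<^sup>2 * (c1\<^sup>2 * (14 * k / V ^ 3) + c2 * (4 * k / V\<^sup>2))"
  proof (intro add_mono mult_left_mono)
    have "(v * k) * V \<le> v * (v * (F * m))" using mult_left_mono[OF kFm, of v] v by (simp add: mult_ac)
    also have "\<dots> = v\<^sup>2 * (F * m)" by (simp add: power2_eq_square)
    also have "\<dots> \<le> 2 * V\<^sup>2 * (F * m)" using vV F mpos by (intro mult_right_mono) auto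
    finally have "v * k * V \<le> 2 * V\<^sup>2 * (F * m)" .
    then show "v / (V\<^sup>2 * (F * m)) \<le> 2 / V / k" using Vpos kpos F mpos by (simp add: field_simps power2_eq_square)
    have V2m: "V\<^sup>2 \<le> 2.7225 * m\<^sup>2" using power_mono[OF Vm, of 2] Vpos by (simp add: power2_eq_square)
    have "v * m \<le> 1.82 * m * m" using vm mpos by (intro mult_right_mono) auto
    also have "\<dots> = 1.82 * m\<^sup>2" by (simp add: power2_eq_square)
    finally have "v * m + V\<^sup>2 \<le> 1.82 * m\<^sup>2 + 2.7225 * m\<^sup>2" using V2m by (rule add_mono)
    also have "\<dots> \<le> 7 * m\<^sup>2" by simp
    finally have "v * m + V\<^sup>2 \<le> 7 * m\<^sup>2" .
    then have "(v * m + V\<^sup>2) / (V\<^sup>2 * m\<^sup>2) \<le> 7 * m\<^sup>2 / (V\<^sup>2 * m\<^sup>2)" by (intro divide_right_mono) auto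
    moreover have "(v * m + V\<^sup>2) / (V\<^sup>2 * m\<^sup>2) = v / (V\<^sup>2 * m) + 1 / m\<^sup>2" "7 * m\<^sup>2 / (V\<^sup>2 * m\<^sup>2) = 7 / V\<^sup>2"
      using Vpos mpos by (simp_all add: field_simps power2_eq_square)
    ultimately show "v / (V\<^sup>2 * m) + 1 / m\<^sup>2 \<le> 7 / V\<^sup>2" by simp
    have Fk: "F \<le> k / m" using Fmk mpos by (simp add: field_simps)
    show "F / m \<le> 4 * k / V\<^sup>2"
    proof -
      have "F / m \<le> k / m / m" using Fk mpos by (intro divide_right_mono) auto
      also have "\<dots> = k * (1 / m\<^sup>2)" by (simp add: power2_eq_square)
      also have "\<dots> \<le> k * (4 / V\<^sup>2)"
      proof (rule mult_left_mono)
        have "2.7225 * m\<^sup>2 \<le> 4 * m\<^sup>2" by simp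
        with V2m have "V\<^sup>2 \<le> 4 * m\<^sup>2" by (rule order_trans)
        then show "1 / m\<^sup>2 \<le> 4 / V\<^sup>2" using mpos Vpos by (simp add: field_simps)
      qed (use kpos in simp)
      also have "\<dots> = 4 * k / V\<^sup>2" by simp
      finally show ?thesis .
    qed
    show "F * v / (V\<^sup>2 * m) + 2 * F / m\<^sup>2 \<le> 14 * k / V ^ 3"
    proof -
      have "F * v / (V\<^sup>2 * m) + 2 * F / m\<^sup>2 = F * (v / (V\<^sup>2 * m) + 2 / m\<^sup>2)" by (simp add: field_simps)
      also have "\<dots> \<le> (k / m) * (v / (V\<^sup>2 * m) + 2 / m\<^sup>2)" using Fk v mpos Vpos by (intro mult_right_mono) auto
      also have "\<dots> = k / V ^ 3 * ((v / m) * (V / m) + 2 * (V / m) ^ 3)"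
        using mpos Vpos by (simp add: field_simps power2_eq_square power3_eq_cube)
      also have "\<dots> \<le> k / V ^ 3 * (1.82 * 1.65 + 2 * 1.65 ^ 3)"
      proof -
        have "v / m \<le> 1.82" "V / m \<le> 1.65" using vm Vm mpos by (simp_all add: field_simps)
        then show ?thesis using kpos Vpos v mpos by (intro mult_left_mono add_mono mult_mono power_mono) auto
      qed
      also have "\<dots> \<le> k / V ^ 3 * 14" using kpos Vpos by (intro mult_left_mono) (auto simp: power3_eq_cube)
      finally show ?thesis by (simp only: times_divide_eq_left mult.commute[of k])
    qed
  qed (use nn in \<open>auto simp: B_def\<close>)
  also have "\<dots> = norm p * (14 * c1\<^sup>2 / V ^ 3 + 4 * c2 / V\<^sup>2) * a\<^sup>2 + 2 * (7 * c1 / V\<^sup>2) * a * norm b + 2 / V / norm p * (norm b)\<^sup>2"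
    unfolding B_def k_def by (simp add: field_simps)
  finally show ?thesis .
qed

context flight
begin

text \<open>Restricted to a line through (x, p), wind, integrand and air vector become curves in one
  variable. Differentiating the squared implicit equation along it supplies the hypotheses of
  \<open>implicit_second_derivative_bound\<close>.\<close>

lemma f2_upper_bound:
  assumes v: "v > 0" and p: "p \<noteq> 0"
    and c0: "norm (w x) \<le> c0" "c0 \<le> v / sqrt 5" and c1: "nD1 w x \<le> c1" and c2: "nD2 w x \<le> c2"
  defines "V \<equiv> sqrt (v\<^sup>2 - c0\<^sup>2)"
  shows "f2 (x, p) (a, b) (a, b) \<le> norm p * (14 * c1\<^sup>2 / V ^ 3 + 4 * c2 / V\<^sup>2) * (norm a)\<^sup>2
     + 2 * (7 * c1 / V\<^sup>2) * norm a * norm b + 2 / V / norm p * (norm b)\<^sup>2"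
proof -
  have pos: "v\<^sup>2 - w x \<bullet> w x > 0" for x using norm_lt_imp_inner_pos w_lt by blast
  let ?y = "(x, p)" and ?h = "(a, b)"
  obtain \<delta> where \<delta>: "\<delta> > 0" "\<And>s. \<bar>s\<bar> < \<delta> \<Longrightarrow> ?y + s *\<^sub>R ?h \<in> nonzero_velocity"
  proof -
    define \<delta> where "\<delta> = norm p / (norm b + 1)"
    have "norm b + 1 > 0" by (simp add: add_nonneg_pos)
    then have 1: "\<delta> > 0" using p by (simp add: \<delta>_def)
    have "p + s *\<^sub>R b \<noteq> 0" if "\<bar>s\<bar> < \<delta>" for s
    proof
      assume "p + s *\<^sub>R b = 0"
      then have "p = - (s *\<^sub>R b)" by (simp add: eq_neg_iff_add_eq_0)
      then have "norm p = \<bar>s\<bar> * norm b" by simp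
      also have "\<dots> \<le> \<bar>s\<bar> * (norm b + 1)" by (intro mult_left_mono) auto
      also have "\<dots> < \<delta> * (norm b + 1)" using that \<open>norm b + 1 > 0\<close> by (intro mult_strict_right_mono) auto
      also have "\<dots> = norm p" using \<open>norm b + 1 > 0\<close> by (simp add: \<delta>_def)
      finally show False by simp
    qed
    then show ?thesis using that[OF 1] by simp
  qed
  define F where "F s = ffp v w (?y + s *\<^sub>R ?h)" for s
  define F1 where "F1 s = f1 (?y + s *\<^sub>R ?h) ?h" for s
  define F2 where "F2 = f2 ?y ?h ?h"
  define W where "W s = w (x + s *\<^sub>R a)" for s
  define W1 where "W1 s = D1 w (x + s *\<^sub>R a) a" for s
  define W2 where "W2 = D2 w x a a"
  define P where "P s = p + s *\<^sub>R b" for s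
  have dF: "(F has_vector_derivative F1 s) (at s)" if "\<bar>s\<bar> < \<delta>" for s
    using directional_derivative_f[OF \<delta>(2)[OF that]] unfolding F_def[abs_def] F1_def by (simp add: has_real_derivative_iff_has_vector_derivative)
  have dF1: "(F1 has_vector_derivative F2) (at 0)"
    using directional_derivative_f1[OF \<delta>(2)[of 0], of ?h] \<delta>(1) unfolding F1_def[abs_def] F2_def by (simp add: has_real_derivative_iff_has_vector_derivative)
  have dW: "(W has_vector_derivative W1 s) (at s)" for s
    unfolding W_def[abs_def] W1_def by (rule has_vector_derivative_directional[OF C3_has_derivative_D1[OF w_C3]])
  have dW1: "(W1 has_vector_derivative W2) (at 0)"
  proof -
    have "((\<lambda>r. D1 w (x + r *\<^sub>R a) a) has_vector_derivative D2 w (x + 0 *\<^sub>R a) a a) (at 0)"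
      by (rule has_vector_derivative_directional[OF C3_has_derivative_D2[OF w_C3]])
    then show ?thesis unfolding W1_def[abs_def] W2_def by simp
  qed
  have dP: "(P has_vector_derivative b) (at s)" for s
    unfolding P_def[abs_def] by (auto intro!: derivative_eq_intros simp: has_vector_derivative_def)
  define q where "q s = P s - F s *\<^sub>R W s" for s
  define q1 where "q1 s = b - (F s *\<^sub>R W1 s + F1 s *\<^sub>R W s)" for s
  define q2 where "q2 = 0 - ((F 0 *\<^sub>R W2 + F1 0 *\<^sub>R W1 0) + (F1 0 *\<^sub>R W1 0 + F2 *\<^sub>R W 0))"
  have dscale: "((\<lambda>s. g s *\<^sub>R k s) has_vector_derivative (g s *\<^sub>R k' + g' *\<^sub>R k s)) (at s)"
    if "(g has_vector_derivative g') (at s)" "(k has_vector_derivative k') (at s)"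
    for g :: "real \<Rightarrow> real" and k :: "real \<Rightarrow> vec2" and g' k' s
    using bounded_bilinear.has_vector_derivative[OF bounded_bilinear_scaleR that] .
  have dq: "(q has_vector_derivative q1 s) (at s)" if "\<bar>s\<bar> < \<delta>" for s
    unfolding q_def[abs_def] q1_def by (intro has_vector_derivative_diff dP dscale dF dW that)
  have dq1: "(q1 has_vector_derivative q2) (at 0)"
    unfolding q1_def[abs_def] q2_def using \<delta>(1)
    by (intro has_vector_derivative_diff has_vector_derivative_add has_vector_derivative_const dscale dF dF1 dW dW1) auto
  have E0: "q s \<bullet> q s = v\<^sup>2 * (F s * F s)" for s
    using ff_implicit[of v w "x + s *\<^sub>R a" "P s", OF pos] unfolding q_def F_def P_def W_def by (simp add: power2_eq_square)
  have E1: "q s \<bullet> q1 s = v\<^sup>2 * (F s * F1 s)" if s: "\<bar>s\<bar> < \<delta>" for s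
  proof -
    have l: "((\<lambda>s. q s \<bullet> q s) has_real_derivative (q s \<bullet> q1 s + q1 s \<bullet> q s)) (at s)"
      by (intro has_real_derivative_inner dq s)
    have r: "((\<lambda>s. v\<^sup>2 * (F s * F s)) has_real_derivative v\<^sup>2 * (F s * F1 s + F1 s * F s)) (at s)"
      using dF[OF s] unfolding has_real_derivative_iff_has_vector_derivative[symmetric]
      by (auto intro!: derivative_eq_intros)
    have "q s \<bullet> q1 s + q1 s \<bullet> q s = v\<^sup>2 * (F s * F1 s + F1 s * F s)"
      using DERIV_unique[OF l[unfolded E0] r] .
    then show ?thesis by (simp add: inner_commute algebra_simps)
  qed
  have E2: "q 0 \<bullet> q2 + q1 0 \<bullet> q1 0 = v\<^sup>2 * (F 0 * F2 + F1 0 * F1 0)"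
  proof -
    have l: "((\<lambda>s. q s \<bullet> q1 s) has_real_derivative (q 0 \<bullet> q2 + q1 0 \<bullet> q1 0)) (at 0)"
      by (intro has_real_derivative_inner dq dq1) (use \<delta> in auto)
    have r: "((\<lambda>s. v\<^sup>2 * (F s * F1 s)) has_real_derivative v\<^sup>2 * (F 0 * F2 + F1 0 * F1 0)) (at 0)"
      using dF[of 0] dF1 \<delta>(1) unfolding has_real_derivative_iff_has_vector_derivative[symmetric]
      by (auto intro!: derivative_eq_intros simp: algebra_simps)
    \<comment> \<open>The first-order identity holds on a whole neighbourhood of 0, which is what
      allows it to be differentiated once more at 0.\<close>
    have "eventually (\<lambda>s. q s \<bullet> q1 s = v\<^sup>2 * (F s * F1 s)) (nhds 0)"
      unfolding eventually_nhds_metric using E1 \<delta>(1) by (auto simp: dist_real_def)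
    then have "((\<lambda>s. v\<^sup>2 * (F s * F1 s)) has_real_derivative (q 0 \<bullet> q2 + q1 0 \<bullet> q1 0)) (at 0)"
      by (rule DERIV_cong_ev[OF refl _ refl, THEN iffD1, OF _ l])
    from DERIV_unique[OF this r] show ?thesis .
  qed
  have n0: "norm (q 0) = v * F 0"
    using ff_norm[of w x v p] w_lt by (simp add: q_def F_def P_def W_def)
  have F0: "F 0 > 0"
  proof -
    have "F 0 \<ge> 0" unfolding F_def using ff_nonneg[of v w x p, OF pos] by simp
    moreover have "F 0 \<noteq> 0" using n0 p by (auto simp: q_def P_def)
    ultimately show ?thesis by simp
  qed
  have "F2 \<le> norm p * (14 * c1\<^sup>2 / sqrt (v\<^sup>2 - c0\<^sup>2) ^ 3 + 4 * c2 / (sqrt (v\<^sup>2 - c0\<^sup>2))\<^sup>2) * (norm a)\<^sup>2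
     + 2 * (7 * c1 / (sqrt (v\<^sup>2 - c0\<^sup>2))\<^sup>2) * norm a * norm b + 2 / sqrt (v\<^sup>2 - c0\<^sup>2) / norm p * (norm b)\<^sup>2"
  proof (rule implicit_second_derivative_bound[where q = "q 0" and F = "F 0" and w = "w x" and q' = "q1 0" and F' = "F1 0"
        and w' = "D1 w x a" and w'' = "D2 w x a a"])
    show "q 0 = p - F 0 *\<^sub>R w x" by (simp add: q_def P_def W_def)
    show "q1 0 = b - F1 0 *\<^sub>R w x - F 0 *\<^sub>R D1 w x a" by (simp add: q1_def W_def W1_def)
    show "q 0 \<bullet> q1 0 = v\<^sup>2 * (F 0 * F1 0)" using E1[of 0] \<delta>(1) by simp
    have q2e: "q2 = - F2 *\<^sub>R w x - (2 * F1 0) *\<^sub>R D1 w x a - F 0 *\<^sub>R D2 w x a a"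
      unfolding q2_def W_def W1_def W2_def by (simp only: mult_2 scaleR_add_left) (simp add: algebra_simps)
    show "q1 0 \<bullet> q1 0 + q 0 \<bullet> (- F2 *\<^sub>R w x - (2 * F1 0) *\<^sub>R D1 w x a - F 0 *\<^sub>R D2 w x a a) = v\<^sup>2 * ((F1 0)\<^sup>2 + F 0 * F2)"
      unfolding q2e[symmetric] using E2 by (simp add: power2_eq_square add.commute)
    show "norm (D1 w x a) \<le> c1 * norm a"
      using norm_D1_le[OF w_C3, of x a] mult_right_mono[OF c1, of "norm a"] by simp
    show "norm (D2 w x a a) \<le> c2 * (norm a)\<^sup>2"
      using norm_D2_le[OF w_C3, of x a a] mult_right_mono[OF c2, of "norm a * norm a"] by (simp add: power2_eq_square mult_ac)
    show "c1 \<ge> 0" using c1 by (rule order_trans[rotated]) (simp add: nD1_def sum_nonneg)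
    show "c2 \<ge> 0" using c2 by (rule order_trans[rotated]) (simp add: nD2_def sum_nonneg)
  qed (use n0 F0 v c0 in auto)
  then show ?thesis unfolding F2_def V_def .
qed

text \<open>The norm \<open>Z2n\<close> adds L2 norms instead of squares, so its square contains the
  mixed product that the middle term needs. The speed is the constant \<open>l\<close>; each term
  replaces it by whichever of the bounds \<open>Lt\<close> and \<open>L'\<close> is
  unfavourable.\<close>

lemma second_variation_upper_bound:
  assumes v: "v > 0" and c0: "c0 \<le> v / sqrt 5" and c12: "c1 \<ge> 0" "c2 \<ge> 0" and cs: "bounded_state cs" and K: "AE t in mu. pt cs t \<in> tube X l 0"
    and l: "0 < Lt" "Lt \<le> l" "l \<le> L'" and c0n: "c0 \<ge> 0"
    and \<Omega>: "AE t in mu. norm (w (sxi cs t)) \<le> c0 \<and> nD1 w (sxi cs t) \<le> c1 \<and> nD2 w (sxi cs t) \<le> c2"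
    and d: "indY d"
  defines "V \<equiv> sqrt (v\<^sup>2 - c0\<^sup>2)"
  shows "second_variation cs d d \<le> (7 * c1 / V\<^sup>2 + max (L' * (14 * c1\<^sup>2 / V ^ 3 + 4 * c2 / V\<^sup>2)) (2 / V / Lt)) * (Z2n d)\<^sup>2"
proof -
  have l0: "l > 0" using l by simp
  have "v / sqrt 5 < v" using v by (simp add: field_simps)
  then have "c0 < v" using c0 by simp
  then have V: "V > 0" unfolding V_def using c0n by (simp add: power_strict_mono)
  define b0 where "b0 = 14 * c1\<^sup>2 / V ^ 3 + 4 * c2 / V\<^sup>2"
  define b1 where "b1 = 7 * c1 / V\<^sup>2"
  have b: "b0 \<ge> 0" "b1 \<ge> 0" using c12 V by (auto simp: b0_def b1_def)
  have bd: "bounded_state d" using d indY_imp_bounded_state by blast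
  note L = bd[unfolded bounded_state_def]
  let ?A = "\<lambda>t. (norm (sxi d t))\<^sup>2" and ?B = "\<lambda>t. norm (sxi d t) * norm (sdxi d t)" and ?C = "\<lambda>t. (norm (sdxi d t))\<^sup>2"
  have int: "integrable mu ?A" "integrable mu ?B" "integrable mu ?C"
    using L by (auto intro!: integrable_Linf is_Linf_mult is_Linf_power2 is_Linf_norm)
  have "second_variation cs d d \<le> (\<integral>t. (l * b0) * ?A t + (2 * b1) * ?B t + (2 / V / l) * ?C t \<partial>mu)"
    unfolding second_variation_def
  proof (rule integral_mono_AE)
    show "integrable mu (\<lambda>t. f2 (pt cs t) (pt d t) (pt d t))"
      by (rule integrable_f2[OF cs is_Linf_pt[OF bd] is_Linf_pt[OF bd] K l0])
    show "integrable mu (\<lambda>t. (l * b0) * ?A t + (2 * b1) * ?B t + (2 / V / l) * ?C t)" using int by simp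
    show "AE t in mu. f2 (pt cs t) (pt d t) (pt d t) \<le> (l * b0) * ?A t + (2 * b1) * ?B t + (2 / V / l) * ?C t"
      using K \<Omega>
    proof eventually_elim
      case (elim t)
      have nl: "norm (sdxi cs t) = l" using elim(1) by (auto simp: tube_def pt_def)
      then have "sdxi cs t \<noteq> 0" using l0 by auto
      from f2_upper_bound[OF v this, of "sxi cs t" c0 c1 c2 "sxi d t" "sdxi d t"] elim(2) c0
      show ?case unfolding pt_def nl b0_def b1_def V_def by (simp add: mult.assoc)
    qed
  qed
  also have "\<dots> = (l * b0) * (L2n (sxi d))\<^sup>2 + (2 * b1) * (\<integral>t. ?B t \<partial>mu) + (2 / V / l) * (L2n (sdxi d))\<^sup>2"
    using int by (simp add: L2n_sq)
  also have "\<dots> \<le> (l * b0) * (L2n (sxi d))\<^sup>2 + (2 * b1) * (L2n (sxi d) * L2n (sdxi d)) + (2 / V / l) * (L2n (sdxi d))\<^sup>2"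
    using L b L2n_Cauchy_Schwarz[of "sxi d" "sdxi d"] by (intro add_mono order_refl mult_left_mono) auto
  also have "\<dots> \<le> (b1 + max (L' * b0) (2 / V / Lt)) * (L2n (sxi d) + L2n (sdxi d))\<^sup>2"
  proof -
    define M where "M = max (L' * b0) (2 / V / Lt)"
    define x where "x = L2n (sxi d)"
    define y where "y = L2n (sdxi d)"
    have xy: "x \<ge> 0" "y \<ge> 0" by (simp_all add: x_def y_def)
    have M1: "l * b0 \<le> M" unfolding M_def using l b by (simp add: le_max_iff_disj mult_right_mono)
    have "2 / V / l \<le> 2 / V / Lt" using l V by (intro divide_left_mono) auto
    then have M2: "2 / V / l \<le> M" unfolding M_def by simp
    have M0: "M \<ge> 0" using M1 b l0 by (meson mult_nonneg_nonneg less_imp_le order_trans)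
    have "(l * b0) * x\<^sup>2 + (2 * b1) * (x * y) + (2 / V / l) * y\<^sup>2 \<le> M * x\<^sup>2 + (2 * b1) * (x * y) + M * y\<^sup>2"
      using M1 M2 by (intro add_mono order_refl mult_right_mono) auto
    also have "\<dots> \<le> (b1 + M) * (x + y)\<^sup>2"
    proof -
      have "(b1 + M) * (x + y)\<^sup>2 - (M * x\<^sup>2 + (2 * b1) * (x * y) + M * y\<^sup>2) = b1 * (x\<^sup>2 + y\<^sup>2) + 2 * (M * (x * y))"
        by (simp add: power2_eq_square algebra_simps)
      moreover have "\<dots> \<ge> 0" using b M0 xy by simp
      ultimately show ?thesis by linarith
    qed
    finally show ?thesis unfolding M_def x_def y_def .
  qed
  also have "\<dots> \<le> (b1 + max (L' * b0) (2 / V / Lt)) * (Z2n d)\<^sup>2"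
  proof (intro mult_left_mono power_mono)
    have "0 \<le> L' * b0" using l b by simp
    then show "0 \<le> b1 + max (L' * b0) (2 / V / Lt)" using b by (simp add: le_max_iff_disj add_nonneg_nonneg)
  qed (auto simp: Z2n_def)
  finally show ?thesis unfolding b0_def b1_def .
qed

text \<open>The constant \<open>L\<close> is the length of the curve, so it is at least the
  distance. Conversely the straight segment is feasible, and comparing travel times, L / (v + c0)
  from below with Lt / (v - c0) from above, bounds the length.\<close>

lemma global_solution_length:
  assumes glob: "global_sol v w xO xD cs" and v: "v > 0" and c0: "c0 < v"
    and \<Omega>: "\<And>t. t \<in> {0..1} \<Longrightarrow> norm (w (sxi cs t)) \<le> c0"
    and line: "\<And>t. t \<in> {0..1} \<Longrightarrow> norm (w (xO + t *\<^sub>R (xD - xO))) \<le> c0"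
  shows "dist xO xD \<le> \<bar>sL cs\<bar>" "\<bar>sL cs\<bar> \<le> (v + c0) / (v - c0) * dist xO xD"
proof -
  have W: "W1inf (sxi cs) (sdxi cs)" "sxi cs 0 = xO" "sxi cs 1 = xD" and sp: "AE t in mu. norm (sdxi cs t) = \<bar>sL cs\<bar>"
    using glob unfolding global_sol_def feasible_def inZ_def AE_mu
    by (auto elim!: eventually_mono simp: norm_eq_sqrt_inner)
  have L: "is_Linf (sxi cs)" "is_Linf (sdxi cs)" using W1inf_imp_is_Linf[OF W(1)] by auto
  have nint: "(\<integral>t. norm (sdxi cs t) \<partial>mu) = \<bar>sL cs\<bar>"
  proof -
    have "(\<integral>t. norm (sdxi cs t) \<partial>mu) = (\<integral>t. \<bar>sL cs\<bar> \<partial>mu)"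
      by (rule integral_cong_AE) (use sp is_Linf_measurable[OF is_Linf_norm[OF L(2)]] in auto)
    then show ?thesis by simp
  qed
  have end1: "xD = xO + prim (sdxi cs) 1" using W unfolding W1inf_iff by (metis atLeastAtMost_iff order_refl zero_le_one)
  show "dist xO xD \<le> \<bar>sL cs\<bar>"
    using norm_prim_le[OF L(2), of 1] end1 nint by (simp add: dist_norm norm_minus_commute)
  have c0n: "c0 \<ge> 0" using order_trans[OF norm_ge_zero \<Omega>[of 0]] by simp
  define b where "b = \<lparr>sL = dist xO xD, sxi = (\<lambda>t. xO + t *\<^sub>R (xD - xO)), sdxi = (\<lambda>t. xD - xO), slam = (\<lambda>t. 0)\<rparr>"
  have prc: "prim (\<lambda>t. xD - xO) t = t *\<^sub>R (xD - xO)" if "t \<in> {0..1}" for t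
    using set_integral_eq_prim[OF that, of "\<lambda>t. xD - xO"] that by (simp add: set_integral_const)
  have "W1inf (sxi b) (sdxi b)"
    unfolding W1inf_iff b_def by (auto simp: is_Linf_const prc)
  then have "feasible xO xD b" unfolding feasible_def inZ_def b_def
    by (auto simp: dist_norm norm_minus_commute power2_norm_eq_inner[symmetric])
  then have TT: "TT v w (sxi cs) (sdxi cs) \<le> TT v w (sxi b) (sdxi b)" using glob unfolding global_sol_def by blast
  have I01_01: "t \<in> {0..1}" if "t \<in> space mu" for t :: real using that by (auto simp: I01_def)
  have lower: "\<bar>sL cs\<bar> / (v + c0) \<le> TT v w (sxi cs) (sdxi cs)"
  proof -
    have lo: "AE t in mu. \<bar>sL cs\<bar> / (v + c0) \<le> ff v w (sxi cs t) (sdxi cs t) \<and> ff v w (sxi cs t) (sdxi cs t) \<le> \<bar>sL cs\<bar> / (v - c0)"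
      using sp AE_space
    proof eventually_elim
      case (elim t)
      then show ?case using ff_bounds[of w "sxi cs t" v c0 "sdxi cs t"] w_lt \<Omega>[OF I01_01[OF elim(2)]] c0 by simp
    qed
    have "integrable mu (\<lambda>t. ff v w (sxi cs t) (sdxi cs t))"
    proof (rule mu.integrable_const_bound[where B = "\<bar>sL cs\<bar> / (v - c0)"])
      have "0 \<le> \<bar>sL cs\<bar> / (v + c0)" using v c0n by simp
      then show "AE t in mu. norm (ff v w (sxi cs t) (sdxi cs t)) \<le> \<bar>sL cs\<bar> / (v - c0)"
        by (intro eventually_mono[OF lo]) auto
      show "(\<lambda>t. ff v w (sxi cs t) (sdxi cs t)) \<in> borel_measurable mu"
        using measurable_compose[OF borel_measurable_Pair[OF L[THEN is_Linf_measurable]] ffp_measurable] by simp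
    qed
    then have "(\<integral>t. \<bar>sL cs\<bar> / (v + c0) \<partial>mu) \<le> (\<integral>t. ff v w (sxi cs t) (sdxi cs t) \<partial>mu)"
      using lo by (intro integral_mono_AE) (auto elim: eventually_mono)
    then show ?thesis unfolding TT_def set_integral_mu by simp
  qed
  have upper: "TT v w (sxi b) (sdxi b) \<le> dist xO xD / (v - c0)"
  proof -
    have up: "0 \<le> ff v w (sxi b t) (sdxi b t) \<and> ff v w (sxi b t) (sdxi b t) \<le> dist xO xD / (v - c0)" if "t \<in> space mu" for t
      using ff_bounds[of w "xO + t *\<^sub>R (xD - xO)" v c0 "xD - xO"] w_lt line[OF I01_01[OF that]] c0
        ff_nonneg[of v w, OF norm_lt_imp_inner_pos] unfolding b_def by (simp add: dist_norm norm_minus_commute)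
    have "integrable mu (\<lambda>t. ff v w (sxi b t) (sdxi b t))"
    proof (rule mu.integrable_const_bound[where B = "dist xO xD / (v - c0)"])
      show "AE t in mu. norm (ff v w (sxi b t) (sdxi b t)) \<le> dist xO xD / (v - c0)"
        using up by (intro AE_I2) (auto simp del: space_mu)
      have "(\<lambda>t. xO + t *\<^sub>R (xD - xO)) \<in> borel_measurable mu" by (rule borel_measurable_muI) measurable
      then show "(\<lambda>t. ff v w (sxi b t) (sdxi b t)) \<in> borel_measurable mu"
        using measurable_compose[OF borel_measurable_Pair[of "\<lambda>t. xO + t *\<^sub>R (xD - xO)" mu "\<lambda>t. xD - xO"] ffp_measurable]
        unfolding b_def by simp
    qed
    then have "(\<integral>t. ff v w (sxi b t) (sdxi b t) \<partial>mu) \<le> (\<integral>t. dist xO xD / (v - c0) \<partial>mu)"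
      using up by (intro integral_mono) (auto simp del: space_mu)
    then show ?thesis unfolding TT_def set_integral_mu by simp
  qed
  have "\<bar>sL cs\<bar> / (v + c0) \<le> dist xO xD / (v - c0)" using lower upper TT by linarith
  then show "\<bar>sL cs\<bar> \<le> (v + c0) / (v - c0) * dist xO xD" using v c0n c0 by (simp add: field_simps)
qed

end

section \<open>Convergence of the Newton iterates\<close>

context flight
begin

lemma FD_formula_sadd:
  assumes "bounded_state y" "bounded_state a" "bounded_state b" "bounded_state d" "AE t in mu. pt y t \<in> tube X l r" "r < l"
  shows "FD_formula y (sadd a b) d = FD_formula y a d + FD_formula y b d"
proof -
  note L = assms(1-4)[unfolded bounded_state_def]
  have i: "integrable mu (\<lambda>t. f2 (pt y t) (pt d t) (pt a t))" "integrable mu (\<lambda>t. f2 (pt y t) (pt d t) (pt b t))"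
    using integrable_f2[OF assms(1) _ _ assms(5,6)] is_Linf_pt assms(2-4) by blast+
  have j: "integrable mu (\<lambda>t. slam a t * constraint_form y d t)" "integrable mu (\<lambda>t. slam b t * constraint_form y d t)"
    "integrable mu (\<lambda>t. slam y t * constraint_form a d t)" "integrable mu (\<lambda>t. slam y t * constraint_form b d t)"
    "integrable mu (\<lambda>t. slam d t * constraint_form y a t)" "integrable mu (\<lambda>t. slam d t * constraint_form y b t)"
    using L by (auto intro!: integrable_Linf is_Linf_mult is_Linf_constraint_form)
  show ?thesis unfolding FD_formula_def using i j
    by (simp add: linear_add[OF linear_f2] distrib_left distrib_right)
qed

lemma FD_formula_sscale: "FD_formula y (sscale s a) d = s * FD_formula y a d"
proof -
  have "(\<integral>t. slam y t * (s * constraint_form a d t) \<partial>mu) = s * (\<integral>t. slam y t * constraint_form a d t \<partial>mu)"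
    "(\<integral>t. slam d t * (s * constraint_form y a t) \<partial>mu) = s * (\<integral>t. slam d t * constraint_form y a t \<partial>mu)"
    by (simp_all only: mult.left_commute[of _ s] integral_mult_right_zero)
  then show ?thesis unfolding FD_formula_def
    by (simp add: linear_scale[OF linear_f2] mult.assoc algebra_simps)
qed

end

section \<open>Neighbourhoods of the solution and comparison of constants\<close>

lemma Nbhd_bounds:
  assumes "y \<in> Nbhd xO xD R cs" "inY xO xD cs"
  shows "inY xO xD y" "indY (sdiff y cs)" "\<bar>sL (sdiff y cs)\<bar> \<le> R" "AE t in mu. norm (sdxi (sdiff y cs) t) \<le> R"
    "AE t in mu. \<bar>slam (sdiff y cs) t\<bar> \<le> R" "AE t in mu. norm (pt (sdiff y cs) t) \<le> 2 * R" "R \<ge> 0"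
proof -
  let ?e = "sdiff y cs"
  show y: "inY xO xD y" and e: "indY ?e" using assms indY_sdiff_inY by (auto simp: Nbhd_def)
  note L = indY_imp_bounded_state[OF e, unfolded bounded_state_def]
  have le: "\<bar>sL ?e\<bar> + Linf (sxi ?e) + Linf (sdxi ?e) + Linf (slam ?e) \<le> R"
    using assms(1) by (simp add: Nbhd_def Yinfn_def)
  have nn: "Linf (sxi ?e) \<ge> 0" "Linf (sdxi ?e) \<ge> 0" "Linf (slam ?e) \<ge> 0" using L by (auto intro: Linf_nonneg)
  show "\<bar>sL ?e\<bar> \<le> R" "R \<ge> 0" using le nn by linarith+
  have A: "AE t in mu. norm (sxi ?e t) \<le> Linf (sxi ?e)" "AE t in mu. norm (sdxi ?e t) \<le> Linf (sdxi ?e)"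
    "AE t in mu. norm (slam ?e t) \<le> Linf (slam ?e)" using L AE_Linf by blast+
  have r: "Linf (sxi ?e) \<le> R" "Linf (sdxi ?e) \<le> R" "Linf (slam ?e) \<le> R" using le nn by linarith+
  show "AE t in mu. norm (sdxi ?e t) \<le> R" using A(2) by eventually_elim (use r in linarith)
  show "AE t in mu. \<bar>slam ?e t\<bar> \<le> R" using A(3) by eventually_elim (use r in \<open>simp del: state_simps\<close>)
  show "AE t in mu. norm (pt ?e t) \<le> 2 * R" using A(1,2)
  proof eventually_elim
    case (elim t)
    then show ?case using norm_pt_le[of ?e t] r by linarith
  qed
qed

text \<open>The mirror image of an iterate keeps the boundary values and its distance, so the
  Lipschitz hypothesis may be applied to the pair.\<close>

lemma Nbhd_reflect:
  assumes "y \<in> Nbhd xO xD R cs" "inY xO xD cs"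
  shows "sadd cs (sscale (-1) (sdiff y cs)) \<in> Nbhd xO xD R cs"
proof -
  let ?y' = "sadd cs (sscale (-1) (sdiff y cs))"
  have "inY xO xD ?y'" using Nbhd_bounds(2)[OF assms] assms(2) by (intro inY_sadd indY_sscale)
  moreover have "Yinfn (sdiff ?y' cs) = Yinfn (sdiff y cs)"
  proof -
    have "sL (sdiff ?y' cs) = - sL (sdiff y cs)" "sxi (sdiff ?y' cs) = (\<lambda>t. - sxi (sdiff y cs) t)"
      "sdxi (sdiff ?y' cs) = (\<lambda>t. - sdxi (sdiff y cs) t)" "slam (sdiff ?y' cs) = (\<lambda>t. - slam (sdiff y cs) t)"
      by (auto simp: fun_eq_iff)
    then show ?thesis unfolding Yinfn_def Linf_def by (simp only: norm_minus_cancel abs_minus_cancel)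
  qed
  ultimately show ?thesis using assms(1) by (simp add: Nbhd_def)
qed

text \<open>Each summand is measured against one entry of the maximum, with coefficients 0.25,
  1.7384 and 0.6724. Their sum times 1.06 is about 2.8205, just below 2 sqrt 2; the 1.06 is reserved
  for the perturbation terms of the iteration.\<close>

lemma omega1_lower_bound:
  assumes pos: "Bl > 0" "c > 0" "0 < R" "R < c" "0 < Lt" and c0: "0 \<le> c0" "c0 < v"
    and B: "0 \<le> B0" "B0 \<le> Bb"
  shows "1.06 * (1 / Bl + (2 + 2 * sqrt (B0 / Bl)) / (4 * c / 5) + B0 / (4 * c / 5)\<^sup>2)
     \<le> 2 * omega1 Bl (kappaR c v c0 Lt R) Bb R"
proof -
  define k where "k = kappaR c v c0 Lt R"
  define i where "i = 1 / k"
  define M where "M = Max {4 / Bl, (1 / k) * (1 + 4 * (Bb + R) / Bl), (Bb + R) / k\<^sup>2}"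
  define \<rho> where "\<rho> = (v + c0) / (v - c0) + R / Lt"
  have "(v + c0) / (v - c0) \<ge> 1" using c0 by (simp add: field_simps)
  then have \<rho>: "\<rho> \<ge> 1" unfolding \<rho>_def using pos by (simp add: add_increasing2)
  \<comment> \<open>Since \<rho> \<ge> 1 the radicand is at least 2.375. So the \<kappa> of the
    theorem is at most c / 1.541, visibly smaller than the available 4 c / 5; this is the source of
    the factor 0.82.\<close>
  have sq: "sqrt (3/8 + 2 * \<rho>\<^sup>2) \<ge> 1.541"
  proof (rule real_le_rsqrt)
    have "1\<^sup>2 \<le> \<rho>\<^sup>2" using \<rho> by (intro power_mono) auto
    then show "1.541\<^sup>2 \<le> 3/8 + 2 * \<rho>\<^sup>2" by (simp add: power2_eq_square)
  qed
  have k: "k = (c - R) / sqrt (3/8 + 2 * \<rho>\<^sup>2)" by (simp add: k_def kappaR_def \<rho>_def)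
  have "0 < sqrt (3/8 + 2 * \<rho>\<^sup>2)" by (rule less_le_trans[OF _ sq]) simp
  then have kpos: "k > 0" unfolding k using pos by (intro divide_pos_pos) linarith+
  have ki: "1 / (4 * c / 5) \<le> 0.82 * i"
  proof -
    have "k \<le> c / 1.541" unfolding k using pos sq by (intro frac_le) auto
    then have "1.541 * k \<le> c" by (simp add: field_simps)
    then have "1.25 * k \<le> 0.82 * c" using kpos by simp
    then show ?thesis unfolding i_def using kpos pos by (simp add: field_simps)
  qed
  have ipos: "i > 0" using kpos by (simp add: i_def)
  have kk: "1 / (4 * c / 5) \<ge> 0" using pos by simp
  have i2: "(Bb + R) * i\<^sup>2 = (Bb + R) / k\<^sup>2" by (simp add: i_def power_divide)
  have M1: "4 / Bl \<le> M" and M2: "i * (1 + 4 * (Bb + R) / Bl) \<le> M"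
    unfolding M_def i_def by (rule Max_ge; simp)+
  have M3: "(Bb + R) * i\<^sup>2 \<le> M" unfolding i2 M_def by (rule Max_ge; simp)
  define t where "t = sqrt (B0 / Bl)"
  have t: "t \<ge> 0" "t\<^sup>2 = B0 / Bl" using B pos by (auto simp: t_def)
  \<comment> \<open>The quadratic 8.48 t^2 - 2 t has minimum - 1 / 8.48, which exceeds - 0.12. The
    term linear in \<open>t\<close> is thereby traded for a multiple of B0 / Bl, with only a slight
    increase of the constant 2.\<close>
  have tb: "2 + 2 * t \<le> 2.12 * (1 + 4 * (Bb + R) / Bl)"
  proof -
    have "2 + 2 * t \<le> 2.12 * (1 + 4 * t\<^sup>2)"
    proof -
      have "8.48 * (t - 1 / 8.48)\<^sup>2 \<ge> 0" by simp
      then show ?thesis by (simp add: power2_eq_square field_simps)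
    qed
    also have "\<dots> \<le> 2.12 * (1 + 4 * ((Bb + R) / Bl))" unfolding t(2) using B pos by (intro mult_left_mono add_left_mono divide_right_mono) auto
    finally show ?thesis by simp
  qed
  have A1: "1 / Bl \<le> 0.25 * M" using M1 by simp
  have A2: "(2 + 2 * t) / (4 * c / 5) \<le> 1.7384 * M"
  proof -
    have "(2 + 2 * t) / (4 * c / 5) = (2 + 2 * t) * (1 / (4 * c / 5))" by simp
    also have "\<dots> \<le> (2.12 * (1 + 4 * (Bb + R) / Bl)) * (0.82 * i)" using tb ki t kk by (intro mult_mono) auto
    also have "\<dots> = 1.7384 * (i * (1 + 4 * (Bb + R) / Bl))" by simp
    also have "\<dots> \<le> 1.7384 * M" using M2 by (intro mult_left_mono) auto
    finally show ?thesis .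
  qed
  have A3: "B0 / (4 * c / 5)\<^sup>2 \<le> 0.6724 * M"
  proof -
    have "B0 / (4 * c / 5)\<^sup>2 = B0 * (1 / (4 * c / 5))\<^sup>2" by (simp only: power_divide power_one) simp
    also have "\<dots> \<le> (Bb + R) * (0.82 * i)\<^sup>2" using ki kk B pos by (intro mult_mono power_mono) auto
    also have "\<dots> = 0.6724 * ((Bb + R) * i\<^sup>2)" by (simp add: power2_eq_square)
    also have "\<dots> \<le> 0.6724 * M" using M3 by (intro mult_left_mono) auto
    finally show ?thesis .
  qed
  have Mpos: "M \<ge> 0" using M1 pos by (meson divide_nonneg_pos order_trans zero_le_numeral)
  have "1.06 * (1 / Bl + (2 + 2 * t) / (4 * c / 5) + B0 / (4 * c / 5)\<^sup>2) \<le> 1.06 * (0.25 * M + 1.7384 * M + 0.6724 * M)"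
    using A1 A2 A3 by (intro mult_left_mono add_mono) auto
  also have "\<dots> \<le> 2 * (1.414 * M)" using Mpos by simp
  also have "\<dots> \<le> 2 * (sqrt 2 * M)"
    using Mpos by (intro mult_left_mono mult_right_mono real_le_rsqrt) (auto simp: power2_eq_square)
  also have "\<dots> = 2 * omega1 Bl k Bb R" by (simp add: omega1_def M_def)
  finally show ?thesis unfolding t_def k_def .
qed

text \<open>The factor 2 between 2 / V and 4 / V absorbs the passage from \<open>Lt\<close> to Lt +
  R, as long as R \<le> Lt.\<close>

lemma Bbar_lower_bound:
  assumes "0 < R" "R \<le> Lt" "0 \<le> c0" "c0 < v" "0 \<le> c1" "0 \<le> c2"
  defines "V \<equiv> sqrt (v\<^sup>2 - c0\<^sup>2)"
  shows "7 * c1 / V\<^sup>2 + max ((v + c0) / (v - c0) * Lt * (14 * c1\<^sup>2 / V ^ 3 + 4 * c2 / V\<^sup>2)) (2 / V / Lt)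
     \<le> Bbar v c0 c1 c2 Lt R"
proof -
  have V: "V > 0" unfolding V_def using assms by (simp add: power_strict_mono)
  have "(v + c0) / (v - c0) * Lt * (14 * c1\<^sup>2 / V ^ 3 + 4 * c2 / V\<^sup>2)
      \<le> ((v + c0) / (v - c0) * Lt + R) * (14 * c1\<^sup>2 / V ^ 3 + 4 * c2 / V\<^sup>2)"
    using assms V by (intro mult_right_mono) auto
  moreover have "2 / V / Lt \<le> 4 / V / (Lt + R)"
  proof -
    have "2 / Lt \<le> 4 / (Lt + R)" using assms by (simp add: field_simps)
    then have "2 / Lt / V \<le> 4 / (Lt + R) / V" using V by (intro divide_right_mono) auto
    then show ?thesis by (simp add: mult.commute)
  qed
  ultimately show ?thesis unfolding Bbar_def Let_def V_def[symmetric] by (intro add_left_mono max.mono)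
qed

lemma Linf_zero: "Linf (\<lambda>t. 0 :: 'a::euclidean_space) = 0"
  using Linf_leI[of 0 "\<lambda>t. 0 :: 'a"] Linf_nonneg[OF is_Linf_const[of "0::'a"]] by simp

lemma abs_le_of_quarter:
  fixes a b :: real
  assumes "\<bar>a - 1/4 * b\<bar> \<le> p" "1/4 * \<bar>b\<bar> \<le> q" shows "\<bar>a\<bar> \<le> q + p"
proof -
  have "\<bar>a\<bar> \<le> \<bar>a - 1/4 * b\<bar> + \<bar>1/4 * b\<bar>" using abs_triangle_ineq[of "a - 1/4 * b" "1/4 * b"] by simp
  also have "\<bar>1/4 * b\<bar> = 1/4 * \<bar>b\<bar>" by simp
  finally show ?thesis using assms by linarith
qed

context flight
begin

lemma newton_error_equation:
  assumes y: "bounded_state y" and Ky: "AE t in mu. pt y t \<in> tube X l r" "r < l"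
    and e: "bounded_state e" and \<Delta>: "bounded_state \<Delta>" and d: "bounded_state d"
    and step: "FD v w y \<Delta> d = - FF v w y d" and foc: "FF v w cs d = 0"
  shows "FD_formula y (sadd e \<Delta>) d = FD_formula y e d - (FF v w y d - FF v w cs d)"
  using FD_formula_sadd[OF y e \<Delta> d Ky] FD_eq[OF y d \<Delta> Ky] step foc by simp

text \<open>The value \<open>Bh\<close> is arbitrary and may be negative, so a lower bound has to
  come from the inequality itself. A change of \<open>L\<close> alone leaves curve and travel time
  untouched; only the term - L^2 of the constraint reacts, and its second derivative is known
  exactly.\<close>

lemma lipschitz_constant_ge:
  assumes cs: "inY xO xD cs" and K: "AE t in mu. pt cs t \<in> tube X l 0" "l > 0" and R: "R > 0"
    and lip: "\<forall>y1\<in>Nbhd xO xD R cs. \<forall>y2\<in>Nbhd xO xD R cs. \<forall>d. indY d \<longrightarrow>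
      \<bar>FD v w y2 (sdiff y2 y1) d - FD v w y1 (sdiff y2 y1) d\<bar> \<le> (8 + Bh) * R * Y2n (sdiff y2 y1) * Y2n d"
  shows "8 + Bh \<ge> 4"
proof -
  define E where "E s = \<lparr>sL = s, sxi = (\<lambda>t. 0), sdxi = (\<lambda>t. 0), slam = (\<lambda>t. 0)\<rparr>" for s
  define d where "d = \<lparr>sL = 0, sxi = (\<lambda>t. 0), sdxi = (\<lambda>t. 0), slam = (\<lambda>t. 1)\<rparr>"
  have W0: "W1inf (\<lambda>t. 0) (\<lambda>t. 0)" by (simp add: W1inf_iff is_Linf_const prim_def)
  have iE: "indY (E s)" for s unfolding indY_def indZ_def E_def using W0 by (simp add: is_Linf_const)
  have id: "indY d" unfolding indY_def indZ_def d_def using W0 by (simp add: is_Linf_const)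
  let ?y = "\<lambda>s. sadd cs (E s)"
  have N: "?y s \<in> Nbhd xO xD R cs" if "\<bar>s\<bar> \<le> R" for s
    using that inY_sadd[OF cs iE] by (simp add: Nbhd_def Yinfn_def E_def Linf_zero)
  have diff: "sdiff (?y R) (?y (- R)) = E (2 * R)" by (intro state_eqI) (auto simp: E_def)
  have b: "bounded_state (?y s)" "bounded_state (E s)" "bounded_state d" "bounded_state cs" for s
    using inY_imp_bounded_state[OF inY_sadd[OF cs iE]] indY_imp_bounded_state iE id inY_imp_bounded_state[OF cs] by blast+
  have ptE: "pt (?y s) t = pt cs t" "pt d t = 0" for s t by (simp_all add: pt_def E_def d_def zero_prod_def)
  have FDv: "FD v w (?y s) (E (2 * R)) d = - 4 * R * (sL cs + s)" for s
  proof -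
    have "FD v w (?y s) (E (2 * R)) d = FD_formula (?y s) (E (2 * R)) d"
      by (rule FD_eq[OF b(1) b(3) b(2) _ K(2)]) (use K(1) in \<open>simp add: ptE del: pt_simps\<close>)
    also have "\<dots> = - 4 * R * (sL cs + s)"
      unfolding FD_formula_def ptE linear_0[OF linear_f2_fst] by (simp add: constraint_form_def E_def d_def)
    finally show ?thesis .
  qed
  have "\<bar>FD v w (?y R) (E (2 * R)) d - FD v w (?y (- R)) (E (2 * R)) d\<bar> \<le> (8 + Bh) * R * Y2n (E (2 * R)) * Y2n d"
    using lip[rule_format, OF N[of "- R"] N[of R] id] R unfolding diff by simp
  moreover have "Y2n (E (2 * R)) = 2 * R" using R by (simp add: Y2n_def Z2n_def E_def)
  moreover have "Y2n d = 1" by (simp add: Y2n_def Z2n_def d_def L2n_const)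
  ultimately have "\<bar>- 4 * R * (sL cs + R) - (- 4 * R * (sL cs + - R))\<bar> \<le> (8 + Bh) * R * (2 * R) * 1"
    unfolding FDv by simp
  also have "- 4 * R * (sL cs + R) - (- 4 * R * (sL cs + - R)) = - (4 * (R * (2 * R)))" by (simp add: algebra_simps)
  finally have "4 * (R * (2 * R)) \<le> (8 + Bh) * (R * (2 * R))" using R by (simp add: mult.assoc)
  then show ?thesis by (rule mult_right_le_imp_le) (use R in simp)
qed

end

text \<open>The operator is inverted at the solution instead of at the iterate; the resulting
  multiple of the unknown error is moved to the left side.\<close>

lemma absorb_perturbation:
  fixes S N \<eta> x :: real
  assumes "x \<le> (N + \<eta> * x) * S" "S * \<eta> \<le> 0.01" "x \<ge> 0"
  shows "0.99 * x \<le> S * N"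
proof -
  have "x \<le> S * N + (S * \<eta>) * x" using assms(1) by (simp add: algebra_simps)
  also have "(S * \<eta>) * x \<le> 0.01 * x" using assms(2,3) by (intro mult_right_mono) auto
  finally show ?thesis by simp
qed

section \<open>Choice of the radius, convergence rate and uniqueness\<close>

theorem theorem17:
  fixes v :: real and w :: "vec2 \<Rightarrow> vec2" and xO xD :: vec2
    and \<Omega> :: "vec2 set" and ae :: real
    and c0 c1 c2 c3 :: real
    and cs :: state and Bl c :: real and u :: vec2
  assumes v_pos: "v > 0"
    and w_C3: "C3 w"
    and w_lt: "\<forall>x. norm (w x) < v"
    and Omega_ellipse: "ae > dist xO xD" "\<Omega> = {x. dist x xO + dist x xD \<le> ae}"
    and Omega_contains: "\<forall>b. global_sol v w xO xD b \<longrightarrow> (\<forall>t\<in>{0..1}. sxi b t \<in> \<Omega>)"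
    and c0: "Linf_bound_on \<Omega> (\<lambda>x. norm (w x)) c0" "c0 \<le> v / sqrt 5"
    and c1: "Linf_bound_on \<Omega> (nD1 w) c1"
    and c2: "Linf_bound_on \<Omega> (nD2 w) c2"
    and c3: "Linf_bound_on \<Omega> (nD3 w) c3"
    \<comment> \<open>\<chi>* = (z*, \<lambda>*) is a global solution of (P) with multiplier \<lambda>* = 0\<close>
    and glob: "global_sol v w xO xD cs"
    and lam0: "is_Linf (slam cs)" "AE t in lborel. t \<in> I01 \<longrightarrow> slam cs t = 0"
    \<comment> \<open>first order conditions F(\<chi>*) = 0\<close>
    and FOC: "\<forall>d. indY d \<longrightarrow> FF v w cs d = 0"
    \<comment> \<open>second order sufficient conditions\<close>
    and SOSC_infsup: "\<exists>k>0. \<forall>dl. is_L2 dl \<and> L2n dl \<noteq> 0 \<longrightarrow>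
          (\<forall>k'<k. \<exists>dz. indZ dz \<and> Z2n dz \<noteq> 0 \<and>
             set_lebesgue_integral lborel I01
               (\<lambda>t. dl t * (2 * (sdxi cs t \<bullet> sdxi dz t) - 2 * sL cs * sL dz))
             / (L2n dl * Z2n dz) \<ge> k')"
    and Bl_pos: "Bl > 0"
    and SOSC_coerc: "\<forall>dz. indZ dz \<and>
          (AE t in lborel. t \<in> I01 \<longrightarrow> sdxi dz t \<bullet> sdxi cs t = sL dz * sL cs)
          \<longrightarrow> TD2 v w cs dz \<ge> Bl * (Z2n dz)\<^sup>2"
    and c_pos: "c > 0" and u_unit: "norm u = 1"
    and u_dir: "AE t in lborel. t \<in> I01 \<longrightarrow> u \<bullet> sdxi cs t \<ge> c"
  shows "\<exists>RC>0.
     (\<forall>it::nat \<Rightarrow> state.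
        (\<forall>k. it k \<in> Nbhd xO xD RC cs) \<and>
        (\<forall>k. \<exists>\<Delta>. indY \<Delta> \<and> (\<forall>d. indY d \<longrightarrow> FD v w (it k) \<Delta> d = - FF v w (it k) d)
                 \<and> it (Suc k) = sadd (it k) \<Delta>)
        \<longrightarrow> ((\<lambda>k. Y2n (sdiff (it k) cs)) \<longlonglongrightarrow> 0)
          \<and> (\<forall>Bh. (\<forall>y1\<in>Nbhd xO xD RC cs. \<forall>y2\<in>Nbhd xO xD RC cs. \<forall>d. indY d \<longrightarrow>
                    \<bar>FD v w y2 (sdiff y2 y1) d - FD v w y1 (sdiff y2 y1) d\<bar>
                      \<le> (8 + Bh) * RC * Y2n (sdiff y2 y1) * Y2n d)
                 \<longrightarrow> (\<forall>k. Y2n (sdiff (it (Suc k)) cs)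
                        \<le> omega1 Bl (kappaR c v c0 (dist xO xD) RC)
                                  (Bbar v c0 c1 c2 (dist xO xD) RC) RC
                            * ((8 + Bh) * RC) / 2 * Y2n (sdiff (it k) cs))))
     \<and> (\<forall>y\<in>Nbhd xO xD RC cs. (\<forall>d. indY d \<longrightarrow> FF v w y d = 0) \<longrightarrow> Y2n (sdiff y cs) = 0)"
proof -
  obtain f1 f2 f3 where "C3_function nonzero_velocity (ffp v w) f1 f2 f3"
    using Ck_3_imp_C3_function[OF open_nonzero_velocity Ck_ffp[OF w_C3 w_lt]] by blast
  then interpret flight v w f1 f2 f3
    using w_C3 w_lt by (intro flight.intro flight_axioms.intro)

  define l where "l = \<bar>sL cs\<bar>"
  define Lt where "Lt = dist xO xD"
  define V where "V = sqrt (v\<^sup>2 - c0\<^sup>2)"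
  have feas: "feasible xO xD cs" using glob by (simp add: global_sol_def)
  have csY: "inY xO xD cs" using feas lam0 by (simp add: inY_def feasible_def)
  have csb: "bounded_state cs" by (rule inY_imp_bounded_state[OF csY])
  note Lcs = csb[unfolded bounded_state_def]
  have speed: "AE t in mu. norm (sdxi cs t) = l"
    using feas unfolding feasible_def AE_mu l_def by (auto elim!: eventually_mono simp: norm_eq_sqrt_inner)
  obtain X where "AE t in mu. norm (sxi cs t) \<le> X" using is_Linf_bound Lcs by blast
  with speed have K: "AE t in mu. pt cs t \<in> tube X l 0" by eventually_elim (simp add: tube_def pt_def)
  have lam: "AE t in mu. slam cs t = 0" using lam0 by (simp add: AE_mu)
  have dir: "AE t in mu. c \<le> u \<bullet> sdxi cs t" using u_dir by (simp add: AE_mu)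
  have on_Omega: "norm (w x) \<le> c0" "nD1 w x \<le> c1" "nD2 w x \<le> c2" if "x \<in> \<Omega>" for x
    using ellipse_bound_everywhere[OF Omega_ellipse _ _ that] c0(1) c1 c2 continuous_nD1[OF w_C3] continuous_nD2[OF w_C3]
      continuous_on_norm[OF cont_w] by blast+
  have cs_Omega: "sxi cs t \<in> \<Omega>" if "t \<in> {0..1}" for t using Omega_contains glob that by blast
  have "xO \<in> \<Omega>" using Omega_ellipse by simp
  have c0n: "c0 \<ge> 0" and c1n: "c1 \<ge> 0" and c2n: "c2 \<ge> 0"
    using on_Omega[OF \<open>xO \<in> \<Omega>\<close>] by (auto intro: order_trans[rotated] simp: nD1_def nD2_def sum_nonneg)
  have "v / sqrt 5 < v" using v_pos by (simp add: field_simps)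
  then have c0v: "c0 < v" using c0(2) by simp
  have line: "norm (w (xO + t *\<^sub>R (xD - xO))) \<le> c0" if "t \<in> {0..1}" for t
  proof (rule on_Omega(1))
    have "xO + t *\<^sub>R (xD - xO) - xD = (1 - t) *\<^sub>R (xO - xD)" by (simp add: algebra_simps)
    then have "dist (xO + t *\<^sub>R (xD - xO)) xO + dist (xO + t *\<^sub>R (xD - xO)) xD = t * dist xO xD + (1 - t) * dist xO xD"
      using that by (simp add: dist_norm norm_minus_commute)
    also have "\<dots> = dist xO xD" by (simp add: algebra_simps)
    finally show "xO + t *\<^sub>R (xD - xO) \<in> \<Omega>" using Omega_ellipse by simp
  qed
  have len: "Lt \<le> l" "l \<le> (v + c0) / (v - c0) * Lt"
    unfolding Lt_def l_def
    by (rule global_solution_length[OF glob v_pos c0v on_Omega(1)[OF cs_Omega] line]; assumption)+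
  \<comment> \<open>Integrating the direction condition gives c \<le> u . (xD - xO). In particular
    origin and destination are distinct, and the speed of the solution is positive.\<close>
  have cLt: "c \<le> Lt"
  proof -
    have "xD = xO + prim (sdxi cs) 1"
      using feas unfolding feasible_def inZ_def W1inf_iff by (metis atLeastAtMost_iff order_refl zero_le_one)
    then have "u \<bullet> (xD - xO) = (\<integral>t. u \<bullet> sdxi cs t \<partial>mu)"
      using integrable_Linf[of "sdxi cs"] Lcs by (simp add: prim_1)
    moreover have "(\<integral>t. c \<partial>mu) \<le> (\<integral>t. u \<bullet> sdxi cs t \<partial>mu)"
      using dir Lcs by (intro integral_mono_AE integrable_Linf is_Linf_inner is_Linf_const) auto
    moreover have "u \<bullet> (xD - xO) \<le> Lt"
      using norm_cauchy_schwarz[of u "xD - xO"] u_unit by (simp add: Lt_def dist_norm norm_minus_commute)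
    ultimately show ?thesis by simp
  qed
  have Lt0: "Lt > 0" and l0: "l > 0" using cLt c_pos len by linarith+

  \<comment> \<open>Both \<open>B\<close> and \<open>S\<close> refer to the solution alone and
    contain no radius, so the radius may be chosen in terms of \<open>S\<close> without
    circularity.\<close>
  define B where "B = 7 * c1 / V\<^sup>2 + max ((v + c0) / (v - c0) * Lt * (14 * c1\<^sup>2 / V ^ 3 + 4 * c2 / V\<^sup>2)) (2 / V / Lt)"
  define S where "S = 1 / Bl + (2 + 2 * sqrt (B / Bl)) / (4 * c / 5) + B / (4 * c / 5)\<^sup>2"
  have V0: "V > 0" unfolding V_def using c0v c0n by (simp add: power_strict_mono)
  have B0: "B \<ge> 0"
  proof -
    have "2 / V / Lt \<ge> 0" "7 * c1 / V\<^sup>2 \<ge> 0" using V0 Lt0 c1n by auto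
    then show ?thesis unfolding B_def by (simp add: le_max_iff_disj add_nonneg_nonneg)
  qed
  have S0: "S \<ge> 0" unfolding S_def using B0 Bl_pos c_pos by (intro add_nonneg_nonneg divide_nonneg_nonneg) auto
  have psd: "second_variation cs d d \<ge> 0" if "indY d" for d
    unfolding second_variation_def by (rule second_variation_nonneg[OF glob csb K l0 that])
  have bnd: "second_variation cs d d \<le> B * (Z2n d)\<^sup>2" if "indY d" for d
    unfolding B_def V_def
  proof (rule second_variation_upper_bound[OF v_pos c0(2) c1n c2n csb K Lt0 len c0n _ that])
    show "AE t in mu. norm (w (sxi cs t)) \<le> c0 \<and> nD1 w (sxi cs t) \<le> c1 \<and> nD2 w (sxi cs t) \<le> c2"
      using on_Omega cs_Omega by (intro AE_I2) (auto simp: I01_def)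
  qed
  have coer: "second_variation cs d d \<ge> Bl * (Z2n d)\<^sup>2" if d: "indY d" and ker: "AE t in mu. constraint_form cs d t = 0" for d
  proof -
    have "AE t in lborel. t \<in> I01 \<longrightarrow> sdxi d t \<bullet> sdxi cs t = sL d * sL cs"
      unfolding AE_mu using ker by eventually_elim (simp add: constraint_form_def inner_commute mult.commute)
    then have "TD2 v w cs d \<ge> Bl * (Z2n d)\<^sup>2" using SOSC_coerc d by (simp add: indY_def)
    then show ?thesis unfolding second_variation_def TD2_eq[OF csb indY_imp_bounded_state[OF d] K l0] .
  qed
  have speed': "AE t in mu. norm (sdxi cs t) \<le> \<bar>sL cs\<bar>" using speed by eventually_elim (simp add: l_def)
  have lift: "\<exists>d. indY d \<and> slam d = (\<lambda>t. 0) \<and> (AE t in mu. 2 * constraint_form cs d t = g t) \<and> Z2n d \<le> L2n g / (4 * c / 5)"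
    if "is_Linf g" for g
    using constraint_lift[OF _ c_pos u_unit dir speed' that] Lcs by blast
  have stab: "Y2n e \<le> N * S" if "indY e" "N \<ge> 0" "\<And>d. indY d \<Longrightarrow> \<bar>FD_formula cs e d\<bar> \<le> N * Y2n d" for e N
    unfolding S_def
    by (rule saddle_point_stability[OF csb K l0 lam psd bnd coer lift B0 Bl_pos _ that(2) that(1) that(3)]) (use c_pos in auto)

  obtain \<delta>1 where \<delta>1: "\<delta>1 > 0" "\<delta>1 \<le> l/4" "\<forall>y\<in>tube X l 0. \<forall>e d. norm e \<le> \<delta>1 \<longrightarrow>
     \<bar>f2 (y + e) d e - (f1 (y + e) d - f1 y d) - 1/4 * (f2 (y + e) d e - f2 (y - e) d e)\<bar> \<le> 0.01 * (norm e * norm e * norm d)"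
    using newton_defect_pointwise[OF l0, of "0.01" X] by auto
  \<comment> \<open>With 6 R \<le> \<epsilon> the total perturbation is at most 2 \<epsilon>, and S
    times that is at most 1/100.\<close>
  define \<epsilon> where "\<epsilon> = 1 / (200 * (S + 1))"
  have \<epsilon>0: "\<epsilon> > 0" using S0 by (simp add: \<epsilon>_def)
  have l4: "l/4 < l" using l0 by simp
  obtain \<delta>2 where \<delta>2: "\<delta>2 > 0" "\<forall>y\<in>tube X l (l/4). \<forall>z\<in>tube X l (l/4). dist y z < \<delta>2 \<longrightarrow>
      (\<forall>h k. \<bar>f2 y h k - f2 z h k\<bar> \<le> \<epsilon> * norm h * norm k)"
    using uniformly_continuous_f2[OF compact_tube[of X l "l/4"] tube_subset[OF l4] \<epsilon>0] by blast
  \<comment> \<open>The joint error in position and velocity can reach 2 R, hence \<delta>1 / 2 and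
    \<delta>2 / 4, the latter with room for a strict inequality. The bound c / 2 keeps
    \<open>kappaR\<close> positive, \<open>Lt\<close> serves \<open>Bbar_lower_bound\<close>, and
    \<epsilon> / 6 controls the constraint terms.\<close>
  define R where "R = Min {\<delta>1 / 2, \<delta>2 / 4, c / 2, Lt, \<epsilon> / 6}"
  have R: "R > 0" "2 * R \<le> \<delta>1" "2 * R < \<delta>2" "R < c" "R \<le> Lt" "6 * R \<le> \<epsilon>"
  proof -
    have "R \<le> \<delta>1 / 2" "R \<le> \<delta>2 / 4" "R \<le> c / 2" "R \<le> Lt" "R \<le> \<epsilon> / 6" unfolding R_def by (rule Min_le; simp)+
    moreover show "R > 0" unfolding R_def using \<delta>1 \<delta>2 c_pos Lt0 \<epsilon>0 by simp
    ultimately show "2 * R \<le> \<delta>1" "2 * R < \<delta>2" "R < c" "R \<le> Lt" "6 * R \<le> \<epsilon>" using \<delta>2 c_pos by auto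
  qed
  define \<eta> where "\<eta> = \<epsilon> + 6 * R"
  have \<eta>: "\<eta> \<ge> 0" "S * \<eta> \<le> 0.01" "S * R \<le> 0.01"
  proof -
    show "\<eta> \<ge> 0" using \<epsilon>0 R by (simp add: \<eta>_def)
    have "\<eta> \<le> 2 * \<epsilon>" using R by (simp add: \<eta>_def)
    then have "S * \<eta> \<le> S * (2 * \<epsilon>)" using S0 by (intro mult_left_mono) auto
    also have "\<dots> \<le> 0.01" using S0 by (simp add: \<epsilon>_def field_simps)
    finally show "S * \<eta> \<le> 0.01" .
    have "S * R \<le> S * \<epsilon>" using S0 R by (intro mult_left_mono) auto
    also have "\<dots> \<le> 0.01" using S0 by (simp add: \<epsilon>_def field_simps)
    finally show "S * R \<le> 0.01" .
  qed
  let ?N = "Nbhd xO xD R cs"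
  let ?e = "\<lambda>y. sdiff y cs"
  let ?r = "\<lambda>y. sadd cs (sscale (-1) (?e y))"

  have Ky: "AE t in mu. pt y t \<in> tube X l (l/4)" if "y \<in> ?N" for y
    using K Nbhd_bounds(6)[OF that csY]
  proof eventually_elim
    case (elim t)
    have "pt cs t + pt (?e y) t \<in> tube X l (0 + l/4)" by (rule tube_add[OF elim(1)]) (use elim(2) R \<delta>1 in linarith)
    then show ?case by simp
  qed
  have pert: "\<bar>FD_formula y h d - FD_formula cs h d\<bar> \<le> \<eta> * (Y2n h * Y2n d)" if y: "y \<in> ?N" and h: "bounded_state h" and d: "bounded_state d" for y h d
  proof -
    note nb = Nbhd_bounds[OF y csY]
    have "\<bar>FD_formula (sadd cs (?e y)) h d - FD_formula cs h d\<bar> \<le> (\<epsilon> + 6 * R) * (Y2n h * Y2n d)"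
      by (rule FD_formula_perturb[OF csb indY_imp_bounded_state[OF nb(2)] h d K l0 _ \<delta>2(2) R(3) _ nb(6) nb(7,4,3,5)])
        (use \<epsilon>0 R \<delta>1 in auto)
    then show ?thesis by (simp add: \<eta>_def)
  qed
  have defect: "\<bar>FD_formula y (?e y) d - (FF v w y d - FF v w cs d) - 1/4 * (FD_formula y (?e y) d - FD_formula (?r y) (?e y) d)\<bar>
      \<le> 0.02 * R * (Y2n (?e y) * Y2n d)" if y: "y \<in> ?N" and d: "bounded_state d" for y d
  proof -
    note nb = Nbhd_bounds[OF y csY]
    have "\<bar>FD_formula (sadd cs (?e y)) (?e y) d - (FF v w (sadd cs (?e y)) d - FF v w cs d)
        - 1/4 * (FD_formula (sadd cs (?e y)) (?e y) d - FD_formula (?r y) (?e y) d)\<bar> \<le> 0.01 * (2 * R) * (Z2n (?e y) * Z2n d)"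
      by (rule newton_defect[OF csb indY_imp_bounded_state[OF nb(2)] d K l0 _ \<delta>1(2,3) R(2) _ nb(6)]) (use R in auto)
    also have "\<dots> \<le> 0.01 * (2 * R) * (Y2n (?e y) * Y2n d)"
      using R by (intro mult_left_mono mult_mono Y2n_ge) (auto simp: Z2n_nonneg Y2n_nonneg)
    finally show ?thesis by simp
  qed
  have sym_pert: "\<bar>FD_formula y (?e y) d - FD_formula (?r y) (?e y) d\<bar> \<le> 2 * \<eta> * (Y2n (?e y) * Y2n d)"
    if y: "y \<in> ?N" and d: "bounded_state d" for y d
    using pert[OF y indY_imp_bounded_state[OF Nbhd_bounds(2)[OF y csY]] d]
      pert[OF Nbhd_reflect[OF y csY] indY_imp_bounded_state[OF Nbhd_bounds(2)[OF y csY]] d] by linarith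

  \<comment> \<open>The bound \<open>q\<close> for the symmetric difference is left open. It is
    instantiated by \<eta> for plain convergence and by (8 + Bh) R / 4 for the estimated
    rate.\<close>
  have contraction: "0.99 * Y2n (sdiff (sadd y \<Delta>) cs) \<le> S * (q * Y2n (?e y) + 0.02 * R * Y2n (?e y))"
    if y: "y \<in> ?N" and \<Delta>: "indY \<Delta>" and step: "\<And>d. indY d \<Longrightarrow> FD v w y \<Delta> d = - FF v w y d"
      and q: "q \<ge> 0" "\<And>d. indY d \<Longrightarrow> 1/4 * \<bar>FD_formula y (?e y) d - FD_formula (?r y) (?e y) d\<bar> \<le> q * (Y2n (?e y) * Y2n d)"
    for y \<Delta> q
  proof -
    note nb = Nbhd_bounds[OF y csY]
    define e' where "e' = sdiff (sadd y \<Delta>) cs"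
    have e'_eq: "e' = sadd (?e y) \<Delta>" unfolding e'_def by (intro state_eqI) (auto simp: fun_eq_iff)
    have e': "indY e'" unfolding e'_eq by (rule indY_sadd[OF nb(2) \<Delta>])
    let ?M = "q * Y2n (?e y) + 0.02 * R * Y2n (?e y)"
    \<comment> \<open>Stability is available for the operator at the solution, while the Newton
      equation holds at the iterate. The exchange costs \<eta> times the new error, which is
      absorbed afterwards.\<close>
    have "Y2n e' \<le> (?M + \<eta> * Y2n e') * S"
    proof (rule stab[OF e'])
      show "0 \<le> ?M + \<eta> * Y2n e'" using q \<eta> R by (intro add_nonneg_nonneg mult_nonneg_nonneg Y2n_nonneg) auto
      fix d assume d: "indY d"
      note db = indY_imp_bounded_state[OF d]
      have eqn: "FD_formula y e' d = FD_formula y (?e y) d - (FF v w y d - FF v w cs d)"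
        unfolding e'_eq
        by (rule newton_error_equation[OF inY_imp_bounded_state[OF nb(1)] Ky[OF y] l4 indY_imp_bounded_state[OF nb(2)] indY_imp_bounded_state[OF \<Delta>] db step[OF d]])
          (use FOC d in blast)
      have "\<bar>FD_formula y e' d\<bar> \<le> q * (Y2n (?e y) * Y2n d) + 0.02 * R * (Y2n (?e y) * Y2n d)"
        unfolding eqn by (rule abs_le_of_quarter[OF defect[OF y db] q(2)[OF d]])
      moreover have "\<bar>FD_formula y e' d - FD_formula cs e' d\<bar> \<le> \<eta> * (Y2n e' * Y2n d)"
        by (rule pert[OF y indY_imp_bounded_state[OF e'] db])
      ultimately have "\<bar>FD_formula cs e' d\<bar> \<le> q * (Y2n (?e y) * Y2n d) + 0.02 * R * (Y2n (?e y) * Y2n d) + \<eta> * (Y2n e' * Y2n d)"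
        by linarith
      then show "\<bar>FD_formula cs e' d\<bar> \<le> (?M + \<eta> * Y2n e') * Y2n d" by (simp add: algebra_simps)
    qed
    from absorb_perturbation[OF this \<eta>(2) Y2n_nonneg] show ?thesis unfolding e'_def .
  qed

  show ?thesis
  proof (intro exI[of _ R] conjI allI impI ballI R(1))
    fix it :: "nat \<Rightarrow> state"
    assume it: "(\<forall>k. it k \<in> ?N) \<and> (\<forall>k. \<exists>\<Delta>. indY \<Delta> \<and> (\<forall>d. indY d \<longrightarrow> FD v w (it k) \<Delta> d = - FF v w (it k) d)
                 \<and> it (Suc k) = sadd (it k) \<Delta>)"
    \<comment> \<open>Uniform continuity and the smallness of \<open>R\<close> suffice here; no
      Lipschitz constant is given yet. The factor 1/2 is generous, the actual one being little above
      0.01.\<close>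
    have half: "Y2n (?e (it (Suc k))) \<le> 1/2 * Y2n (?e (it k))" for k
    proof -
      obtain \<Delta> where \<Delta>: "indY \<Delta>" "\<And>d. indY d \<Longrightarrow> FD v w (it k) \<Delta> d = - FF v w (it k) d" "it (Suc k) = sadd (it k) \<Delta>"
        using it by blast
      have y: "it k \<in> ?N" using it by blast
      have "0.99 * Y2n (?e (it (Suc k))) \<le> S * (\<eta> * Y2n (?e (it k)) + 0.02 * R * Y2n (?e (it k)))"
        unfolding \<Delta>(3)
      proof (rule contraction[OF y \<Delta>(1,2) \<eta>(1)])
        fix d assume "indY d"
        then have "\<bar>FD_formula (it k) (?e (it k)) d - FD_formula (?r (it k)) (?e (it k)) d\<bar> \<le> 2 * (\<eta> * (Y2n (?e (it k)) * Y2n d))"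
          using sym_pert[OF y indY_imp_bounded_state] by (simp only: mult.assoc)
        moreover have "0 \<le> \<eta> * (Y2n (?e (it k)) * Y2n d)" using \<eta> by (intro mult_nonneg_nonneg Y2n_nonneg)
        ultimately show "1/4 * \<bar>FD_formula (it k) (?e (it k)) d - FD_formula (?r (it k)) (?e (it k)) d\<bar> \<le> \<eta> * (Y2n (?e (it k)) * Y2n d)"
          by simp
      qed
      also have "\<dots> = (S * \<eta> + 0.02 * (S * R)) * Y2n (?e (it k))" by (simp add: algebra_simps)
      also have "\<dots> \<le> (0.01 + 0.02 * 0.01) * Y2n (?e (it k))"
        using \<eta> by (intro mult_right_mono add_mono mult_left_mono Y2n_nonneg) auto
      finally show ?thesis using Y2n_nonneg[of "?e (it k)"] by simp
    qed
    show "(\<lambda>k. Y2n (?e (it k))) \<longlonglongrightarrow> 0"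
    proof (rule tendsto_sandwich[of "\<lambda>_. 0" _ _ "\<lambda>k. (1/2) ^ k * Y2n (?e (it 0))"])
      have "Y2n (?e (it k)) \<le> (1/2) ^ k * Y2n (?e (it 0))" for k
      proof (induction k)
        case (Suc k)
        have "Y2n (?e (it (Suc k))) \<le> 1/2 * Y2n (?e (it k))" by (rule half)
        also have "\<dots> \<le> 1/2 * ((1/2) ^ k * Y2n (?e (it 0)))" using Suc by (intro mult_left_mono) auto
        finally show ?case by simp
      qed simp
      then show "\<forall>\<^sub>F k in sequentially. Y2n (?e (it k)) \<le> (1/2) ^ k * Y2n (?e (it 0))" by simp
      show "(\<lambda>k. (1/2) ^ k * Y2n (?e (it 0))) \<longlonglongrightarrow> 0"
        by (intro tendsto_mult_left_zero LIMSEQ_power_zero) auto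
    qed (auto simp: Y2n_nonneg)
    fix Bh k
    assume lip: "\<forall>y1\<in>?N. \<forall>y2\<in>?N. \<forall>d. indY d \<longrightarrow>
        \<bar>FD v w y2 (sdiff y2 y1) d - FD v w y1 (sdiff y2 y1) d\<bar> \<le> (8 + Bh) * R * Y2n (sdiff y2 y1) * Y2n d"
    have Bh: "8 + Bh \<ge> 4" by (rule lipschitz_constant_ge[OF csY K l0 R(1) lip])
    obtain \<Delta> where \<Delta>: "indY \<Delta>" "\<And>d. indY d \<Longrightarrow> FD v w (it k) \<Delta> d = - FF v w (it k) d" "it (Suc k) = sadd (it k) \<Delta>"
      using it by blast
    have y: "it k \<in> ?N" using it by blast
    note nb = Nbhd_bounds[OF y csY] and y' = Nbhd_reflect[OF y csY]
    let ?n = "Y2n (?e (it k))"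
    have "0.99 * Y2n (?e (it (Suc k))) \<le> S * ((8 + Bh) * R / 4 * ?n + 0.02 * R * ?n)"
      unfolding \<Delta>(3)
    proof (rule contraction[OF y \<Delta>(1,2)])
      show "0 \<le> (8 + Bh) * R / 4" using Bh R by simp
      fix d assume d: "indY d"
      note db = indY_imp_bounded_state[OF d] and eb = indY_imp_bounded_state[OF nb(2)]
      \<comment> \<open>The iterate and its mirror image differ by twice the error, and this 2
        cancels on both sides of the hypothesis.\<close>
      have D: "sdiff (it k) (?r (it k)) = sscale 2 (?e (it k))"
        by (intro state_eqI) (auto simp: fun_eq_iff algebra_simps scaleR_2)
      have FDa: "FD v w a (sscale 2 (?e (it k))) d = 2 * FD_formula a (?e (it k)) d" if a: "a \<in> ?N" for a
        using FD_eq[OF inY_imp_bounded_state[OF Nbhd_bounds(1)[OF a csY]] db bounded_state_sscale[OF eb] Ky[OF a] l4] FD_formula_sscale by simp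
      have "\<bar>2 * FD_formula (it k) (?e (it k)) d - 2 * FD_formula (?r (it k)) (?e (it k)) d\<bar> \<le> (8 + Bh) * R * (2 * ?n) * Y2n d"
        using lip[rule_format, OF y' y d] unfolding D FDa[OF y] FDa[OF y'] Y2n_sscale by simp
      moreover have "(8 + Bh) * R * (2 * ?n) * Y2n d = 2 * ((8 + Bh) * R * (?n * Y2n d))" by simp
      ultimately have "\<bar>FD_formula (it k) (?e (it k)) d - FD_formula (?r (it k)) (?e (it k)) d\<bar> \<le> (8 + Bh) * R * (?n * Y2n d)"
        by linarith
      then show "1/4 * \<bar>FD_formula (it k) (?e (it k)) d - FD_formula (?r (it k)) (?e (it k)) d\<bar> \<le> (8 + Bh) * R / 4 * (?n * Y2n d)"
        by simp
    qed
    \<comment> \<open>Here 8 + Bh \<ge> 4 pays off: the Taylor remainder, proportional to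
      \<open>R\<close>, is at most 2 percent of the main term.\<close>
    also have "\<dots> \<le> S * ((8 + Bh) * R / 4 * ?n + 0.02 * ((8 + Bh) * R / 4) * ?n)"
      using S0 Bh R by (intro mult_left_mono add_left_mono mult_right_mono Y2n_nonneg) auto
    also have "\<dots> = 1.02 * (S * ((8 + Bh) * R / 4 * ?n))"
    proof -
      have "S * (z * n + 0.02 * z * n) = 1.02 * (S * (z * n))" for z n :: real by (simp add: algebra_simps)
      then show ?thesis .
    qed
    finally have 1: "0.99 * Y2n (?e (it (Suc k))) \<le> 1.02 * (S * ((8 + Bh) * R / 4 * ?n))" .
    have pos: "0 \<le> (8 + Bh) * R / 4 * ?n" using Bh R Y2n_nonneg[of "?e (it k)"] by simp
    then have "0 \<le> S * ((8 + Bh) * R / 4 * ?n)" using S0 by simp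
    \<comment> \<open>The quotient 1.02 / 0.99 is below 1.04, comfortably within the factor 1.06
      granted by \<open>omega1_lower_bound\<close>.\<close>
    moreover have "x \<le> 1.06 * z" if "0.99 * x \<le> 1.02 * z" "0 \<le> z" for x z :: real using that by simp
    ultimately have "Y2n (?e (it (Suc k))) \<le> 1.06 * (S * ((8 + Bh) * R / 4 * ?n))" using 1 by blast
    also have "\<dots> = (1.06 * S) * ((8 + Bh) * R / 4 * ?n)" by simp
    also have "\<dots> \<le> (2 * omega1 Bl (kappaR c v c0 Lt R) (Bbar v c0 c1 c2 Lt R) R) * ((8 + Bh) * R / 4 * ?n)"
    proof (rule mult_right_mono[OF _ pos])
      show "1.06 * S \<le> 2 * omega1 Bl (kappaR c v c0 Lt R) (Bbar v c0 c1 c2 Lt R) R"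
        unfolding S_def
      proof (rule omega1_lower_bound[OF Bl_pos c_pos R(1,4) Lt0 c0n c0v B0])
        show "B \<le> Bbar v c0 c1 c2 Lt R"
          unfolding B_def V_def by (rule Bbar_lower_bound[OF R(1,5) c0n c0v c1n c2n])
      qed
    qed
    also have "\<dots> = omega1 Bl (kappaR c v c0 Lt R) (Bbar v c0 c1 c2 Lt R) R * ((8 + Bh) * R) / 2 * ?n"
      by (simp add: field_simps)
    finally show "Y2n (?e (it (Suc k))) \<le> omega1 Bl (kappaR c v c0 (dist xO xD) R) (Bbar v c0 c1 c2 (dist xO xD) R) R
        * ((8 + Bh) * R) / 2 * Y2n (?e (it k))"
      unfolding Lt_def .
  next
    fix y assume y: "y \<in> ?N" and F0: "\<forall>d. indY d \<longrightarrow> FF v w y d = 0"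
    note nb = Nbhd_bounds[OF y csY]
    let ?n = "Y2n (?e y)"
    \<comment> \<open>For a second zero the difference of the residuals vanishes, so the defect
      estimate bounds the derivative at \<open>y\<close> applied to the error itself. Stability then
      bounds the error by a fraction of itself.\<close>
    have "?n \<le> ((\<eta> / 2 + 0.02 * R) * ?n + \<eta> * ?n) * S"
    proof (rule stab[OF nb(2)])
      show "0 \<le> (\<eta> / 2 + 0.02 * R) * ?n + \<eta> * ?n"
        using \<eta> R by (intro add_nonneg_nonneg mult_nonneg_nonneg Y2n_nonneg) auto
      fix d assume d: "indY d"
      note db = indY_imp_bounded_state[OF d]
      have z: "FF v w y d = 0" "FF v w cs d = 0" using F0 FOC d by auto
      have "1/4 * \<bar>FD_formula y (?e y) d - FD_formula (?r y) (?e y) d\<bar> \<le> \<eta> / 2 * (?n * Y2n d)"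
        using sym_pert[OF y db] by simp
      from abs_le_of_quarter[OF defect[OF y db] this]
      have "\<bar>FD_formula y (?e y) d\<bar> \<le> \<eta> / 2 * (?n * Y2n d) + 0.02 * R * (?n * Y2n d)"
        by (simp only: z diff_self diff_zero)
      then have "\<bar>FD_formula cs (?e y) d\<bar> \<le> \<eta> / 2 * (?n * Y2n d) + 0.02 * R * (?n * Y2n d) + \<eta> * (?n * Y2n d)"
        using pert[OF y indY_imp_bounded_state[OF nb(2)] db] by linarith
      then show "\<bar>FD_formula cs (?e y) d\<bar> \<le> ((\<eta> / 2 + 0.02 * R) * ?n + \<eta> * ?n) * Y2n d" by (simp add: algebra_simps)
    qed
    also have "\<dots> = (1.5 * (S * \<eta>) + 0.02 * (S * R)) * ?n" by (simp add: algebra_simps)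
    also have "\<dots> \<le> (1.5 * 0.01 + 0.02 * 0.01) * ?n"
      using \<eta> by (intro mult_right_mono add_mono mult_left_mono Y2n_nonneg) auto
    finally show "?n = 0" using Y2n_nonneg[of "?e y"] by simp
  qed
qed

end
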